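(* Let $n\ge 2$, let $1<p\le q\le np/(n-p)<\infty$ and $\beta<p-1$. If $G\subset\mathbb{R}^n$ is a non-empty open set with non-empty boundary and $$\overline{\dim}_A(G^c)<n-p+\beta\quad\text{or}\quad \underline{\dim}_A(G^c)>n-p+\beta,$$ then $G$ admits a $(q,p,\beta)$-Hardy--Sobolev inequality; in the latter case, if $G$ is unbounded, then it is required that also $G^c$ is unbounded.
   Context: $G^c=\mathbb{R}^n\setminus G$, $\delta_{\partial G}(x)=\operatorname{dist}(x,\partial G)$, $B(x,R)$ is the open ball, $d(E)$ is the diameter of $E$, and $C_0^\infty(G)$ denotes smooth functions with compact support in $G$. An open set $G$ admits a $(q,p,\beta)$-Hardy--Sobolev inequality if there is a constant $C>0$ such that $$\biggl(\int_{G} |f|^q \,\delta_{\partial G}^{(q/p)(n-p+\beta)-n}\,dx\biggr)^{1/q}\le C \biggl(\int_G |\nabla f|^p\,\delta_{\partial G}^{\beta}\,dx\biggr)^{1/p}$$ for all $f\in C_0^\infty(G)$. For bounded $A\subset\mathbb{R}^n$ and $r>0$, $N(A,r)$ is the minimal number of open balls of radius $r$ centered at points of $A$ needed to cover $A$. The upper Assouad dimension is $\overline{\dim}_A(E)=\inf\{\lambda\ge 0:\ \exists\, C_\lambda>0 \text{ such that } N(E\cap B(x,R),r)\le C_\lambda (r/R)^{-\lambda}\text{ for all } x\in E,\ 0<r<R<d(E)\}$. The lower Assouad dimension is $\underline{\dim}_A(E)=\sup\{\lambda\ge 0:\ \exists\, c_\lambda>0 \text{ such that } N(E\cap B(x,R),r)\ge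 c_\lambda (r/R)^{-\lambda}\text{ for all } x\in E,\ 0<r<R<d(E)\}$. *)

theory Defs
  imports "HOL-Analysis.Analysis"
begin

section \<open>Smooth functions with compact support\<close>

text \<open>By induction on the order, \<open>f\<close> is of class \<open>C\<^sup>k\<^sup>+\<^sup>1\<close> iff it is (Frechet)
  differentiable and all its first-order partial derivatives are of class \<open>C\<^sup>k\<close>.\<close>

primrec class_C :: "nat \<Rightarrow> ('a::euclidean_space \<Rightarrow> real) \<Rightarrow> bool" where
  "class_C 0 f \<longleftrightarrow> continuous_on UNIV f"
| "class_C (Suc k) f \<longleftrightarrow>
     (\<forall>x. f differentiable (at x)) \<and>
     (\<forall>b\<in>Basis. class_C k (\<lambda>x. frechet_derivative f (at x) b))"

definition smooth :: "('a::euclidean_space \<Rightarrow> real) \<Rightarrow> bool" where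
  "smooth f \<longleftrightarrow> (\<forall>k. class_C k f)"

text \<open>A function in \<open>C\<^sub>0\<^sup>\<infinity>(G)\<close> is identified with its extension by zero to the whole
  space, so that the closure below, taken in the whole space, is its support.\<close>

definition test_functions :: "'a::euclidean_space set \<Rightarrow> ('a \<Rightarrow> real) set" where
  "test_functions G =
     {f. smooth f \<and> compact (closure {x. f x \<noteq> 0}) \<and> closure {x. f x \<noteq> 0} \<subseteq> G}"

definition gradient :: "('a::euclidean_space \<Rightarrow> real) \<Rightarrow> 'a \<Rightarrow> 'a" where
  "gradient f x = (\<Sum>b\<in>Basis. frechet_derivative f (at x) b *\<^sub>R b)"


section \<open>The Hardy--Sobolev inequality\<close>

text \<open>The dimension \<open>n\<close> is \<open>DIM('a)\<close>. The notion is meant for open \<open>G\<close> with non-empty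
  boundary. Then the distance to the boundary is positive and continuous on \<open>G\<close>, hence bounded
  away from zero on the support of a test function, so both Bochner integrals are integrals of
  integrable functions (for \<open>p, q > 0\<close>) and never take the default value 0.\<close>

definition admits_Hardy_Sobolev ::
  "real \<Rightarrow> real \<Rightarrow> real \<Rightarrow> 'a::euclidean_space set \<Rightarrow> bool" where
  "admits_Hardy_Sobolev q p \<beta> G \<longleftrightarrow>
     (\<exists>C>0. \<forall>f\<in>test_functions G.
        (LINT x:G|lborel. \<bar>f x\<bar> powr q *
            infdist x (frontier G) powr ((q / p) * (real DIM('a) - p + \<beta>) - real DIM('a)))
          powr (1 / q)
        \<le> C * (LINT x:G|lborel. norm (gradient f x) powr p * infdist x (frontier G) powr \<beta>)
          powr (1 / p))"


section \<open>Assouad dimensions\<close>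

text \<open>For bounded \<open>A\<close> and \<open>r > 0\<close> in a Euclidean space, finite covers exist, so the minimum
  is attained.\<close>

definition covering_number :: "'a::metric_space set \<Rightarrow> real \<Rightarrow> nat" where
  "covering_number A r =
     (LEAST k. \<exists>F. finite F \<and> F \<subseteq> A \<and> card F = k \<and> A \<subseteq> (\<Union>x\<in>F. ball x r))"

text \<open>The library's \<^const>\<open>diameter\<close> is real-valued and meaningful for bounded sets only.\<close>

definition ediameter :: "'a::metric_space set \<Rightarrow> ereal" where
  "ediameter E = (if bounded E then ereal (diameter E) else \<infinity>)"

definition upper_Assouad_dim :: "'a::metric_space set \<Rightarrow> ereal" where
  "upper_Assouad_dim E = Inf (ereal ` {l. 0 \<le> l \<and>
     (\<exists>C>0. \<forall>x\<in>E. \<forall>r R. 0 < r \<and> r < R \<and> ereal R < ediameter E \<longrightarrow>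
        real (covering_number (E \<inter> ball x R) r) \<le> C * (r / R) powr (- l))})"

definition lower_Assouad_dim :: "'a::metric_space set \<Rightarrow> ereal" where
  "lower_Assouad_dim E = Sup (ereal ` {l. 0 \<le> l \<and>
     (\<exists>c>0. \<forall>x\<in>E. \<forall>r R. 0 < r \<and> r < R \<and> ereal R < ediameter E \<longrightarrow>
        real (covering_number (E \<inter> ball x R) r) \<ge> c * (r / R) powr (- l))})"

end

theory Submission
  imports Defs
begin

text \<open>Write \<open>d(x)\<close> for the distance of \<open>x\<close> to the complement of \<open>G\<close>, which for \<open>x \<in> G\<close> is the distance
to the boundary, and put \<open>s = p - 1 - \<beta> > 0\<close>. Both alternatives on the dimension are used only to
prove the \<open>L\<^sup>1\<close> inequality
  \<open>\<integral> |f| d\<^sup>-\<^sup>s\<^sup>-\<^sup>1 \<le> C \<integral> |\<nabla>f| d\<^sup>-\<^sup>s\<close>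
(\<open>Hardy_L1\<close>), for which the critical dimension is \<open>n - 1 - s = n - p + \<beta>\<close>. The rest is soft. Since
\<open>\<beta> - p = - s - 1\<close>, inserting \<open>|f|\<^sup>p\<close> and applying Hoelder's inequality yields the weighted Hardy
inequality, which is the case \<open>q = p\<close> (\<open>weighted_Hardy\<close>). Inserting \<open>|f|\<^sup>\<gamma> d\<^sup>a\<close>, with suitable \<open>\<gamma>\<close> and
\<open>a\<close>, in the \<open>L\<^sup>1\<close> Sobolev inequality of the whole space produces a gradient term and a term with the
derivative of \<open>d\<^sup>a\<close>; the latter is absorbed by the Hardy inequality, and this is the case
\<open>q = n p / (n - p)\<close> (\<open>weighted_Sobolev\<close>). As the exponent of the weight is affine in \<open>q\<close>, Hoelder's
inequality interpolates between the two cases (\<open>weighted_Hardy_Sobolev\<close>).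

Thin complement. By the potential estimate \<open>|f(x)| \<le> C \<integral> |\<nabla>f(y)| |x - y|\<^sup>1\<^sup>-\<^sup>n dy\<close> and Tonelli it suffices
that the Riesz potential of \<open>d\<^sup>-\<^sup>s\<^sup>-\<^sup>1\<close> is at most \<open>C d\<^sup>-\<^sup>s\<close>. This follows from
\<open>\<integral>\<^bsub>B(y,t)\<^esub> d\<^sup>-\<^sup>s\<^sup>-\<^sup>1 \<le> C t\<^sup>n\<^sup>-\<^sup>s\<^sup>-\<^sup>1\<close> for \<open>t \<ge> d(y)/2\<close>, and that is a count: if the upper Assouad
dimension is less than \<open>\<mu> < n - s - 1\<close>, then the points of \<open>B(y,t)\<close> with \<open>d \<approx> 2\<^sup>-\<^sup>k t\<close> lie in about \<open>2\<^sup>\<mu>\<^sup>k\<close>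
balls of radius \<open>2\<^sup>-\<^sup>k t\<close>.

Fat complement. If the lower Assouad dimension exceeds \<open>n - 1 - \<sigma>\<close>, then for some \<open>\<kappa> < 1\<close> every ball
\<open>B(w,R)\<close> centred in the complement contains at least \<open>2 \<kappa>\<^sup>-\<^sup>(\<^sup>n\<^sup>-\<^sup>1\<^sup>-\<^sup>\<sigma>\<^sup>)\<close> disjoint balls of radius \<open>\<kappa> R\<close> centred
there. Comparing the mean of \<open>|f|\<close> over \<open>B(w,R)\<close> with the average of its means over these smaller balls,
and iterating until \<open>f\<close> vanishes, bounds \<open>\<integral>\<^bsub>B(w,R)\<^esub> |f|\<close> by \<open>C R\<^sup>1\<^sup>+\<^sup>\<sigma> \<integral>\<^bsub>B(w,R)\<^esub> |\<nabla>f| d\<^sup>-\<^sup>\<sigma>\<close>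
(\<open>boundary_ball_integral_le\<close>). The strict inequality on the dimension leaves room for some \<open>\<sigma> < s\<close>, and
the difference \<open>s - \<sigma>\<close> makes the sum over all scales converge when this bound is used with \<open>R = 2 d(x)\<close>
and integrated in \<open>x\<close>.

The argument needs functions that are not smooth, such as \<open>|f|\<^sup>\<gamma> d\<^sup>a\<close>. It is therefore carried out for
pairs \<open>(f, h)\<close> in which \<open>h\<close> is continuous and bounds the pointwise Lipschitz constant of \<open>f\<close>.\<close>


section \<open>Pointwise Lipschitz bounds and upper gradients\<close>

text \<open>The bound is a function \<open>r\<close> with limit \<open>L\<close> rather than \<open>L + \<epsilon>\<close> for every \<open>\<epsilon>\<close>, so that the
product and chain rules below reduce to limit laws.\<close>

definition lip_bound :: "('a::real_normed_vector \<Rightarrow> real) \<Rightarrow> real \<Rightarrow> 'a \<Rightarrow> bool" where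
  "lip_bound f L x \<longleftrightarrow>
     (\<exists>r. (r \<longlongrightarrow> L) (at x) \<and> (\<forall>\<^sub>F z in at x. \<bar>f z - f x\<bar> \<le> r z * norm (z - x)))"

text \<open>Continuity of \<open>h\<close> allows the pointwise bound to be integrated along segments without any
differentiability of \<open>f\<close>.\<close>

definition upper_gradient :: "('a::real_normed_vector \<Rightarrow> real) \<Rightarrow> ('a \<Rightarrow> real) \<Rightarrow> bool" where
  "upper_gradient f h \<longleftrightarrow> continuous_on UNIV h \<and> (\<forall>x. 0 \<le> h x \<and> lip_bound f (h x) x)"

lemma lip_bound_isCont:
  assumes "lip_bound f L x" shows "isCont f x"
proof -
  obtain r where r: "(r \<longlongrightarrow> L) (at x)" "\<forall>\<^sub>F z in at x. \<bar>f z - f x\<bar> \<le> r z * norm (z - x)"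
    using assms by (auto simp: lip_bound_def)
  have "((\<lambda>z. r z * norm (z - x)) \<longlongrightarrow> L * norm (x - x)) (at x)"
    by (intro tendsto_intros r(1))
  then have "((\<lambda>z. r z * norm (z - x)) \<longlongrightarrow> 0) (at x)" by simp
  then have "((\<lambda>z. f z - f x) \<longlongrightarrow> 0) (at x)"
    by (rule Lim_null_comparison[rotated]) (use r(2) in \<open>simp add: \<close>)
  then show ?thesis
    by (simp add: isCont_def LIM_zero_iff)
qed

lemma upper_gradient_continuous:
  "upper_gradient f h \<Longrightarrow> continuous_on S f"
  "upper_gradient f h \<Longrightarrow> continuous_on S h"
  by (meson UNIV_I continuous_at_imp_continuous_on lip_bound_isCont upper_gradient_def)
    (meson continuous_on_subset subset_UNIV upper_gradient_def)

lemma lip_bound_cong: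
  assumes "lip_bound f L x" "\<forall>\<^sub>F z in nhds x. g z = f z"
  shows "lip_bound g L x"
proof -
  obtain r where r: "(r \<longlongrightarrow> L) (at x)" "\<forall>\<^sub>F z in at x. \<bar>f z - f x\<bar> \<le> r z * norm (z - x)"
    using assms by (auto simp: lip_bound_def)
  have gx: "g x = f x" using eventually_nhds_x_imp_x[OF assms(2)] by simp
  have "\<forall>\<^sub>F z in at x. g z = f z" using assms(2) by (simp add: eventually_nhds_conv_at)
  then have "\<forall>\<^sub>F z in at x. \<bar>g z - g x\<bar> \<le> r z * norm (z - x)"
    using r(2) by eventually_elim (simp add: gx)
  then show ?thesis using r(1) by (auto simp: lip_bound_def)
qed

lemma lip_bound_const: "lip_bound (\<lambda>_. c) 0 x"
  unfolding lip_bound_def by (intro exI[of _ "\<lambda>_. 0"]) auto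

lemma lip_bound_mult:
  assumes "lip_bound f L x" "lip_bound g M x"
  shows "lip_bound (\<lambda>z. f z * g z) (\<bar>f x\<bar> * M + \<bar>g x\<bar> * L) x"
proof -
  obtain r where r: "(r \<longlongrightarrow> L) (at x)" "\<forall>\<^sub>F z in at x. \<bar>f z - f x\<bar> \<le> r z * norm (z - x)"
    using assms by (auto simp: lip_bound_def)
  obtain s where s: "(s \<longlongrightarrow> M) (at x)" "\<forall>\<^sub>F z in at x. \<bar>g z - g x\<bar> \<le> s z * norm (z - x)"
    using assms by (auto simp: lip_bound_def)
  have f: "(f \<longlongrightarrow> f x) (at x)" using lip_bound_isCont[OF assms(1)] by (simp add: isCont_def)
  have "((\<lambda>z. \<bar>f z\<bar> * s z + \<bar>g x\<bar> * r z) \<longlongrightarrow> \<bar>f x\<bar> * M + \<bar>g x\<bar> * L) (at x)"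
    by (intro tendsto_intros f r s)
  moreover have "\<forall>\<^sub>F z in at x. \<bar>f z * g z - f x * g x\<bar>
      \<le> (\<bar>f z\<bar> * s z + \<bar>g x\<bar> * r z) * norm (z - x)"
    using r(2) s(2)
  proof eventually_elim
    case (elim z)
    have "f z * g z - f x * g x = f z * (g z - g x) + g x * (f z - f x)" by (simp add: algebra_simps)
    then have "\<bar>f z * g z - f x * g x\<bar> \<le> \<bar>f z\<bar> * \<bar>g z - g x\<bar> + \<bar>g x\<bar> * \<bar>f z - f x\<bar>"
      by (metis abs_mult abs_triangle_ineq)
    also have "\<dots> \<le> \<bar>f z\<bar> * (s z * norm (z - x)) + \<bar>g x\<bar> * (r z * norm (z - x))"
      using elim by (intro add_mono mult_left_mono) auto
    finally show ?case by (simp add: algebra_simps)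
  qed
  ultimately show ?thesis unfolding lip_bound_def by blast
qed

text \<open>The difference quotient of \<open>\<phi>\<close> at \<open>f x\<close>, completed by \<open>D\<close>, is continuous there; composed
with \<open>f\<close> it is the factor by which the bound for \<open>f\<close> has to be multiplied.\<close>

lemma lip_bound_compose:
  assumes f: "lip_bound f L x" and \<phi>: "(\<phi> has_real_derivative D) (at (f x))"
  shows "lip_bound (\<lambda>z. \<phi> (f z)) (\<bar>D\<bar> * L) x"
proof -
  obtain r where r: "(r \<longlongrightarrow> L) (at x)" "\<forall>\<^sub>F z in at x. \<bar>f z - f x\<bar> \<le> r z * norm (z - x)"
    using f by (auto simp: lip_bound_def)
  define q where "q u = (if u = f x then D else (\<phi> u - \<phi> (f x)) / (u - f x))" for u
  have "(q \<longlongrightarrow> D) (at (f x))"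
    using \<phi> unfolding has_field_derivative_iff
    by (rule Lim_transform_eventually) (auto simp: q_def eventually_at_filter)
  then have "isCont q (f x)" by (simp add: isCont_def q_def)
  then have "((\<lambda>z. q (f z)) \<longlongrightarrow> q (f x)) (at x)"
    by (rule isCont_tendsto_compose) (use lip_bound_isCont[OF f] in \<open>simp add: isCont_def\<close>)
  then have "((\<lambda>z. \<bar>q (f z)\<bar> * r z) \<longlongrightarrow> \<bar>q (f x)\<bar> * L) (at x)"
    by (intro tendsto_intros r(1))
  moreover have "\<forall>\<^sub>F z in at x. \<bar>\<phi> (f z) - \<phi> (f x)\<bar> \<le> (\<bar>q (f z)\<bar> * r z) * norm (z - x)"
    using r(2)
  proof eventually_elim
    case (elim z)
    have "\<phi> (f z) - \<phi> (f x) = q (f z) * (f z - f x)" by (simp add: q_def)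
    then have "\<bar>\<phi> (f z) - \<phi> (f x)\<bar> = \<bar>q (f z)\<bar> * \<bar>f z - f x\<bar>" by (simp add: abs_mult)
    also have "\<dots> \<le> \<bar>q (f z)\<bar> * (r z * norm (z - x))"
      using elim by (intro mult_left_mono) auto
    finally show ?case by (simp add: mult.assoc)
  qed
  ultimately show ?thesis unfolding lip_bound_def q_def by auto
qed

lemma lip_bound_infdist: "lip_bound (\<lambda>z. infdist z E) 1 x"
  unfolding lip_bound_def
  by (intro exI[of _ "\<lambda>_. 1"]) (auto simp: infdist_triangle_abs dist_norm[symmetric])

text \<open>A mean value theorem without derivatives. By continuity of \<open>H\<close> the estimate holds up to
\<open>\<epsilon> (b - a)\<close> on short intervals around each point, and such estimates add up, so bisection
(\<open>Bolzano\<close>) spreads it to the whole interval.\<close>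

lemma increment_le_integral:
  fixes \<phi> H :: "real \<Rightarrow> real"
  assumes "a \<le> b" and H: "continuous_on UNIV H" and \<phi>: "\<And>t. lip_bound \<phi> (H t) t"
  shows "\<bar>\<phi> b - \<phi> a\<bar> \<le> integral {a..b} H"
proof -
  have int: "H integrable_on {c..d}" for c d
    using H by (intro integrable_continuous_real) (auto intro: continuous_on_subset)
  have "\<bar>\<phi> b - \<phi> a\<bar> \<le> integral {a..b} H + e * (b - a)" if "e > 0" for e
    using \<open>a \<le> b\<close>
  proof (induction rule: Bolzano)
    case (trans a b c)
    have "integral {a..c} H = integral {a..b} H + integral {b..c} H"
      using trans int Henstock_Kurzweil_Integration.integral_combine[of a b c H] by simp
    then show ?case using trans by (simp add: algebra_simps)
  next
    case (local x)
    obtain r where r: "(r \<longlongrightarrow> H x) (at x)"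
        "\<forall>\<^sub>F z in at x. \<bar>\<phi> z - \<phi> x\<bar> \<le> r z * norm (z - x)"
      using \<phi> by (auto simp: lip_bound_def)
    have e2: "e / 2 > 0" using that by simp
    have "\<forall>\<^sub>F z in at x. \<bar>\<phi> z - \<phi> x\<bar> \<le> (H x + e / 2) * \<bar>z - x\<bar>"
      using r(2) order_tendstoD(2)[OF r(1), of "H x + e / 2", simplified, OF that]
    proof eventually_elim
      case (elim z)
      then show ?case
        by (metis abs_ge_zero less_imp_le mult_right_mono order_trans real_norm_def)
    qed
    moreover have "\<forall>\<^sub>F z in at x. H z > H x - e / 2"
      using H e2 by (intro order_tendstoD(1)) (auto simp: continuous_on_def)
    ultimately have "\<forall>\<^sub>F z in at x. \<bar>\<phi> z - \<phi> x\<bar> \<le> (H x + e / 2) * \<bar>z - x\<bar> \<and> H z > H x - e / 2"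
      by (rule eventually_conj)
    then obtain d where d: "d > 0"
      "\<And>z. z \<noteq> x \<Longrightarrow> dist z x < d \<Longrightarrow> \<bar>\<phi> z - \<phi> x\<bar> \<le> (H x + e / 2) * \<bar>z - x\<bar> \<and> H z > H x - e / 2"
      by (auto simp: eventually_at)
    have d': "\<bar>\<phi> z - \<phi> x\<bar> \<le> (H x + e / 2) * \<bar>z - x\<bar>" "H z \<ge> H x - e / 2" if "dist z x < d" for z
      using d(2)[of z] that e2 by (cases "z = x"; force)+
    show ?case
    proof (intro exI[of _ d] conjI allI impI d(1))
      fix a b assume ab: "a \<le> x \<and> x \<le> b \<and> b - a < d"
      have "\<bar>\<phi> b - \<phi> a\<bar> \<le> \<bar>\<phi> b - \<phi> x\<bar> + \<bar>\<phi> a - \<phi> x\<bar>" by linarith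
      also have "\<dots> \<le> (H x + e / 2) * \<bar>b - x\<bar> + (H x + e / 2) * \<bar>a - x\<bar>"
        using ab by (intro add_mono d') (auto simp: dist_real_def)
      also have "\<dots> = (H x - e / 2) * (b - a) + e * (b - a)"
        using ab by (simp add: field_simps)
      also have "(H x - e / 2) * (b - a) \<le> integral {a..b} H"
proof -
          have "H x - e / 2 \<le> H t" if "t \<in> {a..b}" for t
            using that ab by (intro d'(2)) (auto simp: dist_real_def)
          then show ?thesis
            using ab has_integral_le[OF has_integral_const_real[of "H x - e / 2" a b] integrable_integral[OF int]]
            by (simp add: mult.commute)
        qed
      finally show "\<bar>\<phi> b - \<phi> a\<bar> \<le> integral {a..b} H + e * (b - a)" by simp
    qed
  qed
  note approx = this
  show ?thesis
  proof (rule field_le_epsilon)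
    fix e :: real assume "e > 0"
    then have "e / (b - a + 1) * (b - a) \<le> e" "e / (b - a + 1) > 0"
      using \<open>a \<le> b\<close> by (auto simp: field_simps)
    then show "\<bar>\<phi> b - \<phi> a\<bar> \<le> integral {a..b} H + e"
      using approx[of "e / (b - a + 1)"] by linarith
  qed
qed

lemma increment_le_segment_integral:
  fixes f h :: "'a::euclidean_space \<Rightarrow> real"
  assumes "upper_gradient f h"
  shows "ennreal \<bar>f z - f x\<bar> \<le>
    (\<integral>\<^sup>+t. ennreal (norm (z - x) * h (x + t *\<^sub>R (z - x))) * indicator {0..1} t \<partial>lborel)"
proof (cases "z = x")
  case False
  define \<phi> where "\<phi> t = f (x + t *\<^sub>R (z - x))" for t
  define H where "H t = norm (z - x) * h (x + t *\<^sub>R (z - x))" for t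
  have h: "continuous_on UNIV h" "\<And>x. 0 \<le> h x" "\<And>x. lip_bound f (h x) x"
    using assms by (auto simp: upper_gradient_def)
  have H: "continuous_on UNIV H"
    unfolding H_def by (intro continuous_intros continuous_on_compose2[OF h(1)]) auto
  have "lip_bound \<phi> (H t) t" for t
  proof -
    let ?l = "\<lambda>\<tau>. x + \<tau> *\<^sub>R (z - x)"
    obtain r where r: "(r \<longlongrightarrow> h (?l t)) (at (?l t))"
      "\<forall>\<^sub>F y in at (?l t). \<bar>f y - f (?l t)\<bar> \<le> r y * norm (y - ?l t)"
      using h(3)[of "?l t"] by (auto simp: lip_bound_def)
    have l: "filterlim ?l (at (?l t)) (at t)"
      using False unfolding filterlim_at
      by (auto intro!: tendsto_eq_intros simp: eventually_at_filter)
    show ?thesis unfolding lip_bound_def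
    proof (intro exI[of _ "\<lambda>\<tau>. norm (z - x) * r (?l \<tau>)"] conjI)
      show "((\<lambda>\<tau>. norm (z - x) * r (?l \<tau>)) \<longlongrightarrow> H t) (at t)"
        unfolding H_def by (intro tendsto_intros filterlim_compose[OF r(1) l])
      show "\<forall>\<^sub>F \<tau> in at t. \<bar>\<phi> \<tau> - \<phi> t\<bar> \<le> norm (z - x) * r (?l \<tau>) * norm (\<tau> - t)"
        using eventually_compose_filterlim[OF r(2) l]
        by eventually_elim (simp add: \<phi>_def scaleR_left_diff_distrib[symmetric] mult_ac)
    qed
  qed
  from increment_le_integral[OF _ H this, of 0 1]
  have "\<bar>f z - f x\<bar> \<le> integral {0..1} H" by (simp add: \<phi>_def)
  moreover have "(\<integral>\<^sup>+t. ennreal (H t) * indicator {0..1} t \<partial>lborel) = ennreal (integral {0..1} H)"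
    using continuous_on_subset[OF H, of "{0..1}"] h(2)
    by (intro nn_integral_has_integral_lebesgue' integrable_integral integrable_continuous_real)
      (auto simp: H_def)
  ultimately show ?thesis by (simp add: H_def ennreal_leI)
qed simp


section \<open>Potential estimates\<close>

lemma balls_in_borel [measurable]: "ball x r \<in> sets borel" "cball x r \<in> sets borel"
  by simp_all

lemma nn_integral_powr_tail:
  assumes "a > 0" "b > 0"
  shows "(\<integral>\<^sup>+t. ennreal (t powr (-b-1)) * indicator {a..} t \<partial>lborel) = ennreal (a powr (-b) / b)"
proof -
  have "(\<integral>\<^sup>+t. ennreal (t powr (-b-1)) * indicator {a..} t \<partial>lborel) = ennreal (0 - (- (a powr (-b) / b)))"
  proof (rule nn_integral_FTC_atLeast)
    show "((\<lambda>t. - (t powr (-b) / b)) has_real_derivative t powr (-b-1)) (at t)" if "a \<le> t" for t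
      using that assms by (auto intro!: derivative_eq_intros)
    have "((\<lambda>t. - (t powr (-b) / b)) \<longlongrightarrow> - (0 / b)) at_top"
      using assms by (intro tendsto_intros tendsto_neg_powr filterlim_ident) auto
    then show "((\<lambda>t. - (t powr (-b) / b)) \<longlongrightarrow> 0) at_top" by simp
  qed auto
  then show ?thesis by simp
qed

lemma powr_le_tail_integral:
  assumes "r \<ge> 0" "a > 0"
  shows "ennreal (r powr (-a)) \<le>
    ennreal a * (\<integral>\<^sup>+t. ennreal (t powr (-a-1)) * indicator {r..} t \<partial>lborel)"
proof (cases "r = 0")
  case False
  then show ?thesis using assms
    by (simp add: nn_integral_powr_tail ennreal_mult[symmetric])
qed auto

lemma nn_integral_dilation:
  fixes F :: "'a::euclidean_space \<Rightarrow> ennreal"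
  assumes [measurable]: "F \<in> borel_measurable borel" and "t > 0"
  shows "(\<integral>\<^sup>+z. F (x + t *\<^sub>R (z - x)) \<partial>lborel) = ennreal (t powr - real DIM('a)) * (\<integral>\<^sup>+y. F y \<partial>lborel)"
proof -
  let ?T = "\<lambda>z. (x - t *\<^sub>R x) + t *\<^sub>R z"
  have "(\<integral>\<^sup>+y. F y \<partial>lborel) = (\<integral>\<^sup>+y. F y \<partial>density (distr lborel borel ?T) (\<lambda>_. ennreal (\<bar>t\<bar>^DIM('a))))"
    using lborel_affine[of t "x - t *\<^sub>R x"] \<open>t > 0\<close> by simp
  also have "\<dots> = ennreal (t ^ DIM('a)) * (\<integral>\<^sup>+z. F (?T z) \<partial>lborel)"
    using \<open>t > 0\<close> by (simp add: nn_integral_density nn_integral_distr nn_integral_cmult)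
  finally have "ennreal (t powr - real DIM('a)) * (\<integral>\<^sup>+y. F y \<partial>lborel) =
    ennreal (t powr - real DIM('a) * t ^ DIM('a)) * (\<integral>\<^sup>+z. F (?T z) \<partial>lborel)"
    using \<open>t > 0\<close> by (simp add: mult.assoc[symmetric] ennreal_mult[symmetric])
  also have "t powr - real DIM('a) * t ^ DIM('a) = 1"
    using \<open>t > 0\<close> by (simp add: powr_minus powr_realpow)
  finally show ?thesis by (simp add: algebra_simps)
qed

text \<open>Integrate the segment estimate over \<open>z\<close> and exchange the order of integration. For fixed \<open>t\<close>
the map \<open>z \<mapsto> y = x + t(z - x)\<close> is a dilation that keeps the ball inside itself and contributes
\<open>t\<^sup>-\<^sup>n\<close>, and \<open>|y - x| \<le> 2Rt\<close> bounds \<open>t\<close> from below; the remaining integral in \<open>t\<close> gives the kernel.\<close>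

lemma nn_integral_oscillation_le_potential:
  fixes f h :: "'a::euclidean_space \<Rightarrow> real"
  defines "n \<equiv> real DIM('a)"
  assumes fh: "upper_gradient f h" and x: "x \<in> ball w R"
  shows "(\<integral>\<^sup>+z. ennreal \<bar>f z - f x\<bar> * indicator (ball w R) z \<partial>lborel) \<le>
    ennreal ((2 * R) powr n / n) *
      (\<integral>\<^sup>+y. ennreal (h y * norm (x - y) powr (1 - n)) * indicator (ball w R) y \<partial>lborel)"
proof -
  let ?B = "ball w R"
  have n: "n > 0" by (simp add: n_def)
  have R: "R > 0" using x by (metis ball_eq_empty empty_iff not_le)
  have h [measurable]: "h \<in> borel_measurable borel" and h0: "\<And>x. 0 \<le> h x"
    using upper_gradient_continuous(2)[OF fh, of UNIV] fh
    by (auto simp: upper_gradient_def intro: borel_measurable_continuous_onI)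
  define g where "g t y = ennreal (norm (y - x) * h y) * indicator ?B y *
      (ennreal (t powr (-n-1)) * indicator {norm (y - x) / (2 * R)..} t)" for t y
  have g [measurable]: "case_prod g \<in> borel_measurable (lborel \<Otimes>\<^sub>M lborel)"
    unfolding g_def indicator_def mem_ball atLeast_iff by measurable
  have "(\<integral>\<^sup>+z. ennreal \<bar>f z - f x\<bar> * indicator ?B z \<partial>lborel) \<le>
    (\<integral>\<^sup>+z. (\<integral>\<^sup>+t. ennreal (norm (z - x) * h (x + t *\<^sub>R (z - x))) * indicator {0..1} t * indicator ?B z \<partial>lborel) \<partial>lborel)"
    by (intro nn_integral_mono, subst nn_integral_multc)
      (auto intro!: mult_right_mono increment_le_segment_integral[OF fh])
  also have "\<dots> = (\<integral>\<^sup>+t. (\<integral>\<^sup>+z. ennreal (norm (z - x) * h (x + t *\<^sub>R (z - x))) * indicator {0..1} t * indicator ?B z \<partial>lborel) \<partial>lborel)"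
    unfolding indicator_def mem_ball by (rule lborel_pair.Fubini') measurable
  also have "\<dots> \<le> (\<integral>\<^sup>+t. (\<integral>\<^sup>+y. g t y \<partial>lborel) \<partial>lborel)"
  proof (rule nn_integral_mono_AE)
    show "AE t in lborel. (\<integral>\<^sup>+z. ennreal (norm (z - x) * h (x + t *\<^sub>R (z - x))) * indicator {0..1} t * indicator ?B z \<partial>lborel)
      \<le> (\<integral>\<^sup>+y. g t y \<partial>lborel)"
      using AE_lborel_singleton[of "0::real"]
    proof eventually_elim
      case (elim t)
      show ?case
      proof (cases "t \<in> {0..1}")
        case True
        then have t: "0 < t" "t \<le> 1" using elim by auto
        define F where "F y = ennreal (norm (y - x) / t * h y) * indicator ?B y *
           indicator {norm (y - x) / (2 * R)..} t" for y
        have [measurable]: "F \<in> borel_measurable borel"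
          unfolding F_def indicator_def mem_ball atLeast_iff by measurable
        have "ennreal (norm (z - x) * h (x + t *\<^sub>R (z - x))) * indicator {0..1} t * indicator ?B z
          \<le> F (x + t *\<^sub>R (z - x))" for z
        proof (cases "z \<in> ?B")
          case True
          have "x + t *\<^sub>R (z - x) = (1 - t) *\<^sub>R x + t *\<^sub>R z" by (simp add: algebra_simps)
          then have "x + t *\<^sub>R (z - x) \<in> ?B"
            using convexD_alt[OF convex_ball x True] t by auto
          moreover have "norm (z - x) \<le> 2 * R"
            using x True norm_triangle_sub[of "z - w" "x - w"] norm_triangle_ineq4[of "z - w" "x - w"]
            by (auto simp: dist_norm norm_minus_commute)
          then have "norm (t *\<^sub>R (z - x)) / (2 * R) \<le> t"
            using t R by (simp add: pos_divide_le_eq mult_left_mono)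
          ultimately show ?thesis
            using t by (auto simp: F_def indicator_def)
        qed auto
        then have "(\<integral>\<^sup>+z. ennreal (norm (z - x) * h (x + t *\<^sub>R (z - x))) * indicator {0..1} t * indicator ?B z \<partial>lborel)
          \<le> (\<integral>\<^sup>+z. F (x + t *\<^sub>R (z - x)) \<partial>lborel)" by (intro nn_integral_mono)
        also have "\<dots> = ennreal (t powr - n) * (\<integral>\<^sup>+y. F y \<partial>lborel)"
          unfolding n_def using t by (intro nn_integral_dilation) auto
        also have "\<dots> = (\<integral>\<^sup>+y. ennreal (t powr - n) * F y \<partial>lborel)"
          by (simp add: nn_integral_cmult)
        also have "\<dots> = (\<integral>\<^sup>+y. g t y \<partial>lborel)"
        proof (intro nn_integral_cong)
          fix y
          have "t powr (-n-1) = t powr (-n) / t"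
            using t by (simp add: powr_diff)
          then show "ennreal (t powr - n) * F y = g t y"
            using t h0 by (auto simp: F_def g_def indicator_def ennreal_mult[symmetric] mult_ac)
        qed
        finally show ?thesis .
      qed auto
    qed
  qed
  also have "\<dots> = (\<integral>\<^sup>+y. (\<integral>\<^sup>+t. g t y \<partial>lborel) \<partial>lborel)"
    by (rule lborel_pair.Fubini') measurable
  also have "\<dots> = (\<integral>\<^sup>+y. ennreal ((2 * R) powr n / n) * (ennreal (h y * norm (x - y) powr (1 - n)) * indicator ?B y) \<partial>lborel)"
  proof (intro nn_integral_cong)
    fix y
    show "(\<integral>\<^sup>+t. g t y \<partial>lborel) = ennreal ((2 * R) powr n / n) * (ennreal (h y * norm (x - y) powr (1 - n)) * indicator ?B y)"
    proof (cases "y = x")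
      case False
      define \<rho> where "\<rho> = norm (y - x)"
      have \<rho>: "\<rho> > 0" "norm (x - y) = \<rho>" using False by (auto simp: \<rho>_def norm_minus_commute)
      have "(\<integral>\<^sup>+t. g t y \<partial>lborel) = ennreal (\<rho> * h y) * indicator ?B y * ennreal ((\<rho> / (2 * R)) powr (-n) / n)"
        unfolding g_def \<rho>_def[symmetric] using \<rho> R n
        by (subst nn_integral_cmult) (auto simp: nn_integral_powr_tail)
      also have "(\<rho> / (2 * R)) powr (-n) / n = (2 * R) powr n / n * \<rho> powr (-n)"
        using \<rho> R n by (simp add: powr_divide powr_minus field_simps)
      also have "ennreal (\<rho> * h y) * indicator ?B y * ennreal ((2 * R) powr n / n * \<rho> powr (-n)) =
         ennreal ((2 * R) powr n / n) * (ennreal (h y * (\<rho> * \<rho> powr (-n))) * indicator ?B y)"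
        using \<rho> R n h0 by (auto simp: indicator_def ennreal_mult[symmetric] mult_ac)
      also have "\<rho> * \<rho> powr (-n) = \<rho> powr (1 - n)"
        using \<rho> by (simp add: powr_diff powr_minus field_simps)
      finally show ?thesis unfolding \<rho> .
    qed (simp add: g_def)
  qed
  also have "\<dots> = ennreal ((2 * R) powr n / n) *
      (\<integral>\<^sup>+y. ennreal (h y * norm (x - y) powr (1 - n)) * indicator ?B y \<partial>lborel)"
    by (rule nn_integral_cmult) measurable
  finally show ?thesis .
qed

lemma emeasure_ball_powr:
  fixes c :: "'a::euclidean_space"
  assumes "r > 0"
  shows "emeasure lborel (ball c r) = ennreal (unit_ball_vol DIM('a) * r powr real DIM('a))"
    and "emeasure lborel (cball c r) = ennreal (unit_ball_vol DIM('a) * r powr real DIM('a))"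
  using assms by (simp_all add: emeasure_ball emeasure_cball powr_realpow)

text \<open>The kernel is a superposition of indicators of balls around \<open>y\<close>, so a potential is controlled
by the masses that the density puts on these balls.\<close>

lemma nn_integral_kernel_layer_cake:
  fixes u :: "'a::euclidean_space \<Rightarrow> ennreal" and y :: 'a
  assumes [measurable]: "u \<in> borel_measurable borel" and "a > 0"
  shows "(\<integral>\<^sup>+x. u x * ennreal (norm (x - y) powr (-a)) \<partial>lborel) \<le>
    ennreal a * (\<integral>\<^sup>+t. ennreal (t powr (-a-1)) * indicator {0<..} t *
       (\<integral>\<^sup>+x. u x * indicator (cball y t) x \<partial>lborel) \<partial>lborel)"
proof -
  have "(\<integral>\<^sup>+x. u x * ennreal (norm (x - y) powr (-a)) \<partial>lborel) \<le>
    (\<integral>\<^sup>+x. ennreal a * (\<integral>\<^sup>+t. u x * (ennreal (t powr (-a-1)) * indicator {0<..} t * indicator (cball y t) x) \<partial>lborel) \<partial>lborel)"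
  proof (intro nn_integral_mono)
    fix x
    show "u x * ennreal (norm (x - y) powr (-a)) \<le>
      ennreal a * (\<integral>\<^sup>+t. u x * (ennreal (t powr (-a-1)) * indicator {0<..} t * indicator (cball y t) x) \<partial>lborel)"
    proof (cases "x = y")
      case False
      have "u x * ennreal (norm (x - y) powr (-a)) \<le>
        u x * (ennreal a * (\<integral>\<^sup>+t. ennreal (t powr (-a-1)) * indicator {norm (x - y)..} t \<partial>lborel))"
        using \<open>a > 0\<close> by (intro mult_left_mono powr_le_tail_integral) auto
      also have "\<dots> = ennreal a * (\<integral>\<^sup>+t. u x * (ennreal (t powr (-a-1)) * indicator {norm (x - y)..} t) \<partial>lborel)"
        by (subst nn_integral_cmult) (auto simp: mult_ac)
      also have "\<dots> = ennreal a * (\<integral>\<^sup>+t. u x * (ennreal (t powr (-a-1)) * indicator {0<..} t * indicator (cball y t) x) \<partial>lborel)"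
      proof (rule arg_cong2[OF refl nn_integral_cong, of _ _ _ "(*)"])
        fix t :: real
        have "norm (x - y) > 0" using False by simp
        then show "u x * (ennreal (t powr (-a-1)) * indicator {norm (x - y)..} t) =
          u x * (ennreal (t powr (-a-1)) * indicator {0<..} t * indicator (cball y t) x)"
          by (auto simp: indicator_def dist_norm norm_minus_commute simp del: zero_less_norm_iff)
      qed
      finally show ?thesis .
    qed auto
  qed
  also have "\<dots> = ennreal a * (\<integral>\<^sup>+x. (\<integral>\<^sup>+t. u x * (ennreal (t powr (-a-1)) * indicator {0<..} t * indicator (cball y t) x) \<partial>lborel) \<partial>lborel)"
    unfolding indicator_def mem_cball by (intro nn_integral_cmult) measurable
  also have "(\<integral>\<^sup>+x. (\<integral>\<^sup>+t. u x * (ennreal (t powr (-a-1)) * indicator {0<..} t * indicator (cball y t) x) \<partial>lborel) \<partial>lborel)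
    = (\<integral>\<^sup>+t. (\<integral>\<^sup>+x. u x * (ennreal (t powr (-a-1)) * indicator {0<..} t * indicator (cball y t) x) \<partial>lborel) \<partial>lborel)"
    unfolding indicator_def mem_cball by (rule lborel_pair.Fubini') measurable
  also have "\<dots> = (\<integral>\<^sup>+t. ennreal (t powr (-a-1)) * indicator {0<..} t *
       (\<integral>\<^sup>+x. u x * indicator (cball y t) x \<partial>lborel) \<partial>lborel)"
    by (intro nn_integral_cong, subst nn_integral_cmult[symmetric]) (auto simp: mult_ac)
  finally show ?thesis .
qed

text \<open>Mass growing like \<open>t\<^sup>n\<close> below the scale \<open>\<rho>\<close> and like \<open>t\<^sup>b\<close> with \<open>b < n - 1\<close> above it makes both
ends of the layer-cake integral converge, and each contributes a multiple of \<open>A \<rho>\<close>.\<close>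

lemma Riesz_potential_le_of_growth:
  fixes u :: "'a::euclidean_space \<Rightarrow> ennreal"
  defines "n \<equiv> real DIM('a)"
  assumes u: "u \<in> borel_measurable borel" and n: "n > 1" and "b < n - 1" "\<rho> > 0" "A \<ge> 0"
    and small: "\<And>t. 0 < t \<Longrightarrow> t \<le> \<rho> \<Longrightarrow> (\<integral>\<^sup>+x. u x * indicator (cball y t) x \<partial>lborel) \<le> ennreal (A * t powr n)"
    and large: "\<And>t. \<rho> \<le> t \<Longrightarrow> (\<integral>\<^sup>+x. u x * indicator (cball y t) x \<partial>lborel) \<le> ennreal (A * \<rho> powr (n - b) * t powr b)"
  shows "(\<integral>\<^sup>+x. u x * ennreal (norm (x - y) powr (1 - n)) \<partial>lborel) \<le>
    ennreal ((n - 1) * (1 + 1 / (n - 1 - b)) * A * \<rho>)"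
proof -
  have "(\<integral>\<^sup>+x. u x * ennreal (norm (x - y) powr (1 - n)) \<partial>lborel) \<le>
    ennreal (n - 1) * (\<integral>\<^sup>+t. ennreal (t powr (-n)) * indicator {0<..} t *
       (\<integral>\<^sup>+x. u x * indicator (cball y t) x \<partial>lborel) \<partial>lborel)"
    using nn_integral_kernel_layer_cake[OF u, of "n - 1" y] n by simp
  also have "\<dots> \<le> ennreal (n - 1) * (\<integral>\<^sup>+t. ennreal A * indicator {0..\<rho>} t +
      ennreal (A * \<rho> powr (n - b)) * (ennreal (t powr (-(n-1-b)-1)) * indicator {\<rho>..} t) \<partial>lborel)"
  proof (intro mult_left_mono nn_integral_mono)
    fix t :: real
    let ?I = "\<integral>\<^sup>+x. u x * indicator (cball y t) x \<partial>lborel"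
    consider "t \<le> 0" | "0 < t" "t \<le> \<rho>" | "t > \<rho>" by linarith
    then show "ennreal (t powr (-n)) * indicator {0<..} t * ?I \<le> ennreal A * indicator {0..\<rho>} t +
      ennreal (A * \<rho> powr (n - b)) * (ennreal (t powr (-(n-1-b)-1)) * indicator {\<rho>..} t)"
    proof cases
      case 2
      then have "ennreal (t powr (-n)) * ?I \<le> ennreal (t powr (-n)) * ennreal (A * t powr n)"
        by (intro mult_left_mono small) auto
      also have "\<dots> = ennreal A"
        using 2 \<open>A \<ge> 0\<close> by (simp add: ennreal_mult[symmetric] powr_minus)
      finally show ?thesis using 2 by (simp add: add_increasing2)
    next
      case 3
      then have "ennreal (t powr (-n)) * ?I \<le> ennreal (t powr (-n)) * ennreal (A * \<rho> powr (n - b) * t powr b)"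
        by (intro mult_left_mono large) auto
      also have "\<dots> = ennreal (A * \<rho> powr (n - b)) * ennreal (t powr (-(n-1-b)-1))"
        using 3 \<open>A \<ge> 0\<close> \<open>\<rho> > 0\<close> by (simp add: ennreal_mult[symmetric] mult_ac powr_add[symmetric])
      finally show ?thesis using 3 \<open>\<rho> > 0\<close> by simp
    qed auto
  qed auto
  also have "(\<integral>\<^sup>+t. ennreal A * indicator {0..\<rho>} t +
      ennreal (A * \<rho> powr (n - b)) * (ennreal (t powr (-(n-1-b)-1)) * indicator {\<rho>..} t) \<partial>lborel) =
      ennreal A * ennreal \<rho> + ennreal (A * \<rho> powr (n - b)) * ennreal (\<rho> powr (-(n-1-b)) / (n-1-b))"
  proof -
    have tail: "(\<integral>\<^sup>+t. ennreal (t powr (-(n-1-b)-1)) * indicator {\<rho>..} t \<partial>lborel) =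
      ennreal (\<rho> powr (-(n-1-b)) / (n-1-b))"
      using \<open>\<rho> > 0\<close> \<open>b < n - 1\<close> by (intro nn_integral_powr_tail) auto
    show ?thesis
      using \<open>\<rho> > 0\<close>
      by (subst nn_integral_add; (subst nn_integral_cmult)?; (subst tail)?) (auto simp: nn_integral_cmult)
  qed
  also have "\<dots> = ennreal (A * \<rho> + A * (\<rho> powr (n - b) * \<rho> powr (-(n-1-b))) / (n-1-b))"
    using \<open>\<rho> > 0\<close> \<open>b < n - 1\<close> \<open>A \<ge> 0\<close>
    by (subst ennreal_plus) (auto simp: ennreal_mult[symmetric])
  also have "\<rho> powr (n - b) * \<rho> powr (-(n-1-b)) = \<rho>"
    using \<open>\<rho> > 0\<close> by (simp add: powr_add[symmetric])
  also have "ennreal (n - 1) * ennreal (A * \<rho> + A * \<rho> / (n-1-b)) =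
     ennreal ((n - 1) * (1 + 1 / (n - 1 - b)) * A * \<rho>)"
    using \<open>\<rho> > 0\<close> \<open>b < n - 1\<close> \<open>A \<ge> 0\<close> n
    by (subst ennreal_mult[symmetric]) (auto simp: algebra_simps add_divide_distrib)
  finally show ?thesis .
qed


section \<open>The L1 Hardy inequality for thin complements\<close>

text \<open>The counterpart of the test functions on \<open>G\<close> for pairs of a function and an upper gradient.\<close>

definition test_pair :: "'a::euclidean_space set \<Rightarrow> ('a \<Rightarrow> real) \<Rightarrow> ('a \<Rightarrow> real) \<Rightarrow> bool" where
  "test_pair G f h \<longleftrightarrow> upper_gradient f h \<and>
     (\<exists>K. compact K \<and> K \<subseteq> G \<and> (\<forall>x. x \<notin> K \<longrightarrow> f x = 0 \<and> h x = 0))"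

lemma test_pairE:
  assumes "test_pair G f h"
  obtains K where "compact K" "K \<subseteq> G" "\<And>x. x \<notin> K \<Longrightarrow> f x = 0" "\<And>x. x \<notin> K \<Longrightarrow> h x = 0"
    "upper_gradient f h"
proof -
  obtain K where "compact K \<and> K \<subseteq> G \<and> (\<forall>x. x \<notin> K \<longrightarrow> f x = 0 \<and> h x = 0)" "upper_gradient f h"
    using assms unfolding test_pair_def by metis
  then show thesis by (intro that[of K]) simp_all
qed

text \<open>At points of the complement the distance is 0 and the weights take the value \<open>0 powr a = 0\<close>.
There both \<open>f\<close> and \<open>h\<close> vanish, so this is the inequality over \<open>G\<close>.\<close>

definition Hardy_L1 :: "real \<Rightarrow> 'a::euclidean_space set \<Rightarrow> bool" where
  "Hardy_L1 s G \<longleftrightarrow> (\<exists>C\<ge>0. \<forall>f h. test_pair G f h \<longrightarrow>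
     (\<integral>\<^sup>+x. ennreal (\<bar>f x\<bar> * infdist x (- G) powr (- s - 1)) \<partial>lborel) \<le>
     ennreal C * (\<integral>\<^sup>+x. ennreal (h x * infdist x (- G) powr (- s)) \<partial>lborel))"

lemma upper_gradient_measurable:
  fixes f :: "'a::euclidean_space \<Rightarrow> real"
  assumes "upper_gradient f h"
  shows "f \<in> borel_measurable borel" "h \<in> borel_measurable borel"
  using upper_gradient_continuous[OF assms, of UNIV] by (auto intro: borel_measurable_continuous_onI)

lemma borel_measurable_infdist [measurable (raw)]:
  assumes "g \<in> borel_measurable M" shows "(\<lambda>x. infdist (g x) E) \<in> borel_measurable M"
  using assms by (rule borel_measurable_continuous_on[OF continuous_on_infdist[OF continuous_on_id]])

lemma value_le_ball_integral:
  fixes f h :: "'a::euclidean_space \<Rightarrow> real"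
  defines "n \<equiv> real DIM('a)"
  assumes fh: "upper_gradient f h" and x: "x \<in> ball w R"
  shows "ennreal (unit_ball_vol n * R powr n) * ennreal \<bar>f x\<bar> \<le>
    (\<integral>\<^sup>+z. ennreal \<bar>f z\<bar> * indicator (ball w R) z \<partial>lborel) +
    ennreal ((2 * R) powr n / n) *
      (\<integral>\<^sup>+y. ennreal (h y * norm (x - y) powr (1 - n)) * indicator (ball w R) y \<partial>lborel)"
proof -
  have R: "R > 0" using x by (metis ball_eq_empty empty_iff not_le)
  note [measurable] = upper_gradient_measurable[OF fh]
  have "ennreal (unit_ball_vol n * R powr n) * ennreal \<bar>f x\<bar> =
      (\<integral>\<^sup>+z. ennreal \<bar>f x\<bar> * indicator (ball w R) z \<partial>lborel)"
    using R by (simp add: nn_integral_cmult emeasure_ball_powr n_def mult.commute)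
  also have "\<dots> \<le> (\<integral>\<^sup>+z. ennreal \<bar>f z\<bar> * indicator (ball w R) z + ennreal \<bar>f z - f x\<bar> * indicator (ball w R) z \<partial>lborel)"
    by (intro nn_integral_mono) (auto simp: indicator_def ennreal_plus[symmetric] simp del: ennreal_plus intro!: ennreal_leI)
  also have "\<dots> = (\<integral>\<^sup>+z. ennreal \<bar>f z\<bar> * indicator (ball w R) z \<partial>lborel) +
     (\<integral>\<^sup>+z. ennreal \<bar>f z - f x\<bar> * indicator (ball w R) z \<partial>lborel)"
    by (intro nn_integral_add) auto
  finally show ?thesis
    using nn_integral_oscillation_le_potential[OF fh x, folded n_def] add_left_mono order_trans by blast
qed

lemma integrable_continuous_compact_support:
  fixes g :: "'a::euclidean_space \<Rightarrow> real"
  assumes g: "continuous_on UNIV g" and K: "compact K" "\<And>x. x \<notin> K \<Longrightarrow> g x = 0"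
  shows "integrable lborel g"
proof -
  have "integrable lborel (\<lambda>x. indicator K x *\<^sub>R g x)"
    using borel_integrable_compact[OF K(1) continuous_on_subset[OF g subset_UNIV]]
    by (simp add: indicator_def if_distrib cong: if_cong)
  also have "(\<lambda>x. indicator K x *\<^sub>R g x) = g"
    using K(2) by (auto simp: indicator_def fun_eq_iff)
  finally show ?thesis .
qed

text \<open>Apply the estimate on balls around \<open>x\<close> whose radius tends to infinity: the mean of \<open>f\<close> tends to 0,
because its integral is finite.\<close>

lemma value_le_Riesz_potential:
  fixes f h :: "'a::euclidean_space \<Rightarrow> real"
  defines "n \<equiv> real DIM('a)"
  assumes fh: "upper_gradient f h" and K: "compact K" "\<And>x. x \<notin> K \<Longrightarrow> f x = 0"
  shows "ennreal \<bar>f x\<bar> \<le> ennreal (2 powr n / n / unit_ball_vol n) *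
      (\<integral>\<^sup>+y. ennreal (h y * norm (x - y) powr (1 - n)) \<partial>lborel)"
proof -
  define I where "I = (\<integral>\<^sup>+y. ennreal (h y * norm (x - y) powr (1 - n)) \<partial>lborel)"
  define M where "M = (LINT z|lborel. \<bar>f z\<bar>)"
  define \<omega> where "\<omega> = unit_ball_vol n"
  have n: "n > 0" and \<omega>: "\<omega> > 0" by (auto simp: n_def \<omega>_def)
  have M: "(\<integral>\<^sup>+z. ennreal \<bar>f z\<bar> \<partial>lborel) = ennreal M" "M \<ge> 0"
    unfolding M_def using K upper_gradient_continuous(1)[OF fh, of UNIV]
    by (auto intro!: nn_integral_eq_integral integrable_continuous_compact_support[where K=K]
        continuous_intros)
  show ?thesis
  proof (cases I)
    case top
    then show ?thesis using n \<omega> unfolding I_def[symmetric] \<omega>_def[symmetric]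
      by (simp add: ennreal_mult_top)
  next
    case (real J)
    have "\<bar>f x\<bar> \<le> M / (\<omega> * R powr n) + 2 powr n / n / \<omega> * J" if R: "R > 0" for R
    proof -
      have "ennreal (\<omega> * R powr n) * ennreal \<bar>f x\<bar> \<le>
         (\<integral>\<^sup>+z. ennreal \<bar>f z\<bar> * indicator (ball x R) z \<partial>lborel) +
         ennreal ((2 * R) powr n / n) *
         (\<integral>\<^sup>+y. ennreal (h y * norm (x - y) powr (1 - n)) * indicator (ball x R) y \<partial>lborel)"
        unfolding n_def \<omega>_def by (rule value_le_ball_integral[OF fh]) (use R in auto)
      also have "\<dots> \<le> ennreal M + ennreal ((2 * R) powr n / n) * ennreal J"
        unfolding M(1)[symmetric] real(2)[symmetric] I_def
        by (intro add_mono mult_left_mono nn_integral_mono) (auto simp: indicator_def)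
      also have "\<dots> = ennreal (M + (2 * R) powr n / n * J)"
        using M real n by (simp add: ennreal_mult[symmetric])
      finally have "\<omega> * R powr n * \<bar>f x\<bar> \<le> M + (2 * R) powr n / n * J"
        using M real n \<omega> by (simp add: ennreal_mult[symmetric] del: ennreal_plus)
      then have "\<bar>f x\<bar> \<le> (M + (2 * R) powr n / n * J) / (\<omega> * R powr n)"
        using R \<omega> by (subst pos_le_divide_eq) (auto simp: mult_ac)
      also have "\<dots> = M / (\<omega> * R powr n) + 2 powr n / n / \<omega> * J"
        using R \<omega> n by (simp add: powr_mult field_simps)
      finally show ?thesis .
    qed
    then have "\<forall>\<^sub>F R in at_top. \<bar>f x\<bar> \<le> M / \<omega> * R powr (-n) + 2 powr n / n / \<omega> * J"
      by (intro eventually_mono[OF eventually_gt_at_top[of 0]]) (simp add: powr_minus divide_inverse mult.assoc)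
    moreover have "((\<lambda>R. M / \<omega> * R powr (-n) + 2 powr n / n / \<omega> * J) \<longlongrightarrow> M / \<omega> * 0 + 2 powr n / n / \<omega> * J) at_top"
      using n by (intro tendsto_intros tendsto_neg_powr filterlim_ident) auto
    ultimately have "\<bar>f x\<bar> \<le> M / \<omega> * 0 + 2 powr n / n / \<omega> * J"
      by (intro tendsto_lowerbound) auto
    then show ?thesis
      using real n \<omega> unfolding I_def[symmetric] \<omega>_def[symmetric]
      by (simp add: ennreal_mult[symmetric] ennreal_leI)
  qed
qed

text \<open>By duality: after inserting the potential estimate for \<open>f\<close>, Tonelli moves the kernel onto the weight
\<open>d\<^sup>-\<^sup>s\<^sup>-\<^sup>1\<close>. Below the scale \<open>d(y)/2\<close> this weight is comparable to a constant; above it the hypothesis gives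
growth with exponent \<open>n - s - 1 < n - 1\<close>.\<close>

lemma Hardy_L1_of_distance_integrals:
  fixes G :: "'a::euclidean_space set"
  defines "n \<equiv> real DIM('a)"
  assumes n: "n > 1" and "open G" "- G \<noteq> {}" "s > 0" "C \<ge> 0"
    and ball: "\<And>y t. t > 0 \<Longrightarrow> infdist y (- G) \<le> 2 * t \<Longrightarrow>
      (\<integral>\<^sup>+x. ennreal (infdist x (- G) powr (- s - 1)) * indicator (cball y t) x \<partial>lborel)
        \<le> ennreal (C * t powr (n - s - 1))"
  shows "Hardy_L1 s G"
proof -
  let ?d = "\<lambda>x. infdist x (- G)"
  define \<omega> where "\<omega> = unit_ball_vol n"
  define c1 where "c1 = 2 powr n / n / \<omega>"
  define c2 where "c2 = (n - 1) * (1 + 1 / s) * (\<omega> + C) * 2 powr s"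
  have \<omega>: "\<omega> > 0" by (simp add: n_def \<omega>_def)
  have c: "c1 \<ge> 0" "c2 \<ge> 0" using n \<omega> assms by (auto simp: c1_def c2_def)
  have cl: "closed (- G)" using \<open>open G\<close> by (simp add: closed_Compl)
  have pot: "(\<integral>\<^sup>+x. ennreal (?d x powr (- s - 1)) * ennreal (norm (x - y) powr (1 - n)) \<partial>lborel) \<le>
      ennreal (c2 * ?d y powr (- s))" if "y \<in> G" for y
  proof -
    define \<rho> where "\<rho> = ?d y / 2"
    have "?d y > 0" using that cl \<open>- G \<noteq> {}\<close> by (metis Compl_iff in_closed_iff_infdist_zero infdist_nonneg less_le)
    then have \<rho>: "\<rho> > 0" "?d y = 2 * \<rho>" by (auto simp: \<rho>_def)
    have "(\<integral>\<^sup>+x. ennreal (?d x powr (- s - 1)) * ennreal (norm (x - y) powr (1 - n)) \<partial>lborel) \<le>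
       ennreal ((n - 1) * (1 + 1 / (n - 1 - (n - s - 1))) * (\<rho> powr (- s - 1) * (\<omega> + C)) * \<rho>)"
      unfolding n_def
    proof (rule Riesz_potential_le_of_growth; (unfold n_def[symmetric])?)
      fix t :: real assume t: "0 < t" "t \<le> \<rho>"
      have "(\<integral>\<^sup>+x. ennreal (?d x powr (- s - 1)) * indicator (cball y t) x \<partial>lborel) \<le>
        (\<integral>\<^sup>+x. ennreal (\<rho> powr (- s - 1)) * indicator (cball y t) x \<partial>lborel)"
      proof (intro nn_integral_mono)
        fix x
        show "ennreal (?d x powr (- s - 1)) * indicator (cball y t) x \<le>
          ennreal (\<rho> powr (- s - 1)) * indicator (cball y t) x"
        proof (cases "x \<in> cball y t")
          case True
          then have "\<rho> \<le> ?d x" using infdist_triangle[of y "- G" x] t \<rho> by auto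
          then show ?thesis using \<rho> \<open>s > 0\<close> True by (auto intro!: ennreal_leI powr_mono2')
        qed auto
      qed
      also have "\<dots> = ennreal (\<rho> powr (- s - 1) * (\<omega> * t powr n))"
        using t \<omega> by (simp add: nn_integral_cmult emeasure_ball_powr \<omega>_def n_def ennreal_mult)
      also have "\<dots> \<le> ennreal (\<rho> powr (- s - 1) * (\<omega> + C) * t powr n)"
        using \<open>C \<ge> 0\<close> by (intro ennreal_leI) (auto simp: algebra_simps)
      finally show "(\<integral>\<^sup>+x. ennreal (?d x powr (- s - 1)) * indicator (cball y t) x \<partial>lborel) \<le>
         ennreal (\<rho> powr (- s - 1) * (\<omega> + C) * t powr n)" .
    next
      fix t :: real assume t: "\<rho> \<le> t"
      have "(\<integral>\<^sup>+x. ennreal (?d x powr (- s - 1)) * indicator (cball y t) x \<partial>lborel) \<le> ennreal (C * t powr (n - s - 1))"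
        using t \<rho> by (intro ball) auto
      also have "\<dots> \<le> ennreal ((\<rho> powr (- s - 1) * \<rho> powr (n - (n - s - 1))) * ((\<omega> + C) * t powr (n - s - 1)))"
      proof -
        have "\<rho> powr (- s - 1) * \<rho> powr (n - (n - s - 1)) = 1"
          using \<rho> by (simp add: powr_add[symmetric])
        then show ?thesis using \<omega> by (auto intro!: ennreal_leI mult_right_mono)
      qed
      finally show "(\<integral>\<^sup>+x. ennreal (?d x powr (- s - 1)) * indicator (cball y t) x \<partial>lborel) \<le>
         ennreal (\<rho> powr (- s - 1) * (\<omega> + C) * \<rho> powr (n - (n - s - 1)) * t powr (n - s - 1))"
        by (simp add: mult_ac)
    qed (use n \<rho> \<omega> \<open>s > 0\<close> \<open>C \<ge> 0\<close> in auto)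
    also have "(n - 1) * (1 + 1 / (n - 1 - (n - s - 1))) * (\<rho> powr (- s - 1) * (\<omega> + C)) * \<rho> =
       (n - 1) * (1 + 1 / s) * (\<omega> + C) * (\<rho> powr (- s - 1) * \<rho>)" by simp
    also have "\<rho> powr (- s - 1) * \<rho> = 2 powr s * ?d y powr (- s)"
      using \<rho> by (simp add: powr_diff powr_mult powr_minus field_simps)
    finally show ?thesis by (simp add: c2_def mult_ac)
  qed
  have "(\<integral>\<^sup>+x. ennreal (\<bar>f x\<bar> * ?d x powr (- s - 1)) \<partial>lborel) \<le>
     ennreal (c1 * c2) * (\<integral>\<^sup>+x. ennreal (h x * ?d x powr (- s)) \<partial>lborel)" if fh': "test_pair G f h" for f h
  proof -
    obtain K where K: "compact K" "K \<subseteq> G" "\<And>x. x \<notin> K \<Longrightarrow> f x = 0" "\<And>x. x \<notin> K \<Longrightarrow> h x = 0"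
      and fh: "upper_gradient f h"
      by (rule test_pairE[OF fh']) (rule that; assumption)
    note [measurable] = upper_gradient_measurable[OF fh]
    have h0: "h x \<ge> 0" for x using fh by (auto simp: upper_gradient_def)
    have "(\<integral>\<^sup>+x. ennreal (\<bar>f x\<bar> * ?d x powr (- s - 1)) \<partial>lborel) \<le>
      (\<integral>\<^sup>+x. ennreal (?d x powr (- s - 1)) * (ennreal c1 * (\<integral>\<^sup>+y. ennreal (h y * norm (x - y) powr (1 - n)) \<partial>lborel)) \<partial>lborel)"
    proof (intro nn_integral_mono)
      fix x
      have "ennreal \<bar>f x\<bar> \<le> ennreal c1 * (\<integral>\<^sup>+y. ennreal (h y * norm (x - y) powr (1 - n)) \<partial>lborel)"
        unfolding c1_def \<omega>_def n_def by (rule value_le_Riesz_potential[OF fh K(1,3)])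
      then show "ennreal (\<bar>f x\<bar> * ?d x powr (- s - 1)) \<le> ennreal (?d x powr (- s - 1)) *
        (ennreal c1 * (\<integral>\<^sup>+y. ennreal (h y * norm (x - y) powr (1 - n)) \<partial>lborel))"
        by (subst mult.commute, subst ennreal_mult) (auto intro!: mult_left_mono)
    qed
    also have "\<dots> = (\<integral>\<^sup>+x. (\<integral>\<^sup>+y. ennreal c1 * (ennreal (?d x powr (- s - 1)) * ennreal (h y * norm (x - y) powr (1 - n))) \<partial>lborel) \<partial>lborel)"
      by (intro nn_integral_cong) (simp add: nn_integral_cmult mult_ac)
    also have "\<dots> = (\<integral>\<^sup>+y. (\<integral>\<^sup>+x. ennreal c1 * (ennreal (?d x powr (- s - 1)) * ennreal (h y * norm (x - y) powr (1 - n))) \<partial>lborel) \<partial>lborel)"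
      by (rule lborel_pair.Fubini') measurable
    also have "\<dots> = (\<integral>\<^sup>+y. ennreal c1 * (ennreal (h y) * (\<integral>\<^sup>+x. ennreal (?d x powr (- s - 1)) * ennreal (norm (x - y) powr (1 - n)) \<partial>lborel)) \<partial>lborel)"
      using h0 by (intro nn_integral_cong) (simp add: nn_integral_cmult[symmetric] ennreal_mult mult_ac)
    also have "\<dots> \<le> (\<integral>\<^sup>+y. ennreal (c1 * c2) * ennreal (h y * ?d y powr (- s)) \<partial>lborel)"
    proof (intro nn_integral_mono)
      fix y
      show "ennreal c1 * (ennreal (h y) * (\<integral>\<^sup>+x. ennreal (?d x powr (- s - 1)) * ennreal (norm (x - y) powr (1 - n)) \<partial>lborel))
        \<le> ennreal (c1 * c2) * ennreal (h y * ?d y powr (- s))"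
      proof (cases "y \<in> G")
        case True
        have "ennreal c1 * (ennreal (h y) * (\<integral>\<^sup>+x. ennreal (?d x powr (- s - 1)) * ennreal (norm (x - y) powr (1 - n)) \<partial>lborel))
          \<le> ennreal c1 * (ennreal (h y) * ennreal (c2 * ?d y powr (- s)))"
          by (intro mult_left_mono pot True) auto
        also have "\<dots> = ennreal (c1 * c2) * ennreal (h y * ?d y powr (- s))"
          using h0 c by (simp add: ennreal_mult[symmetric] mult_ac)
        finally show ?thesis .
      next
        case False
        then have "h y = 0" using K by auto
        then show ?thesis by simp
      qed
    qed
    also have "\<dots> = ennreal (c1 * c2) * (\<integral>\<^sup>+x. ennreal (h x * ?d x powr (- s)) \<partial>lborel)"
      by (rule nn_integral_cmult) measurable
    finally show ?thesis .
  qed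
  then show ?thesis unfolding Hardy_L1_def using c by (intro exI[of _ "c1 * c2"]) auto
qed

text \<open>Split the ball into the layers where the distance is comparable to \<open>2\<^sup>-\<^sup>k t\<close>. The nearest points of
a layer are covered by about \<open>2\<^sup>\<mu>\<^sup>k\<close> balls of that radius, so the layer contributes a multiple of
\<open>2\<^sup>k\<^sup>(\<^sup>s\<^sup>+\<^sup>1\<^sup>+\<^sup>\<mu>\<^sup>-\<^sup>n\<^sup>)\<close>, which is summable.\<close>

lemma distance_integral_of_covers:
  fixes E :: "'a::euclidean_space set"
  defines "n \<equiv> real DIM('a)"
  assumes E: "closed E" "E \<noteq> {}" and "s > 0" and "\<mu> < n - s - 1" and "C \<ge> 0"
    and cover: "\<And>w r R. w \<in> E \<Longrightarrow> 0 < r \<Longrightarrow> r < R \<Longrightarrow>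
      \<exists>F. finite F \<and> real (card F) \<le> C * (R / r) powr \<mu> \<and> E \<inter> ball w R \<subseteq> (\<Union>x\<in>F. ball x r)"
  shows "\<exists>C'\<ge>0. \<forall>y t. t > 0 \<and> infdist y E \<le> 2 * t \<longrightarrow>
      (\<integral>\<^sup>+x. ennreal (infdist x E powr (- s - 1)) * indicator (cball y t) x \<partial>lborel)
        \<le> ennreal (C' * t powr (n - s - 1))"
proof -
  let ?d = "\<lambda>x. infdist x E"
  define \<omega> where "\<omega> = unit_ball_vol n"
  define q where "q = (2::real) powr (s + 1 + \<mu> - n)"
  define c where "c = 2 powr (- s - 1) * C * 2 powr \<mu> * \<omega> * 8 powr n"
  have \<omega>: "\<omega> > 0" by (simp add: n_def \<omega>_def)
  have q: "0 < q" "q < 1" using \<open>\<mu> < n - s - 1\<close> powr_less_mono[of "s + 1 + \<mu> - n" 0 2] by (simp_all add: q_def)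
  have c: "c \<ge> 0" using \<omega> \<open>C \<ge> 0\<close> by (simp add: c_def)
  have "(\<integral>\<^sup>+x. ennreal (?d x powr (- s - 1)) * indicator (cball y t) x \<partial>lborel)
        \<le> ennreal (c / (1 - q) * t powr (n - s - 1))" if t: "t > 0" and y: "?d y \<le> 2 * t" for y t
  proof -
    obtain w where w: "w \<in> E" "?d y = dist y w" using infdist_attains_inf[OF E] by auto
    \<comment> \<open>All points of the ball are at distance at most \<open>3 t < 4 t\<close> from \<open>w\<close>, so the layers start at \<open>4 t\<close>, and their nearest points lie in \<open>B(w, 8 t)\<close>.\<close>
    define r where "r k = 4 * t * 2 powr (- real k)" for k :: nat
    define S where "S k = {x \<in> cball y t. r k / 2 \<le> ?d x \<and> ?d x \<le> r k}" for k
    have r: "r k > 0" for k using t by (simp add: r_def)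
    have r4: "r k \<le> 4 * t" for k
    proof -
      have "(2::real) powr (- real k) \<le> 2 powr 0" by (rule powr_mono) auto
      then show ?thesis using t by (simp add: r_def)
    qed
    have [measurable]: "S k \<in> sets borel" for k
      unfolding S_def by measurable
    have S: "emeasure lborel (S k) \<le> ennreal (C * (8 * t / r k) powr \<mu> * (\<omega> * (2 * r k) powr n))" for k
    proof -
      obtain F where F: "finite F" "real (card F) \<le> C * (8 * t / r k) powr \<mu>"
          "E \<inter> ball w (8 * t) \<subseteq> (\<Union>x\<in>F. ball x (r k))"
        using cover[OF w(1) r[of k], of "8 * t"] r4[of k] t by auto
      have "S k \<subseteq> (\<Union>x\<in>F. ball x (2 * r k))"
      proof
        fix x assume x: "x \<in> S k"
        obtain w' where w': "w' \<in> E" "?d x = dist x w'" using infdist_attains_inf[OF E] by auto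
        have "dist w w' \<le> dist y w + dist y x + dist x w'"
          by (smt (verit) dist_commute dist_triangle)
        also have "\<dots> < 8 * t" using x w w' y r4[of k] t by (auto simp: S_def)
        finally obtain a where a: "a \<in> F" "dist a w' < r k" using w'(1) F(3) by auto
        have "dist a x \<le> dist a w' + dist x w'" by (rule dist_triangle2)
        also have "\<dots> < 2 * r k" using a x w' by (auto simp: S_def)
        finally show "x \<in> (\<Union>x\<in>F. ball x (2 * r k))" using a by auto
      qed
      then have "emeasure lborel (S k) \<le> emeasure lborel (\<Union>x\<in>F. ball x (2 * r k))"
        using F(1) by (intro emeasure_mono) (auto intro!: sets.finite_UN)
      also have "\<dots> \<le> (\<Sum>x\<in>F. emeasure lborel (ball x (2 * r k)))"
        using F(1) by (intro emeasure_subadditive_finite) auto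
      also have "\<dots> = ennreal (real (card F) * (\<omega> * (2 * r k) powr n))"
        using r[of k] \<omega> by (simp add: emeasure_ball_powr \<omega>_def n_def ennreal_mult ennreal_of_nat_eq_real_of_nat)
      also have "\<dots> \<le> ennreal (C * (8 * t / r k) powr \<mu> * (\<omega> * (2 * r k) powr n))"
        using \<omega> by (intro ennreal_leI mult_right_mono F(2)) auto
      finally show ?thesis .
    qed
    have "(\<integral>\<^sup>+x. ennreal (?d x powr (- s - 1)) * indicator (cball y t) x \<partial>lborel) \<le>
      (\<integral>\<^sup>+x. (\<Sum>k. ennreal ((r k / 2) powr (- s - 1)) * indicator (S k) x) \<partial>lborel)"
    proof (intro nn_integral_mono)
      fix x
      show "ennreal (?d x powr (- s - 1)) * indicator (cball y t) x \<le>
        (\<Sum>k. ennreal ((r k / 2) powr (- s - 1)) * indicator (S k) x)"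
      proof (cases "x \<in> cball y t \<and> ?d x > 0")
        case True
        have "?d x \<le> dist x w" by (rule infdist_le[OF w(1)])
        also have "\<dots> \<le> dist y x + dist y w" by (metis dist_commute dist_triangle)
        also have "\<dots> < 4 * t" using True w y t by auto
        finally have d4: "?d x < 4 * t" .
        \<comment> \<open>The layer of \<open>x\<close>: this \<open>k\<close> satisfies \<open>r k / 2 < d(x) \<le> r k\<close>.\<close>
        define k where "k = nat \<lfloor>log 2 (4 * t / ?d x)\<rfloor>"
        have l0: "log 2 (4 * t / ?d x) \<ge> 0" using True d4 by simp
        have k: "real k \<le> log 2 (4 * t / ?d x)" "log 2 (4 * t / ?d x) < real k + 1"
          using l0 by (auto simp: k_def)
        have k1: "2 powr real k \<le> 4 * t / ?d x" "4 * t / ?d x < 2 powr (real k + 1)"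
          using k True t by (auto simp: le_log_iff log_less_iff)
        have "r k / 2 < ?d x" "?d x \<le> r k"
          using k1 True t by (auto simp: r_def powr_minus powr_add field_simps)
        then have xS: "x \<in> S k" using True by (auto simp: S_def)
        have "ennreal (?d x powr (- s - 1)) * indicator (cball y t) x \<le>
           ennreal ((r k / 2) powr (- s - 1)) * indicator (S k) x"
          using \<open>r k / 2 < ?d x\<close> r[of k] xS True \<open>s > 0\<close> by (auto intro!: ennreal_leI powr_mono2')
        also have "\<dots> = (\<Sum>k\<in>{k}. ennreal ((r k / 2) powr (- s - 1)) * indicator (S k) x)"
          by (simp only: sum.insert[OF finite.emptyI] empty_iff not_False_eq_True sum.empty add_0_right)
        also have "\<dots> \<le> (\<Sum>k. ennreal ((r k / 2) powr (- s - 1)) * indicator (S k) x)"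
          by (rule sum_le_suminf) auto
        finally show ?thesis .
      next
        case False
        then show ?thesis using infdist_nonneg[of x E] by (cases "?d x = 0") auto
      qed
    qed
    also have "\<dots> = (\<Sum>k. \<integral>\<^sup>+x. ennreal ((r k / 2) powr (- s - 1)) * indicator (S k) x \<partial>lborel)"
      by (rule nn_integral_suminf) measurable
    also have "\<dots> \<le> (\<Sum>k. ennreal (c * t powr (n - s - 1) * q ^ k))"
    proof (intro suminf_le)
      fix k
      have "(\<integral>\<^sup>+x. ennreal ((r k / 2) powr (- s - 1)) * indicator (S k) x \<partial>lborel)
        = ennreal ((r k / 2) powr (- s - 1)) * emeasure lborel (S k)"
        by (subst nn_integral_cmult) auto
      also have "\<dots> \<le> ennreal ((r k / 2) powr (- s - 1)) * ennreal (C * (8 * t / r k) powr \<mu> * (\<omega> * (2 * r k) powr n))"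
        by (intro mult_left_mono S) auto
      also have "\<dots> = ennreal ((r k / 2) powr (- s - 1) * (C * (8 * t / r k) powr \<mu> * (\<omega> * (2 * r k) powr n)))"
        using \<omega> \<open>C \<ge> 0\<close> by (intro ennreal_mult[symmetric]) auto
      also have "(r k / 2) powr (- s - 1) * (C * (8 * t / r k) powr \<mu> * (\<omega> * (2 * r k) powr n)) =
         c * t powr (n - s - 1) * q ^ k"
      proof -
        have "r k / 2 = 2 * t * 2 powr (- real k)" "8 * t / r k = 2 * 2 powr real k" "2 * r k = 8 * t * 2 powr (- real k)"
          using t by (auto simp: r_def powr_minus field_simps)
        moreover have "q ^ k = 2 powr (- real k * (- s - 1)) * 2 powr (real k * \<mu>) * 2 powr (- real k * n)"
          by (simp add: q_def powr_power powr_add[symmetric] algebra_simps)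
        moreover have "t powr (n - s - 1) = t powr (- s - 1) * t powr n"
          by (subst powr_add[symmetric]) (simp add: algebra_simps)
        ultimately show ?thesis
          using t by (simp add: c_def powr_mult powr_powr mult_ac)
      qed
      finally show "(\<integral>\<^sup>+x. ennreal ((r k / 2) powr (- s - 1)) * indicator (S k) x \<partial>lborel) \<le>
        ennreal (c * t powr (n - s - 1) * q ^ k)" .
    qed auto
    also have "\<dots> = ennreal (c * t powr (n - s - 1) * (1 / (1 - q)))"
      using q c by (intro suminf_ennreal_eq sums_mult geometric_sums) auto
    finally show ?thesis by (simp add: mult_ac)
  qed
  then show ?thesis using q c by (intro exI[of _ "c / (1 - q)"]) auto
qed


section \<open>Covers and separated sets from the Assouad dimensions\<close>

lemma covering_number_attained:
  fixes A :: "'a::heine_borel set"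
  assumes "bounded A" "r > 0"
  shows "\<exists>F. finite F \<and> F \<subseteq> A \<and> card F = covering_number A r \<and> A \<subseteq> (\<Union>x\<in>F. ball x r)"
proof -
  have "compact (closure A)" using \<open>bounded A\<close> by (simp add: compact_closure)
  moreover have "closure A \<subseteq> (\<Union>x\<in>A. ball x r)"
    using \<open>r > 0\<close> by (auto simp: closure_approachable)
  ultimately obtain F where "F \<subseteq> A" "finite F" "closure A \<subseteq> (\<Union>x\<in>F. ball x r)"
    by (metis compactE_image open_ball)
  then have "\<exists>k F. finite F \<and> F \<subseteq> A \<and> card F = k \<and> A \<subseteq> (\<Union>x\<in>F. ball x r)"
    using closure_subset[of A] by blast
  then show ?thesis unfolding covering_number_def by (rule LeastI_ex)
qed

lemma covering_number_le:
  assumes "finite F" "F \<subseteq> A" "A \<subseteq> (\<Union>x\<in>F. ball x r)"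
  shows "covering_number A r \<le> card F"
  unfolding covering_number_def by (rule Least_le) (use assms in auto)

text \<open>Greedy choice: as long as fewer points are chosen than a cover needs, some point of \<open>A\<close> is far from all
of them.\<close>

lemma separated_subset_of_covering_number:
  assumes "r > 0" "k \<le> covering_number A r"
  shows "\<exists>F. finite F \<and> F \<subseteq> A \<and> card F = k \<and> (\<forall>x\<in>F. \<forall>y\<in>F. x \<noteq> y \<longrightarrow> r \<le> dist x y)"
  using assms(2)
proof (induction k)
  case 0
  then show ?case by (intro exI[of _ "{}"]) auto
next
  case (Suc k)
  then obtain F where F: "finite F" "F \<subseteq> A" "card F = k" "\<forall>x\<in>F. \<forall>y\<in>F. x \<noteq> y \<longrightarrow> r \<le> dist x y"
    by auto
  have "\<not> A \<subseteq> (\<Union>x\<in>F. ball x r)"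
    using covering_number_le[OF F(1,2)] F(3) Suc.prems by force
  then obtain a where a: "a \<in> A" "\<And>x. x \<in> F \<Longrightarrow> r \<le> dist x a" by force
  then have "a \<notin> F" using \<open>r > 0\<close> by force
  then show ?case using F a
    by (intro exI[of _ "insert a F"]) (auto simp: dist_commute)
qed

text \<open>The definition only speaks of radii below the diameter. For a bounded set a fixed finite cover
by balls of half the diameter extends the bound to all radii, at the price of a larger constant; a
single point is covered by one ball.\<close>

lemma covers_of_upper_Assouad_dim:
  fixes E :: "'a::euclidean_space set"
  assumes "E \<noteq> {}" and dim: "upper_Assouad_dim E < ereal L"
  shows "\<exists>l C. 0 \<le> l \<and> l < L \<and> 0 \<le> C \<and> (\<forall>w\<in>E. \<forall>r R. 0 < r \<and> r < R \<longrightarrow>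
    (\<exists>F. finite F \<and> real (card F) \<le> C * (R / r) powr l \<and> E \<inter> ball w R \<subseteq> (\<Union>x\<in>F. ball x r)))"
proof -
  obtain l C where l: "0 \<le> l" "l < L" and C: "C > 0"
    and N: "\<And>x r R. x \<in> E \<Longrightarrow> 0 < r \<Longrightarrow> r < R \<Longrightarrow> ereal R < ediameter E \<Longrightarrow>
        real (covering_number (E \<inter> ball x R) r) \<le> C * (r / R) powr (- l)"
    using dim unfolding upper_Assouad_dim_def Inf_less_iff by auto
  have inv: "(r / R) powr (- l) = (R / r) powr l" if "0 < r" "r < R" for r R :: real
    using that by (simp add: powr_minus powr_divide)
  have small: "\<exists>F. finite F \<and> real (card F) \<le> C * (R / r) powr l \<and> E \<inter> ball w R \<subseteq> (\<Union>x\<in>F. ball x r)"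
    if "w \<in> E" "0 < r" "r < R" "ereal R < ediameter E" for w r R
    using covering_number_attained[of "E \<inter> ball w R" r] N[OF that] that inv[of r R]
    by (metis bounded_Int bounded_ball)
  show ?thesis
  proof (cases "bounded E \<and> diameter E > 0")
    case False
    have "\<exists>F. finite F \<and> real (card F) \<le> max C 1 * (R / r) powr l \<and> E \<inter> ball w R \<subseteq> (\<Union>x\<in>F. ball x r)"
      if w: "w \<in> E" and r: "0 < r" "r < R" for w r R
    proof (cases "bounded E")
      case True
      with False have "diameter E \<le> 0" by simp
      then have "dist x w \<le> 0" if "x \<in> E" for x
        using diameter_bounded_bound[OF True that w] by linarith
      then have "E \<subseteq> {w}" by auto
      moreover have "1 \<le> (R / r) powr l" using r l by (intro ge_one_powr_ge_zero) auto
      then have "1 \<le> max C 1 * (R / r) powr l"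
        using mult_mono[of 1 "max C 1" 1 "(R / r) powr l"] by simp
      ultimately show ?thesis using r by (intro exI[of _ "{w}"]) auto
    next
      case unb: False
      then obtain F where "finite F" "real (card F) \<le> C * (R / r) powr l" "E \<inter> ball w R \<subseteq> (\<Union>x\<in>F. ball x r)"
        using small[OF w r] by (auto simp: ediameter_def)
      moreover have "C * (R / r) powr l \<le> max C 1 * (R / r) powr l" by (intro mult_right_mono) auto
      ultimately show ?thesis by (intro exI[of _ F]) auto
    qed
    note cov = this
    show ?thesis using l
      by (intro exI[of _ l] exI[of _ "max C 1"] conjI ballI allI impI cov) auto
  next
    case True
    define D where "D = diameter E"
    have D: "D > 0" "ediameter E = ereal D" "bounded E" using True by (auto simp: D_def ediameter_def)
    obtain P where P: "finite P" "P \<subseteq> E" "E \<subseteq> (\<Union>x\<in>P. ball x (D / 2))"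
      using covering_number_attained[OF D(3), of "D / 2"] D(1) by auto
    have P0: "real (card P) \<ge> 1" using P \<open>E \<noteq> {}\<close>
      by (cases "P = {}") (auto simp: Suc_le_eq card_gt_0_iff)
    have "\<exists>F. finite F \<and> real (card F) \<le> (card P * max C 1) * (R / r) powr l \<and> E \<inter> ball w R \<subseteq> (\<Union>x\<in>F. ball x r)"
      if w: "w \<in> E" and r: "0 < r" "r < R" for w r R
    proof -
      have one: "1 \<le> (R / r) powr l" using r l by (intro ge_one_powr_ge_zero) auto
      consider "R < D" | "D / 2 \<le> r" | "r < D / 2" "D \<le> R" by linarith
      then show ?thesis
      proof cases
        case 1
        then obtain F where F: "finite F" "real (card F) \<le> C * (R / r) powr l" "E \<inter> ball w R \<subseteq> (\<Union>x\<in>F. ball x r)"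
          using small[OF w r] D by auto
        have "1 * C \<le> real (card P) * max C 1" using P0 C by (intro mult_mono) auto
        then have "C * (R / r) powr l \<le> (card P * max C 1) * (R / r) powr l" by (intro mult_right_mono) auto
        then show ?thesis using F by (intro exI[of _ F]) auto
      next
        case 2
        have "real (card P) * 1 * 1 \<le> card P * max C 1 * (R / r) powr l" using one by (intro mult_mono) auto
        moreover have "ball x (D / 2) \<subseteq> ball x r" for x using 2 by auto
        ultimately show ?thesis using P by (intro exI[of _ P]) fastforce
      next
        case 3
        have "\<exists>F. finite F \<and> real (card F) \<le> C * ((D/2) / r) powr l \<and> E \<inter> ball x (D/2) \<subseteq> (\<Union>x\<in>F. ball x r)"
          if "x \<in> P" for x
          using that P r 3 D by (intro small) auto
        then obtain F where F: "\<And>x. x \<in> P \<Longrightarrow> finite (F x)"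
            "\<And>x. x \<in> P \<Longrightarrow> real (card (F x)) \<le> C * ((D/2) / r) powr l"
            "\<And>x. x \<in> P \<Longrightarrow> E \<inter> ball x (D/2) \<subseteq> (\<Union>x\<in>F x. ball x r)"
          by metis
        have "real (card (\<Union>x\<in>P. F x)) \<le> (\<Sum>x\<in>P. real (card (F x)))"
          using card_UN_le[OF P(1), of F] by (metis of_nat_mono of_nat_sum)
        also have "\<dots> \<le> (\<Sum>x\<in>P. max C 1 * (R / r) powr l)"
        proof (intro sum_mono order_trans[OF F(2)] mult_mono powr_mono2)
          show "D / 2 / r \<le> R / r" using r 3 D by (intro divide_right_mono) auto
        qed (use C l r D in auto)
        finally have "real (card (\<Union>x\<in>P. F x)) \<le> (card P * max C 1) * (R / r) powr l" by simp
        moreover have "E \<inter> ball w R \<subseteq> (\<Union>x\<in>(\<Union>x\<in>P. F x). ball x r)"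
        proof
          fix z assume z: "z \<in> E \<inter> ball w R"
          then obtain x where x: "x \<in> P" "z \<in> ball x (D / 2)" using P(3) by blast
          then have "z \<in> (\<Union>x\<in>F x. ball x r)" using F(3)[OF x(1)] z by blast
          then show "z \<in> (\<Union>x\<in>(\<Union>x\<in>P. F x). ball x r)" using x(1) by auto
        qed
        moreover have "finite (\<Union>x\<in>P. F x)" using P(1) F(1) by blast
        ultimately show ?thesis by blast
      qed
    qed
    note cov = this
    show ?thesis using l
      by (intro exI[of _ l] exI[of _ "card P * max C 1"] conjI ballI allI impI cov) auto
  qed
qed

text \<open>A lower bound \<open>c (R/r)\<^sup>l\<close> with \<open>l > \<sigma>\<close> beats \<open>2 (R/r)\<^sup>\<sigma>\<close> once \<open>r/R\<close> is small, and this swallows the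
constant \<open>c\<close>. Unboundedness makes the bound available at every scale.\<close>

lemma branching_of_lower_Assouad_dim:
  fixes E :: "'a::euclidean_space set"
  assumes "\<not> bounded E" and dim: "lower_Assouad_dim E > ereal \<sigma>"
  shows "\<exists>\<kappa>>0. \<kappa> < 1 \<and> (\<forall>w\<in>E. \<forall>R>0. \<exists>F. finite F \<and> F \<subseteq> E \<and> real (card F) \<ge> 2 * \<kappa> powr (- \<sigma>) \<and>
    (\<forall>v\<in>F. ball v (\<kappa> * R) \<subseteq> ball w R) \<and> disjoint_family_on (\<lambda>v. ball v (\<kappa> * R)) F)"
proof -
  obtain l c where l: "0 \<le> l" "\<sigma> < l" and c: "c > 0"
    and N: "\<And>x r R. x \<in> E \<Longrightarrow> 0 < r \<Longrightarrow> r < R \<Longrightarrow>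
        real (covering_number (E \<inter> ball x R) r) \<ge> c * (r / R) powr (- l)"
    using dim \<open>\<not> bounded E\<close> unfolding lower_Assouad_dim_def less_Sup_iff ediameter_def by auto
  \<comment> \<open>The second entry solves \<open>2 \<kappa>\<^sup>l\<^sup>-\<^sup>\<sigma> = c 4\<^sup>-\<^sup>l\<close>. The points are chosen in \<open>B(w, R/2)\<close> with mutual distance \<open>2 \<kappa> R\<close>, which explains the factor 4.\<close>
  define \<kappa> where "\<kappa> = min (1 / 8) ((c * 4 powr (- l) / 2) powr (1 / (l - \<sigma>)))"
  have \<kappa>: "0 < \<kappa>" "\<kappa> \<le> 1 / 8" using c by (auto simp: \<kappa>_def)
  have "\<kappa> powr (l - \<sigma>) \<le> ((c * 4 powr (- l) / 2) powr (1 / (l - \<sigma>))) powr (l - \<sigma>)"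
    using l \<kappa> by (intro powr_mono2) (auto simp: \<kappa>_def)
  also have "\<dots> = c * 4 powr (- l) / 2" using l c by (simp add: powr_powr)
  finally have "2 * \<kappa> powr (l - \<sigma>) * \<kappa> powr (- l) \<le> c * 4 powr (- l) * \<kappa> powr (- l)"
    by (intro mult_right_mono) auto
  then have big: "2 * \<kappa> powr (- \<sigma>) \<le> c * (4 * \<kappa>) powr (- l)"
    using \<kappa> by (simp add: powr_add[symmetric] powr_mult mult.assoc)
  show ?thesis
  proof (intro exI[of _ \<kappa>] conjI ballI allI impI)
    fix w and R :: real assume w: "w \<in> E" and R: "R > 0"
    define A where "A = E \<inter> ball w (R / 2)"
    obtain F where F: "finite F" "F \<subseteq> A" "card F = covering_number A (2 * \<kappa> * R)"
      "\<forall>x\<in>F. \<forall>y\<in>F. x \<noteq> y \<longrightarrow> 2 * \<kappa> * R \<le> dist x y"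
      using separated_subset_of_covering_number[OF _ order_refl, of "2 * \<kappa> * R" A] \<kappa> R by auto
    have "2 * \<kappa> * R < R / 2" using \<kappa> R by simp
    then have "c * (2 * \<kappa> * R / (R / 2)) powr (- l) \<le> real (card F)"
      unfolding F(3) A_def using w R \<kappa> by (intro N) auto
    also have "2 * \<kappa> * R / (R / 2) = 4 * \<kappa>" using R by simp
    finally have "2 * \<kappa> powr (- \<sigma>) \<le> real (card F)" using big by linarith
    moreover have "ball v (\<kappa> * R) \<subseteq> ball w R" if "v \<in> F" for v
    proof
      fix x assume "x \<in> ball v (\<kappa> * R)"
      moreover have "dist w v < R / 2" using that F(2) by (auto simp: A_def)
      moreover have "\<kappa> * R \<le> R / 2" using \<kappa> R by simp
      ultimately show "x \<in> ball w R" using dist_triangle[of w x v] by simp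
    qed
    moreover have "disjoint_family_on (\<lambda>v. ball v (\<kappa> * R)) F"
      unfolding disjoint_family_on_def
    proof (intro ballI impI equals0I)
      fix x y z assume "x \<in> F" "y \<in> F" "x \<noteq> y" and z: "z \<in> ball x (\<kappa> * R) \<inter> ball y (\<kappa> * R)"
      then have "2 * \<kappa> * R \<le> dist x y" using F(4) by blast
      then show False using z dist_triangle2[of x y z] by simp
    qed
    ultimately show "\<exists>F. finite F \<and> F \<subseteq> E \<and> real (card F) \<ge> 2 * \<kappa> powr (- \<sigma>) \<and>
      (\<forall>v\<in>F. ball v (\<kappa> * R) \<subseteq> ball w R) \<and> disjoint_family_on (\<lambda>v. ball v (\<kappa> * R)) F"
      using F by (intro exI[of _ F]) (auto simp: A_def)
  qed (use \<kappa> in auto)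
qed


section \<open>Kernel integrals and averages over boundary balls\<close>

text \<open>Among all sets of given measure a ball is the worst case; the growth lemma with \<open>b = 0\<close> gives the
bound without rearrangement.\<close>

lemma kernel_integral_over_set_le:
  fixes S :: "'a::euclidean_space set"
  defines "n \<equiv> real DIM('a)"
  assumes [measurable]: "S \<in> sets borel" and n: "n > 1" and "\<rho> > 0"
    and S: "emeasure lborel S \<le> ennreal (unit_ball_vol n * \<rho> powr n)"
  shows "(\<integral>\<^sup>+x. indicator S x * ennreal (norm (x - y) powr (1 - n)) \<partial>lborel) \<le>
    ennreal (n * unit_ball_vol n * \<rho>)"
proof -
  let ?\<omega> = "unit_ball_vol n"
  have le: "(\<integral>\<^sup>+x. indicator S x * indicator (cball y t) x \<partial>lborel) \<le> emeasure lborel S"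
       "(\<integral>\<^sup>+x. indicator S x * indicator (cball y t) x \<partial>lborel) \<le> emeasure lborel (cball y t)" for t
  proof -
    have "(\<integral>\<^sup>+x. indicator S x * indicator (cball y t) x \<partial>lborel) = emeasure lborel (S \<inter> cball y t)"
      by (simp add: indicator_inter_arith[symmetric])
    then show "(\<integral>\<^sup>+x. indicator S x * indicator (cball y t) x \<partial>lborel) \<le> emeasure lborel S"
       "(\<integral>\<^sup>+x. indicator S x * indicator (cball y t) x \<partial>lborel) \<le> emeasure lborel (cball y t)"
      by (auto intro!: emeasure_mono)
  qed
  have "(\<integral>\<^sup>+x. indicator S x * ennreal (norm (x - y) powr (1 - n)) \<partial>lborel) \<le>
    ennreal ((n - 1) * (1 + 1 / (n - 1 - 0)) * ?\<omega> * \<rho>)"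
    unfolding n_def
  proof (rule Riesz_potential_le_of_growth; (unfold n_def[symmetric])?)
    show "(\<integral>\<^sup>+x. indicator S x * indicator (cball y t) x \<partial>lborel) \<le> ennreal (?\<omega> * t powr n)" if "0 < t" for t
      using le(2)[of t] that by (simp add: emeasure_ball_powr n_def)
    show "(\<integral>\<^sup>+x. indicator S x * indicator (cball y t) x \<partial>lborel) \<le> ennreal (?\<omega> * \<rho> powr (n - 0) * t powr 0)"
      if "\<rho> \<le> t" for t
      using order_trans[OF le(1) S] that \<open>\<rho> > 0\<close> by simp
  qed (use n \<open>\<rho> > 0\<close> in \<open>auto simp: n_def\<close>)
  also have "(n - 1) * (1 + 1 / (n - 1 - 0)) = n" using n by (simp add: field_simps)
  finally show ?thesis .
qed

lemma kernel_integral_regularized_le: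
  fixes y :: "'a::euclidean_space"
  defines "n \<equiv> real DIM('a)"
  assumes "\<rho> > 0" "\<eta> > 0"
  shows "(\<integral>\<^sup>+x. ennreal (max \<rho> (norm (x - y)) powr (- n - \<eta>)) \<partial>lborel) \<le>
    ennreal ((n + \<eta>) * unit_ball_vol n / \<eta> * \<rho> powr (- \<eta>))"
proof -
  let ?\<omega> = "unit_ball_vol n"
  have n: "n > 0" by (simp add: n_def)
  have "(\<integral>\<^sup>+x. ennreal (max \<rho> (norm (x - y)) powr (- n - \<eta>)) \<partial>lborel) \<le>
    (\<integral>\<^sup>+x. ennreal (n + \<eta>) * (\<integral>\<^sup>+t. ennreal (t powr (-(n+\<eta>)-1)) * indicator {max \<rho> (norm (x - y))..} t \<partial>lborel) \<partial>lborel)"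
    using powr_le_tail_integral[of "max \<rho> (norm (x - y))" "n + \<eta>" for x] n assms
    by (intro nn_integral_mono) (auto simp: le_max_iff_disj)
  also have "\<dots> = ennreal (n + \<eta>) * (\<integral>\<^sup>+x. (\<integral>\<^sup>+t. ennreal (t powr (-(n+\<eta>)-1)) * indicator {max \<rho> (norm (x - y))..} t \<partial>lborel) \<partial>lborel)"
    unfolding indicator_def atLeast_iff by (intro nn_integral_cmult) measurable
  also have "(\<integral>\<^sup>+x. (\<integral>\<^sup>+t. ennreal (t powr (-(n+\<eta>)-1)) * indicator {max \<rho> (norm (x - y))..} t \<partial>lborel) \<partial>lborel) =
     (\<integral>\<^sup>+t. (\<integral>\<^sup>+x. ennreal (t powr (-(n+\<eta>)-1)) * indicator {max \<rho> (norm (x - y))..} t \<partial>lborel) \<partial>lborel)"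
    unfolding indicator_def atLeast_iff by (rule lborel_pair.Fubini') measurable
  also have "\<dots> = (\<integral>\<^sup>+t. ennreal ?\<omega> * (ennreal (t powr (-\<eta>-1)) * indicator {\<rho>..} t) \<partial>lborel)"
  proof (intro nn_integral_cong)
    fix t :: real
    have "(\<integral>\<^sup>+x. ennreal (t powr (-(n+\<eta>)-1)) * indicator {max \<rho> (norm (x - y))..} t \<partial>lborel) =
       (\<integral>\<^sup>+x. ennreal (t powr (-(n+\<eta>)-1)) * indicator {\<rho>..} t * indicator (cball y t) x \<partial>lborel)"
      by (intro nn_integral_cong) (auto simp: indicator_def dist_norm norm_minus_commute)
    also have "\<dots> = ennreal (t powr (-(n+\<eta>)-1)) * indicator {\<rho>..} t * emeasure lborel (cball y t)"
      by (subst nn_integral_cmult) auto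
    also have "\<dots> = ennreal ?\<omega> * (ennreal (t powr (-\<eta>-1)) * indicator {\<rho>..} t)"
    proof (cases "\<rho> \<le> t")
      case True
      then have t: "t > 0" using assms by linarith
      have "t powr (-\<eta>-1) = t powr (-(n+\<eta>)-1) * t powr n"
        by (simp add: powr_add[symmetric])
      then show ?thesis
        using t n True by (simp add: emeasure_ball_powr n_def[symmetric] ennreal_mult[symmetric] mult_ac)
    qed auto
    finally show "(\<integral>\<^sup>+x. ennreal (t powr (-(n+\<eta>)-1)) * indicator {max \<rho> (norm (x - y))..} t \<partial>lborel) =
      ennreal ?\<omega> * (ennreal (t powr (-\<eta>-1)) * indicator {\<rho>..} t)" .
  qed
  also have "\<dots> = ennreal ?\<omega> * ennreal (\<rho> powr (-\<eta>) / \<eta>)"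
    using nn_integral_powr_tail[OF assms(2,3)] by (subst nn_integral_cmult) auto
  also have "ennreal (n + \<eta>) * (ennreal ?\<omega> * ennreal (\<rho> powr (-\<eta>) / \<eta>)) =
    ennreal ((n + \<eta>) * ?\<omega> / \<eta> * \<rho> powr (- \<eta>))"
    using n assms(2,3) by (simp add: ennreal_mult[symmetric] del: ennreal_plus)
  finally show ?thesis .
qed

text \<open>For each \<open>z\<close> in the small ball, \<open>\<integral>\<^bsub>B\<^esub> |f|\<close> is at most \<open>|B| |f(z)|\<close> plus a potential; averaging over \<open>z\<close> turns
the kernel into its integral over the small ball, which is of the order of its radius.\<close>

lemma ball_integral_le_subball_integral:
  fixes f h :: "'a::euclidean_space \<Rightarrow> real"
  defines "n \<equiv> real DIM('a)"
  assumes n: "n > 1" and fh: "upper_gradient f h" and \<kappa>: "0 < \<kappa>" and "R > 0"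
    and sub: "ball v (\<kappa> * R) \<subseteq> ball w R"
  shows "(\<integral>\<^sup>+z. ennreal \<bar>f z\<bar> * indicator (ball w R) z \<partial>lborel) \<le>
    ennreal (\<kappa> powr (- n)) * (\<integral>\<^sup>+z. ennreal \<bar>f z\<bar> * indicator (ball v (\<kappa> * R)) z \<partial>lborel) +
    ennreal (2 powr n * \<kappa> powr (1 - n) * R) * (\<integral>\<^sup>+y. ennreal (h y) * indicator (ball w R) y \<partial>lborel)"
proof -
  let ?B = "ball w R" and ?B' = "ball v (\<kappa> * R)"
  define \<omega> where "\<omega> = unit_ball_vol n"
  have \<omega>: "\<omega> > 0" by (simp add: \<omega>_def n_def)
  note [measurable] = upper_gradient_measurable[OF fh]
  have h0: "h x \<ge> 0" for x using fh by (auto simp: upper_gradient_def)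
  define X where "X = (\<integral>\<^sup>+z. ennreal \<bar>f z\<bar> * indicator ?B z \<partial>lborel)"
  define H where "H = (\<integral>\<^sup>+y. ennreal (h y) * indicator ?B y \<partial>lborel)"
  define Y where "Y = (\<integral>\<^sup>+z. ennreal \<bar>f z\<bar> * indicator ?B' z \<partial>lborel)"
  define P where "P z = (\<integral>\<^sup>+y. ennreal (h y * norm (z - y) powr (1 - n)) * indicator ?B y \<partial>lborel)" for z
  have \<kappa>R: "\<kappa> * R > 0" using assms by simp
  have [measurable]: "P \<in> borel_measurable borel"
    unfolding P_def indicator_def mem_ball by measurable
  have pt: "X \<le> ennreal (\<omega> * R powr n) * ennreal \<bar>f z\<bar> + ennreal ((2 * R) powr n / n) * P z" if z: "z \<in> ?B" for z
  proof -
    have "X \<le> (\<integral>\<^sup>+z'. ennreal \<bar>f z\<bar> * indicator ?B z' + ennreal \<bar>f z' - f z\<bar> * indicator ?B z' \<partial>lborel)"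
      unfolding X_def
      by (intro nn_integral_mono) (auto simp: indicator_def ennreal_plus[symmetric] simp del: ennreal_plus intro!: ennreal_leI)
    also have "\<dots> = ennreal (\<omega> * R powr n) * ennreal \<bar>f z\<bar> + (\<integral>\<^sup>+z'. ennreal \<bar>f z' - f z\<bar> * indicator ?B z' \<partial>lborel)"
      using \<open>R > 0\<close> by (subst nn_integral_add) (auto simp: nn_integral_cmult emeasure_ball_powr \<omega>_def n_def mult.commute)
    finally show ?thesis
      using nn_integral_oscillation_le_potential[OF fh z, folded n_def] unfolding P_def
      by (meson add_left_mono order_trans)
  qed
  have PB: "(\<integral>\<^sup>+z. P z * indicator ?B' z \<partial>lborel) \<le> ennreal (n * \<omega> * (\<kappa> * R)) * H"
  proof -
    have "(\<integral>\<^sup>+z. P z * indicator ?B' z \<partial>lborel) =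
      (\<integral>\<^sup>+z. (\<integral>\<^sup>+y. ennreal (h y * norm (z - y) powr (1 - n)) * indicator ?B y * indicator ?B' z \<partial>lborel) \<partial>lborel)"
      unfolding P_def by (intro nn_integral_cong nn_integral_multc[symmetric]) measurable
    also have "\<dots> = (\<integral>\<^sup>+y. (\<integral>\<^sup>+z. ennreal (h y * norm (z - y) powr (1 - n)) * indicator ?B y * indicator ?B' z \<partial>lborel) \<partial>lborel)"
      unfolding indicator_def mem_ball by (rule lborel_pair.Fubini') measurable
    also have "\<dots> = (\<integral>\<^sup>+y. (ennreal (h y) * indicator ?B y) * (\<integral>\<^sup>+z. indicator ?B' z * ennreal (norm (z - y) powr (1 - n)) \<partial>lborel) \<partial>lborel)"
      using h0 by (intro nn_integral_cong, subst nn_integral_cmult[symmetric]) (auto simp: ennreal_mult mult_ac)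
    also have "\<dots> \<le> (\<integral>\<^sup>+y. (ennreal (h y) * indicator ?B y) * ennreal (n * \<omega> * (\<kappa> * R)) \<partial>lborel)"
      unfolding n_def \<omega>_def using n \<kappa>R
      by (intro nn_integral_mono mult_left_mono kernel_integral_over_set_le) (auto simp: emeasure_ball_powr n_def)
    also have "\<dots> = H * ennreal (n * \<omega> * (\<kappa> * R))"
      unfolding H_def by (rule nn_integral_multc) measurable
    finally show ?thesis by (simp add: mult.commute)
  qed
  have "ennreal (\<omega> * (\<kappa> * R) powr n) * X = (\<integral>\<^sup>+z. X * indicator ?B' z \<partial>lborel)"
    using \<kappa>R by (simp add: nn_integral_cmult emeasure_ball_powr \<omega>_def n_def mult.commute)
  also have "\<dots> \<le> (\<integral>\<^sup>+z. ennreal (\<omega> * R powr n) * (ennreal \<bar>f z\<bar> * indicator ?B' z) + ennreal ((2 * R) powr n / n) * (P z * indicator ?B' z) \<partial>lborel)"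
    using pt sub by (intro nn_integral_mono) (auto simp: indicator_def)
  also have "\<dots> = ennreal (\<omega> * R powr n) * Y + ennreal ((2 * R) powr n / n) * (\<integral>\<^sup>+z. P z * indicator ?B' z \<partial>lborel)"
    unfolding Y_def by (subst nn_integral_add; (subst nn_integral_cmult)?; (subst nn_integral_cmult)?) auto
  also have "\<dots> \<le> ennreal (\<omega> * R powr n) * Y + ennreal ((2 * R) powr n / n) * (ennreal (n * \<omega> * (\<kappa> * R)) * H)"
    by (intro add_left_mono mult_left_mono PB) auto
  also have "\<dots> = ennreal (\<omega> * (\<kappa> * R) powr n) * (ennreal (\<kappa> powr (- n)) * Y + ennreal (2 powr n * \<kappa> powr (1 - n) * R) * H)"
  proof -
    have "\<omega> * R powr n = \<omega> * (\<kappa> * R) powr n * \<kappa> powr (- n)"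
      using \<kappa> \<open>R > 0\<close> by (simp add: powr_mult powr_minus)
    moreover have "(2 * R) powr n / n * (n * \<omega> * (\<kappa> * R)) = \<omega> * (\<kappa> * R) powr n * (2 powr n * \<kappa> powr (1 - n) * R)"
      using \<kappa> \<open>R > 0\<close> n by (simp add: powr_mult powr_diff)
    ultimately have
      "ennreal (\<omega> * R powr n) = ennreal (\<omega> * (\<kappa> * R) powr n) * ennreal (\<kappa> powr (- n))"
      "ennreal ((2 * R) powr n / n) * ennreal (n * \<omega> * (\<kappa> * R)) =
        ennreal (\<omega> * (\<kappa> * R) powr n) * ennreal (2 powr n * \<kappa> powr (1 - n) * R)"
      using \<omega> \<kappa> \<open>R > 0\<close> n
      by (subst ennreal_mult[symmetric]; (subst ennreal_mult[symmetric])?; simp)+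
    then show ?thesis
      by (simp only: distrib_left mult.assoc[symmetric])
  qed
  finally show ?thesis
    using \<omega> \<kappa>R unfolding X_def Y_def H_def
    by (subst (asm) ennreal_mult_le_mult_iff) auto
qed

lemma test_pair_vanishes_near_complement:
  assumes "test_pair G f h"
  obtains \<epsilon> where "\<epsilon> > 0" "\<And>x. infdist x (- G) < \<epsilon> \<Longrightarrow> - G \<noteq> {} \<Longrightarrow> open G \<Longrightarrow> f x = 0 \<and> h x = 0"
proof -
  obtain K where K: "compact K" "K \<subseteq> G" "\<And>x. x \<notin> K \<Longrightarrow> f x = 0" "\<And>x. x \<notin> K \<Longrightarrow> h x = 0"
    by (rule test_pairE[OF assms]) (rule that; assumption)
  show thesis
  proof (cases "K = {} \<or> - G = {} \<or> \<not> open G")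
    case True
    then show ?thesis using K by (intro that[of 1]) auto
  next
    case False
    obtain x0 where x0: "x0 \<in> K" "\<And>x. x \<in> K \<Longrightarrow> infdist x0 (- G) \<le> infdist x (- G)"
      using continuous_attains_inf[OF K(1) _ continuous_on_infdist[OF continuous_on_id], of "- G"] False
      by blast
    have "infdist x0 (- G) > 0"
      using x0 K False by (metis Compl_iff closed_Compl in_closed_iff_infdist_zero infdist_nonneg less_le subsetD)
    then show ?thesis using x0(2) K by (intro that[of "infdist x0 (- G)"]) (auto simp: not_less[symmetric])
  qed
qed

text \<open>Induction on the number of steps that reach the scale at which \<open>f\<close> vanishes. In one step the mean over
\<open>B(w,R)\<close> is compared with the means over the smaller balls. These are disjoint, so the induction
hypotheses add up to a single integral over \<open>B(w,R)\<close>, and their large number makes the resulting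
coefficient half of the claimed constant. The other half pays for the comparison, as \<open>d \<le> R\<close> on \<open>B(w,R)\<close>.\<close>

lemma boundary_ball_integral_le:
  fixes G :: "'a::euclidean_space set"
  defines "n \<equiv> real DIM('a)" and "E \<equiv> - G"
  assumes n: "n > 1" and G: "open G" "- G \<noteq> {}" and "\<sigma> > 0" and \<kappa>: "0 < \<kappa>" "\<kappa> < 1"
    and branching: "\<And>w R. w \<in> E \<Longrightarrow> R > 0 \<Longrightarrow> \<exists>F. finite F \<and> F \<subseteq> E \<and>
      real (card F) \<ge> 2 * \<kappa> powr (- (n - 1 - \<sigma>)) \<and>
      (\<forall>v\<in>F. ball v (\<kappa> * R) \<subseteq> ball w R) \<and> disjoint_family_on (\<lambda>v. ball v (\<kappa> * R)) F"
    and fh: "test_pair G f h" and w: "w \<in> E" and R: "R > 0"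
  shows "(\<integral>\<^sup>+z. ennreal \<bar>f z\<bar> * indicator (ball w R) z \<partial>lborel) \<le>
    ennreal (2 * (2 powr n * \<kappa> powr (1 - n)) * R powr (1 + \<sigma>)) *
      (\<integral>\<^sup>+y. ennreal (h y * infdist y E powr (- \<sigma>)) * indicator (ball w R) y \<partial>lborel)"
proof -
  define C1 where "C1 = 2 powr n * \<kappa> powr (1 - n)"
  have C1: "C1 > 0" using \<kappa> by (simp add: C1_def)
  have ug: "upper_gradient f h" using fh by (simp add: test_pair_def)
  note [measurable] = upper_gradient_measurable[OF ug]
  have h0: "h x \<ge> 0" for x using ug by (auto simp: upper_gradient_def)
  obtain \<epsilon> where \<epsilon>: "\<epsilon> > 0" "\<And>x. infdist x E < \<epsilon> \<Longrightarrow> f x = 0" "\<And>x. infdist x E < \<epsilon> \<Longrightarrow> h x = 0"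
    using test_pair_vanishes_near_complement[OF fh] G unfolding E_def by metis
  define X where "X w R = (\<integral>\<^sup>+z. ennreal \<bar>f z\<bar> * indicator (ball w R) z \<partial>lborel)" for w R
  define H where "H w R = (\<integral>\<^sup>+y. ennreal (h y) * indicator (ball w R) y \<partial>lborel)" for w R
  define Z where "Z w R = (\<integral>\<^sup>+y. ennreal (h y * infdist y E powr (- \<sigma>)) * indicator (ball w R) y \<partial>lborel)" for w R
  have "X w R \<le> ennreal (2 * C1 * R powr (1 + \<sigma>)) * Z w R" if "w \<in> E" "R > 0" "\<kappa> ^ k * R \<le> \<epsilon>" for k w R
    using that
  proof (induction k arbitrary: w R)
    case 0
    have "f z = 0" if "z \<in> ball w R" for z
      using infdist_le[OF 0(1), of z] that 0(3) by (intro \<epsilon>) (simp add: dist_commute)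
    then have "X w R = (\<integral>\<^sup>+(z::'a). 0 \<partial>lborel)"
      unfolding X_def by - (rule nn_integral_cong, auto simp: indicator_def)
    then show ?case by simp
  next
    case (Suc k)
    obtain F where F: "finite F" "F \<subseteq> E" "real (card F) \<ge> 2 * \<kappa> powr (- (n - 1 - \<sigma>))"
      "\<And>v. v \<in> F \<Longrightarrow> ball v (\<kappa> * R) \<subseteq> ball w R" "disjoint_family_on (\<lambda>v. ball v (\<kappa> * R)) F"
      using branching[OF Suc.prems(1,2)] by blast
    define m where "m = real (card F)"
    have m: "m > 0" using F(3) \<kappa> unfolding m_def by (smt (verit) powr_gt_zero)
    have HZ: "H w R \<le> ennreal (R powr \<sigma>) * Z w R"
    proof -
      have "H w R \<le> (\<integral>\<^sup>+y. ennreal (R powr \<sigma>) * (ennreal (h y * infdist y E powr (- \<sigma>)) * indicator (ball w R) y) \<partial>lborel)"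
        unfolding H_def
      proof (intro nn_integral_mono)
        fix y
        show "ennreal (h y) * indicator (ball w R) y \<le>
          ennreal (R powr \<sigma>) * (ennreal (h y * infdist y E powr (- \<sigma>)) * indicator (ball w R) y)"
        proof (cases "y \<in> ball w R \<and> \<epsilon> \<le> infdist y E")
          case True
          then have d: "0 < infdist y E" "infdist y E \<le> R"
            using \<epsilon>(1) infdist_le[OF Suc.prems(1), of y] by (auto simp: dist_commute)
          have "1 = R powr \<sigma> * R powr (- \<sigma>)" using Suc.prems by (simp add: powr_minus)
          also have "\<dots> \<le> R powr \<sigma> * infdist y E powr (- \<sigma>)"
            using d \<open>\<sigma> > 0\<close> by (intro mult_left_mono powr_mono2') auto
          finally have "h y * 1 \<le> h y * (R powr \<sigma> * infdist y E powr (- \<sigma>))"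
            by (intro mult_left_mono h0)
          then show ?thesis using True h0 by (auto simp: ennreal_mult[symmetric] mult_ac intro!: ennreal_leI)
        next
          case False
          then show ?thesis using \<epsilon>(3)[of y] by (auto simp: indicator_def not_le)
        qed
      qed
      also have "\<dots> = ennreal (R powr \<sigma>) * Z w R"
        unfolding Z_def by (rule nn_integral_cmult) measurable
      finally show ?thesis .
    qed
    have ZZ: "(\<Sum>v\<in>F. Z v (\<kappa> * R)) \<le> Z w R"
    proof -
      have "(\<Sum>v\<in>F. Z v (\<kappa> * R)) =
        (\<integral>\<^sup>+y. (\<Sum>v\<in>F. ennreal (h y * infdist y E powr (- \<sigma>)) * indicator (ball v (\<kappa> * R)) y) \<partial>lborel)"
        unfolding Z_def by (rule nn_integral_sum[symmetric]) measurable
      also have "\<dots> \<le> Z w R"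
        unfolding Z_def
      proof (intro nn_integral_mono)
        fix y
        have "(\<Sum>v\<in>F. indicator (ball v (\<kappa> * R)) y) = (indicator (\<Union>v\<in>F. ball v (\<kappa> * R)) y :: ennreal)"
          by (rule indicator_UN_disjoint[symmetric, OF F(1,5)])
        also have "\<dots> \<le> indicator (ball w R) y"
          using UN_least[of F "\<lambda>v. ball v (\<kappa> * R)" "ball w R"] F(4) unfolding indicator_def by (auto simp del: mem_ball)
        finally show "(\<Sum>v\<in>F. ennreal (h y * infdist y E powr (- \<sigma>)) * indicator (ball v (\<kappa> * R)) y) \<le>
          ennreal (h y * infdist y E powr (- \<sigma>)) * indicator (ball w R) y"
          by (simp only: sum_distrib_left[symmetric]) (rule mult_left_mono, auto)
      qed
      finally show ?thesis .
    qed
    have "ennreal m * X w R = (\<Sum>v\<in>F. X w R)"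
      by (simp add: m_def ennreal_of_nat_eq_real_of_nat)
    also have "\<dots> \<le> (\<Sum>v\<in>F. ennreal (\<kappa> powr (- n)) * (ennreal (2 * C1 * (\<kappa> * R) powr (1 + \<sigma>)) * Z v (\<kappa> * R)) + ennreal (C1 * R) * (ennreal (R powr \<sigma>) * Z w R))"
    proof (intro sum_mono)
      fix v assume v: "v \<in> F"
      have "X w R \<le> ennreal (\<kappa> powr (- n)) * X v (\<kappa> * R) + ennreal (C1 * R) * H w R"
        unfolding X_def H_def C1_def n_def
        by (rule ball_integral_le_subball_integral[OF _ ug \<kappa>(1) Suc.prems(2) F(4)[OF v]]) (use n in \<open>simp add: n_def\<close>)
      also have "\<dots> \<le> ennreal (\<kappa> powr (- n)) * (ennreal (2 * C1 * (\<kappa> * R) powr (1 + \<sigma>)) * Z v (\<kappa> * R)) + ennreal (C1 * R) * (ennreal (R powr \<sigma>) * Z w R)"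
        using v F(2) Suc.prems \<kappa> by (intro add_mono mult_left_mono Suc.IH HZ) (auto simp: mult_ac)
      finally show "X w R \<le> ennreal (\<kappa> powr (- n)) * (ennreal (2 * C1 * (\<kappa> * R) powr (1 + \<sigma>)) * Z v (\<kappa> * R)) + ennreal (C1 * R) * (ennreal (R powr \<sigma>) * Z w R)" .
    qed
    also have "\<dots> = ennreal (\<kappa> powr (- n)) * (ennreal (2 * C1 * (\<kappa> * R) powr (1 + \<sigma>)) * (\<Sum>v\<in>F. Z v (\<kappa> * R))) + ennreal m * (ennreal (C1 * R) * (ennreal (R powr \<sigma>) * Z w R))"
      by (simp add: sum.distrib sum_distrib_left m_def ennreal_of_nat_eq_real_of_nat)
    also have "\<dots> \<le> ennreal (\<kappa> powr (- n)) * (ennreal (2 * C1 * (\<kappa> * R) powr (1 + \<sigma>)) * Z w R) + ennreal m * (ennreal (C1 * R) * (ennreal (R powr \<sigma>) * Z w R))"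
      by (intro add_right_mono mult_left_mono ZZ) auto
    also have "\<dots> = ennreal (\<kappa> powr (- n) * (2 * C1 * (\<kappa> * R) powr (1 + \<sigma>)) + m * (C1 * R * R powr \<sigma>)) * Z w R"
      using m C1 Suc.prems by (subst ennreal_plus) (auto simp: ennreal_mult distrib_right mult.assoc)
    also have "\<dots> \<le> ennreal (m * (2 * C1 * R powr (1 + \<sigma>))) * Z w R"
    proof (intro mult_right_mono ennreal_leI)
      have "\<kappa> powr (- n) * (2 * C1 * (\<kappa> * R) powr (1 + \<sigma>)) = (2 * \<kappa> powr (- (n - 1 - \<sigma>))) * (C1 * R powr (1 + \<sigma>))"
      proof -
        have "\<kappa> powr (- (n - 1 - \<sigma>)) = \<kappa> powr (- n) * \<kappa> powr (1 + \<sigma>)"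
          by (simp add: powr_add[symmetric] algebra_simps)
        then show ?thesis using \<kappa> Suc.prems by (simp add: powr_mult)
      qed
      also have "\<dots> \<le> m * (C1 * R powr (1 + \<sigma>))"
        using F(3) C1 unfolding m_def by (intro mult_right_mono) auto
      finally show "\<kappa> powr (- n) * (2 * C1 * (\<kappa> * R) powr (1 + \<sigma>)) + m * (C1 * R * R powr \<sigma>) \<le> m * (2 * C1 * R powr (1 + \<sigma>))"
        using Suc.prems by (simp add: powr_add algebra_simps)
    qed auto
    also have "\<dots> = ennreal m * (ennreal (2 * C1 * R powr (1 + \<sigma>)) * Z w R)"
      using m C1 by (simp add: ennreal_mult mult.assoc)
    finally show ?case
      using m by (subst (asm) ennreal_mult_le_mult_iff) auto
  qed
  moreover obtain k where "\<kappa> ^ k * R \<le> \<epsilon>"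
  proof -
    obtain k where "\<kappa> ^ k < \<epsilon> / R" using real_arch_pow_inv[of "\<epsilon> / R" \<kappa>] \<epsilon> R \<kappa> by auto
    then show thesis using R by (intro that[of k]) (simp add: field_simps)
  qed
  ultimately show ?thesis using w R unfolding X_def Z_def C1_def by blast
qed


section \<open>The L1 Hardy inequality for fat complements\<close>

lemma infdist_pos_of_open:
  assumes "open G" "- G \<noteq> {}" "x \<in> G"
  shows "0 < infdist x (- G)"
  using assms by (metis Compl_iff closed_Compl in_closed_iff_infdist_zero infdist_nonneg less_le)

text \<open>For \<open>x \<in> G\<close> with nearest point \<open>w\<close> in the complement use the hypothesis on \<open>B(w, 2 d(x))\<close>. This ball
contains \<open>x\<close> and lies in \<open>B(x, 3 d(x))\<close>, so \<open>f(x)\<close> is bounded by an integral of \<open>h\<close> against a kernel \<open>k(x, y)\<close>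
that lives on \<open>|x - y| < 3 d(x)\<close>. There \<open>d(x)\<close> dominates both \<open>|x - y|\<close> and \<open>d(y)\<close>, so integrating in \<open>x\<close>
leaves a multiple of \<open>d(y)\<^sup>-\<^sup>s\<close>.\<close>

lemma Hardy_L1_of_boundary_ball_integrals:
  fixes G :: "'a::euclidean_space set"
  defines "n \<equiv> real DIM('a)" and "E \<equiv> - G"
  assumes n: "n > 1" and G: "open G" "- G \<noteq> {}" and \<sigma>: "0 < \<sigma>" "\<sigma> < s" and "C \<ge> 0"
    and bdry: "\<And>f h w R. test_pair G f h \<Longrightarrow> w \<in> E \<Longrightarrow> R > 0 \<Longrightarrow>
      (\<integral>\<^sup>+z. ennreal \<bar>f z\<bar> * indicator (ball w R) z \<partial>lborel) \<le>
      ennreal (C * R powr (1 + \<sigma>)) *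
      (\<integral>\<^sup>+y. ennreal (h y * infdist y E powr (- \<sigma>)) * indicator (ball w R) y \<partial>lborel)"
  shows "Hardy_L1 s G"
proof -
  let ?d = "\<lambda>x. infdist x E"
  define \<omega> where "\<omega> = unit_ball_vol n"
  have \<omega>: "\<omega> > 0" by (simp add: n_def \<omega>_def)
  have E: "closed E" "E \<noteq> {}" using G by (auto simp: E_def closed_Compl)
  define C3 where "C3 = C * 2 powr (1 + \<sigma> - n) / \<omega>"
  define C4 where "C4 = 2 powr n / n / \<omega>"
  have C34: "C3 \<ge> 0" "C4 \<ge> 0" using \<open>C \<ge> 0\<close> \<omega> n by (auto simp: C3_def C4_def)
  define \<eta> where "\<eta> = s - \<sigma>"
  have \<eta>: "\<eta> > 0" using \<sigma> by (simp add: \<eta>_def)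
  define P where "P a = (n + a) * \<omega> / a" for a
  define C5 where "C5 = C3 * 4 powr (n + \<eta>) * P \<eta> + C4 * 4 powr (s + 1) * (n * \<omega> + P s)"
  have P0: "P a \<ge> 0" if "a > 0" for a using that n \<omega> by (simp add: P_def)
  have C5: "C5 \<ge> 0" using C34 P0[OF \<eta>] P0[of s] n \<omega> \<sigma> by (simp add: C5_def)
  define k where "k x y = indicator {p. norm (fst p - snd p) < 3 * ?d (fst p)} (x, y) *
     ennreal (C3 * ?d x powr (- n - \<eta>) * ?d y powr (- \<sigma>) + C4 * ?d x powr (- s - 1) * norm (x - y) powr (1 - n))" for x y
  have [measurable]: "case_prod k \<in> borel_measurable (lborel \<Otimes>\<^sub>M lborel)"
    unfolding k_def indicator_def mem_Collect_eq fst_conv snd_conv by measurable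
  have ky: "(\<integral>\<^sup>+x. k x y \<partial>lborel) \<le> ennreal (C5 * ?d y powr (- s))" if "y \<in> G" for y
  proof -
    define \<rho> where "\<rho> = ?d y"
    have \<rho>: "\<rho> > 0" using infdist_pos_of_open[OF G that] by (simp add: \<rho>_def E_def)
    define m where "m x = max \<rho> (norm (x - y))" for x
    have [measurable]: "m \<in> borel_measurable borel" unfolding m_def by measurable
    define A where "A = C3 * 4 powr (n + \<eta>) * \<rho> powr (- \<sigma>)"
    define B where "B = C4 * 4 powr (s + 1)"
    have AB: "A \<ge> 0" "B \<ge> 0" using C34 by (auto simp: A_def B_def)
    have "(\<integral>\<^sup>+x. k x y \<partial>lborel) \<le>
      (\<integral>\<^sup>+x. ennreal A * ennreal (m x powr (- n - \<eta>)) + ennreal B *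
         (ennreal (\<rho> powr (- s - 1)) * (indicator (cball y \<rho>) x * ennreal (norm (x - y) powr (1 - n)))
          + ennreal (m x powr (- n - s))) \<partial>lborel)"
    proof (intro nn_integral_mono)
      fix x
      show "k x y \<le> ennreal A * ennreal (m x powr (- n - \<eta>)) + ennreal B *
         (ennreal (\<rho> powr (- s - 1)) * (indicator (cball y \<rho>) x * ennreal (norm (x - y) powr (1 - n)))
          + ennreal (m x powr (- n - s)))"
      proof (cases "norm (x - y) < 3 * ?d x")
        case True
        have "\<rho> \<le> ?d x + norm (x - y)"
          unfolding \<rho>_def by (metis dist_commute dist_norm infdist_triangle)
        then have md: "m x / 4 \<le> ?d x" "m x > 0"
          using True \<rho> infdist_nonneg[of x E] by (auto simp: m_def max_def)
        have d0: "?d x > 0" using md by linarith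
        have p: "?d x powr (- a) \<le> 4 powr a * m x powr (- a)" if "a > 0" for a
        proof -
          have "?d x powr (- a) \<le> (m x / 4) powr (- a)"
            using md that by (intro powr_mono2') auto
          also have "\<dots> = 4 powr a * m x powr (- a)"
            using md by (simp add: powr_divide powr_minus field_simps)
          finally show ?thesis .
        qed
        have 1: "C3 * ?d x powr (- n - \<eta>) * ?d y powr (- \<sigma>) \<le> A * m x powr (- n - \<eta>)"
        proof -
          have "C3 * ?d x powr (- n - \<eta>) * ?d y powr (- \<sigma>) \<le> C3 * (4 powr (n + \<eta>) * m x powr (- n - \<eta>)) * ?d y powr (- \<sigma>)"
            using p[of "n + \<eta>"] n \<eta> C34 by (intro mult_right_mono mult_left_mono) auto
          then show ?thesis by (simp add: A_def \<rho>_def mult_ac)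
        qed
        have 2: "m x powr (- s - 1) * norm (x - y) powr (1 - n) \<le>
            \<rho> powr (- s - 1) * (indicator (cball y \<rho>) x * norm (x - y) powr (1 - n)) + m x powr (- n - s)"
        proof (cases "x \<in> cball y \<rho>")
          case True
          then have "m x = \<rho>" by (simp add: m_def dist_norm norm_minus_commute)
          then show ?thesis using True by simp
        next
          case False
          then have "m x = norm (x - y)" by (simp add: m_def dist_norm norm_minus_commute)
          moreover have "- s - 1 + (1 - n) = - n - s" by simp
          ultimately show ?thesis using False by (simp only: powr_add[symmetric]) simp
        qed
        have 3: "C4 * ?d x powr (- s - 1) * norm (x - y) powr (1 - n) \<le>
            B * (\<rho> powr (- s - 1) * (indicator (cball y \<rho>) x * norm (x - y) powr (1 - n)) + m x powr (- n - s))"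
        proof -
          have "C4 * ?d x powr (- s - 1) * norm (x - y) powr (1 - n) \<le>
            C4 * (4 powr (s + 1) * m x powr (- s - 1)) * norm (x - y) powr (1 - n)"
            using p[of "s + 1"] \<sigma> C34 by (intro mult_right_mono mult_left_mono) auto
          also have "\<dots> = B * (m x powr (- s - 1) * norm (x - y) powr (1 - n))" by (simp add: B_def mult_ac)
          also have "\<dots> \<le> B * (\<rho> powr (- s - 1) * (indicator (cball y \<rho>) x * norm (x - y) powr (1 - n)) + m x powr (- n - s))"
            by (intro mult_left_mono 2 AB)
          finally show ?thesis .
        qed
        have "k x y \<le> ennreal (A * m x powr (- n - \<eta>) +
            B * (\<rho> powr (- s - 1) * (indicator (cball y \<rho>) x * norm (x - y) powr (1 - n)) + m x powr (- n - s)))"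
          unfolding k_def using True 1 3 by (auto intro!: ennreal_leI add_mono)
        also have "\<dots> = ennreal A * ennreal (m x powr (- n - \<eta>)) + ennreal B *
         (ennreal (\<rho> powr (- s - 1)) * (indicator (cball y \<rho>) x * ennreal (norm (x - y) powr (1 - n)))
          + ennreal (m x powr (- n - s)))"
          using AB by (simp add: ennreal_mult ennreal_indicator)
        finally show ?thesis .
      qed (simp add: k_def)
    qed
    also have "\<dots> = ennreal A * (\<integral>\<^sup>+x. ennreal (m x powr (- n - \<eta>)) \<partial>lborel) + ennreal B *
         (ennreal (\<rho> powr (- s - 1)) * (\<integral>\<^sup>+x. indicator (cball y \<rho>) x * ennreal (norm (x - y) powr (1 - n)) \<partial>lborel)
          + (\<integral>\<^sup>+x. ennreal (m x powr (- n - s)) \<partial>lborel))"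
      by (simp add: nn_integral_add nn_integral_cmult)
    also have "\<dots> \<le> ennreal A * ennreal (P \<eta> * \<rho> powr (- \<eta>)) + ennreal B *
         (ennreal (\<rho> powr (- s - 1)) * ennreal (n * \<omega> * \<rho>) + ennreal (P s * \<rho> powr (- s)))"
      using kernel_integral_regularized_le[of \<rho> \<eta> y, folded n_def] kernel_integral_regularized_le[of \<rho> s y, folded n_def]
        kernel_integral_over_set_le[of "cball y \<rho>" \<rho> y, folded n_def] n \<rho> \<eta> \<sigma>
      unfolding m_def P_def \<omega>_def
      by (intro add_mono mult_left_mono) (auto simp: emeasure_ball_powr n_def)
    also have "\<dots> = ennreal (A * (P \<eta> * \<rho> powr (- \<eta>)) + B * (\<rho> powr (- s - 1) * (n * \<omega> * \<rho>) + P s * \<rho> powr (- s)))"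
      using AB P0 \<eta> \<sigma> n \<omega> \<rho> by (simp add: ennreal_mult)
    also have "A * (P \<eta> * \<rho> powr (- \<eta>)) + B * (\<rho> powr (- s - 1) * (n * \<omega> * \<rho>) + P s * \<rho> powr (- s)) = C5 * \<rho> powr (- s)"
    proof -
      have e1: "\<rho> powr (- \<sigma>) * \<rho> powr (- \<eta>) = \<rho> powr (- s)"
        by (simp add: powr_add[symmetric] \<eta>_def)
      have e2: "\<rho> powr (- s - 1) * \<rho> = \<rho> powr (- s)"
        using \<rho> by (simp add: powr_diff)
      have "A * (P \<eta> * \<rho> powr (- \<eta>)) + B * (\<rho> powr (- s - 1) * (n * \<omega> * \<rho>) + P s * \<rho> powr (- s)) =
        C3 * 4 powr (n + \<eta>) * P \<eta> * (\<rho> powr (- \<sigma>) * \<rho> powr (- \<eta>)) +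
        B * (n * \<omega> * (\<rho> powr (- s - 1) * \<rho>) + P s * \<rho> powr (- s))"
        by (simp add: A_def)
      then show ?thesis unfolding e1 e2 by (simp add: B_def C5_def algebra_simps)
    qed
    finally show ?thesis by (simp add: \<rho>_def)
  qed
  have "(\<integral>\<^sup>+x. ennreal (\<bar>f x\<bar> * ?d x powr (- s - 1)) \<partial>lborel) \<le>
     ennreal C5 * (\<integral>\<^sup>+x. ennreal (h x * ?d x powr (- s)) \<partial>lborel)" if fh': "test_pair G f h" for f h
  proof -
    obtain K where K: "compact K" "K \<subseteq> G" "\<And>x. x \<notin> K \<Longrightarrow> f x = 0" "\<And>x. x \<notin> K \<Longrightarrow> h x = 0"
      and fh: "upper_gradient f h"
      by (rule test_pairE[OF fh']) (rule that; assumption)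
    note [measurable] = upper_gradient_measurable[OF fh]
    have h0: "h x \<ge> 0" for x using fh by (auto simp: upper_gradient_def)
    have pt: "ennreal (\<bar>f x\<bar> * ?d x powr (- s - 1)) \<le> (\<integral>\<^sup>+y. k x y * ennreal (h y) \<partial>lborel)" for x
    proof (cases "x \<in> G")
      case False
      then have "f x = 0" using K by auto
      then show ?thesis by simp
    next
      case True
      define d where "d = ?d x"
      have d: "d > 0" using infdist_pos_of_open[OF G True] by (simp add: d_def E_def)
      obtain w where w: "w \<in> E" "d = dist x w" using infdist_attains_inf[OF E] unfolding d_def by metis
      let ?B = "ball w (2 * d)"
      have xB: "x \<in> ?B" using w d by (simp add: dist_commute)
      have near: "norm (x - y) < 3 * d" if "y \<in> ?B" for y
        using dist_triangle[of x y w] that w by (simp add: dist_norm[symmetric])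
      have "ennreal (\<omega> * (2 * d) powr n) * ennreal \<bar>f x\<bar> \<le>
        (\<integral>\<^sup>+z. ennreal \<bar>f z\<bar> * indicator ?B z \<partial>lborel) +
        ennreal ((2 * (2 * d)) powr n / n) *
        (\<integral>\<^sup>+y. ennreal (h y * norm (x - y) powr (1 - n)) * indicator ?B y \<partial>lborel)"
        unfolding \<omega>_def n_def by (rule value_le_ball_integral[OF fh xB])
      also have "\<dots> \<le> ennreal (C * (2 * d) powr (1 + \<sigma>)) *
          (\<integral>\<^sup>+y. ennreal (h y * infdist y E powr (- \<sigma>)) * indicator ?B y \<partial>lborel) +
        ennreal ((2 * (2 * d)) powr n / n) *
        (\<integral>\<^sup>+y. ennreal (h y * norm (x - y) powr (1 - n)) * indicator ?B y \<partial>lborel)"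
        using d by (intro add_right_mono bdry[OF fh' w(1)]) auto
      finally have "ennreal (d powr (- s - 1) / (\<omega> * (2 * d) powr n)) * (ennreal (\<omega> * (2 * d) powr n) * ennreal \<bar>f x\<bar>) \<le>
        ennreal (d powr (- s - 1) / (\<omega> * (2 * d) powr n)) * (ennreal (C * (2 * d) powr (1 + \<sigma>)) *
          (\<integral>\<^sup>+y. ennreal (h y * infdist y E powr (- \<sigma>)) * indicator ?B y \<partial>lborel) +
        ennreal ((2 * (2 * d)) powr n / n) *
        (\<integral>\<^sup>+y. ennreal (h y * norm (x - y) powr (1 - n)) * indicator ?B y \<partial>lborel))"
        by (intro mult_left_mono) auto
      also have "ennreal (d powr (- s - 1) / (\<omega> * (2 * d) powr n)) * (ennreal (\<omega> * (2 * d) powr n) * ennreal \<bar>f x\<bar>)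
        = ennreal (\<bar>f x\<bar> * ?d x powr (- s - 1))"
        using d \<omega> unfolding d_def[symmetric] by (simp add: ennreal_mult[symmetric] mult.commute)
      also have "ennreal (d powr (- s - 1) / (\<omega> * (2 * d) powr n)) * (ennreal (C * (2 * d) powr (1 + \<sigma>)) *
          (\<integral>\<^sup>+y. ennreal (h y * infdist y E powr (- \<sigma>)) * indicator ?B y \<partial>lborel) +
        ennreal ((2 * (2 * d)) powr n / n) *
        (\<integral>\<^sup>+y. ennreal (h y * norm (x - y) powr (1 - n)) * indicator ?B y \<partial>lborel)) =
        ennreal (C3 * d powr (- n - \<eta>)) * (\<integral>\<^sup>+y. ennreal (h y * infdist y E powr (- \<sigma>)) * indicator ?B y \<partial>lborel) +
        ennreal (C4 * d powr (- s - 1)) * (\<integral>\<^sup>+y. ennreal (h y * norm (x - y) powr (1 - n)) * indicator ?B y \<partial>lborel)"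
      proof -
        have "d powr (- s - 1) / (\<omega> * (2 * d) powr n) * (C * (2 * d) powr (1 + \<sigma>)) = C3 * d powr (- n - \<eta>)"
        proof -
          have "d powr (- n - \<eta>) = d powr (- s - 1) * d powr (1 + \<sigma>) / d powr n"
            using d by (simp add: powr_add[symmetric] powr_diff[symmetric] \<eta>_def algebra_simps)
          moreover have "2 powr (1 + \<sigma> - n) = 2 powr (1 + \<sigma>) / 2 powr n" by (simp add: powr_diff)
          ultimately show ?thesis using d by (simp add: C3_def powr_mult mult_ac)
        qed
        moreover have "d powr (- s - 1) / (\<omega> * (2 * d) powr n) * ((2 * (2 * d)) powr n / n) = C4 * d powr (- s - 1)"
        proof -
          have "(2 * (2 * d)) powr n = 2 powr n * (2 * d) powr n" by (rule powr_mult)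
          then show ?thesis using d \<omega> n by (simp only: C4_def) (simp add: mult_ac)
        qed
        ultimately have
          "ennreal (d powr (- s - 1) / (\<omega> * (2 * d) powr n)) * ennreal (C * (2 * d) powr (1 + \<sigma>)) = ennreal (C3 * d powr (- n - \<eta>))"
          "ennreal (d powr (- s - 1) / (\<omega> * (2 * d) powr n)) * ennreal ((2 * (2 * d)) powr n / n) = ennreal (C4 * d powr (- s - 1))"
          using d \<omega> n \<open>C \<ge> 0\<close> by (auto simp: ennreal_mult[symmetric])
        then show ?thesis by (simp only: distrib_left mult.assoc[symmetric])
      qed
      also have "\<dots> = (\<integral>\<^sup>+y. ennreal (C3 * d powr (- n - \<eta>)) * (ennreal (h y * infdist y E powr (- \<sigma>)) * indicator ?B y) +
        ennreal (C4 * d powr (- s - 1)) * (ennreal (h y * norm (x - y) powr (1 - n)) * indicator ?B y) \<partial>lborel)"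
        by (simp add: nn_integral_add nn_integral_cmult)
      also have "\<dots> \<le> (\<integral>\<^sup>+y. k x y * ennreal (h y) \<partial>lborel)"
      proof (intro nn_integral_mono)
        fix y
        show "ennreal (C3 * d powr (- n - \<eta>)) * (ennreal (h y * infdist y E powr (- \<sigma>)) * indicator ?B y) +
          ennreal (C4 * d powr (- s - 1)) * (ennreal (h y * norm (x - y) powr (1 - n)) * indicator ?B y) \<le> k x y * ennreal (h y)"
        proof (cases "y \<in> ?B")
          case True
          have "ennreal (C3 * d powr (- n - \<eta>)) * ennreal (h y * infdist y E powr (- \<sigma>)) +
             ennreal (C4 * d powr (- s - 1)) * ennreal (h y * norm (x - y) powr (1 - n)) =
             ennreal (C3 * d powr (- n - \<eta>) * (h y * infdist y E powr (- \<sigma>)) + C4 * d powr (- s - 1) * (h y * norm (x - y) powr (1 - n)))"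
            using C34 h0 by (simp add: ennreal_mult)
          also have "\<dots> = k x y * ennreal (h y)"
            unfolding k_def using near[OF True] C34 h0 
            by (simp add: d_def[symmetric] ennreal_mult[symmetric] algebra_simps del: ennreal_plus)
          finally show ?thesis using True by simp
        qed simp
      qed
      finally show ?thesis .
    qed
    have "(\<integral>\<^sup>+x. ennreal (\<bar>f x\<bar> * ?d x powr (- s - 1)) \<partial>lborel) \<le>
      (\<integral>\<^sup>+x. (\<integral>\<^sup>+y. k x y * ennreal (h y) \<partial>lborel) \<partial>lborel)"
      by (intro nn_integral_mono pt)
    also have "\<dots> = (\<integral>\<^sup>+y. (\<integral>\<^sup>+x. k x y * ennreal (h y) \<partial>lborel) \<partial>lborel)"
      by (rule lborel_pair.Fubini') measurable
    also have "\<dots> = (\<integral>\<^sup>+y. (\<integral>\<^sup>+x. k x y \<partial>lborel) * ennreal (h y) \<partial>lborel)"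
      by (intro nn_integral_cong nn_integral_multc) measurable
    also have "\<dots> \<le> (\<integral>\<^sup>+y. ennreal C5 * ennreal (h y * ?d y powr (- s)) \<partial>lborel)"
    proof (intro nn_integral_mono)
      fix y
      show "(\<integral>\<^sup>+x. k x y \<partial>lborel) * ennreal (h y) \<le> ennreal C5 * ennreal (h y * ?d y powr (- s))"
      proof (cases "y \<in> G")
        case True
        have "(\<integral>\<^sup>+x. k x y \<partial>lborel) * ennreal (h y) \<le> ennreal (C5 * ?d y powr (- s)) * ennreal (h y)"
          by (intro mult_right_mono ky True) auto
        then show ?thesis using C5 h0 by (simp add: ennreal_mult[symmetric] mult_ac)
      next
        case False
        then have "h y = 0" using K by auto
        then show ?thesis by simp
      qed
    qed
    also have "\<dots> = ennreal C5 * (\<integral>\<^sup>+x. ennreal (h x * ?d x powr (- s)) \<partial>lborel)"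
      by (rule nn_integral_cmult) measurable
    finally show ?thesis .
  qed
  then show ?thesis unfolding Hardy_L1_def E_def[symmetric] using C5 by blast
qed

lemma Hardy_L1_of_thin_complement:
  fixes G :: "'a::euclidean_space set"
  assumes n: "DIM('a) \<ge> 2" and G: "open G" "- G \<noteq> {}" and s: "s > 0"
    and dim: "upper_Assouad_dim (- G) < ereal (real DIM('a) - 1 - s)"
  shows "Hardy_L1 s G"
proof -
  obtain l C where l: "0 \<le> l" "l < real DIM('a) - 1 - s" "0 \<le> C"
    and cov: "\<forall>w\<in>- G. \<forall>r R. 0 < r \<and> r < R \<longrightarrow>
    (\<exists>F. finite F \<and> real (card F) \<le> C * (R / r) powr l \<and> - G \<inter> ball w R \<subseteq> (\<Union>x\<in>F. ball x r))"
    using covers_of_upper_Assouad_dim[OF G(2) dim] by blast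
  have "\<exists>C'\<ge>0. \<forall>y t. t > 0 \<and> infdist y (- G) \<le> 2 * t \<longrightarrow>
      (\<integral>\<^sup>+x. ennreal (infdist x (- G) powr (- s - 1)) * indicator (cball y t) x \<partial>lborel)
        \<le> ennreal (C' * t powr (real DIM('a) - s - 1))"
    using G l s cov by (intro distance_integral_of_covers[of _ s l C]) (auto simp: closed_Compl)
  then obtain C' where C': "C' \<ge> 0" "\<And>y t. t > 0 \<Longrightarrow> infdist y (- G) \<le> 2 * t \<Longrightarrow>
      (\<integral>\<^sup>+x. ennreal (infdist x (- G) powr (- s - 1)) * indicator (cball y t) x \<partial>lborel)
        \<le> ennreal (C' * t powr (real DIM('a) - s - 1))"
    by blast
  show ?thesis
    using n by (intro Hardy_L1_of_distance_integrals[OF _ G s C']) auto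
qed

lemma Hardy_L1_of_fat_complement:
  fixes G :: "'a::euclidean_space set"
  assumes n: "DIM('a) \<ge> 2" and G: "open G" "\<not> bounded (- G)" and s: "s > 0"
    and dim: "lower_Assouad_dim (- G) > ereal (real DIM('a) - 1 - s)"
  shows "Hardy_L1 s G"
proof -
  have ne: "- G \<noteq> {}" using G(2) by auto
  obtain \<tau> where \<tau>: "real DIM('a) - 1 - s < \<tau>" "ereal \<tau> < lower_Assouad_dim (- G)"
    using ereal_dense2[OF dim] by auto
  \<comment> \<open>Any \<open>\<sigma> \<in> (0, s)\<close> with \<open>n - 1 - \<sigma> \<le> \<tau>\<close> would do; \<open>s / 2\<close> keeps it positive.\<close>
  define \<sigma> where "\<sigma> = max (s / 2) (real DIM('a) - 1 - \<tau>)"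
  have \<sigma>: "0 < \<sigma>" "\<sigma> < s" "real DIM('a) - 1 - \<sigma> \<le> \<tau>" using \<tau> s by (auto simp: \<sigma>_def max_def)
  then have "ereal (real DIM('a) - 1 - \<sigma>) \<le> ereal \<tau>" by (simp only: ereal_less_eq)
  then have "ereal (real DIM('a) - 1 - \<sigma>) < lower_Assouad_dim (- G)"
    using \<tau>(2) by (rule le_less_trans)
  from branching_of_lower_Assouad_dim[OF G(2) this] obtain \<kappa> where \<kappa>: "0 < \<kappa>" "\<kappa> < 1"
    and br: "\<And>w R. w \<in> - G \<Longrightarrow> R > 0 \<Longrightarrow> \<exists>F. finite F \<and> F \<subseteq> - G \<and>
      real (card F) \<ge> 2 * \<kappa> powr (- (real DIM('a) - 1 - \<sigma>)) \<and>
      (\<forall>v\<in>F. ball v (\<kappa> * R) \<subseteq> ball w R) \<and> disjoint_family_on (\<lambda>v. ball v (\<kappa> * R)) F"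
    by metis
  show ?thesis
    using n \<sigma> \<kappa>
    by (intro Hardy_L1_of_boundary_ball_integrals[OF _ G(1) ne \<sigma>(1,2) _
          boundary_ball_integral_le[OF _ G(1) ne \<sigma>(1) \<kappa> br]]) auto
qed


section \<open>The L1 Sobolev inequality\<close>

lemma upper_gradient_compose:
  fixes f h :: "'a::euclidean_space \<Rightarrow> real"
  assumes fh: "upper_gradient f h"
    and \<phi>: "\<And>x. (\<phi> has_real_derivative \<phi>' (f x)) (at (f x))"
    and cont: "continuous_on UNIV (\<lambda>x. \<phi>' (f x))"
  shows "upper_gradient (\<lambda>x. \<phi> (f x)) (\<lambda>x. \<bar>\<phi>' (f x)\<bar> * h x)"
  unfolding upper_gradient_def
proof (intro conjI allI)
  show "continuous_on UNIV (\<lambda>x. \<bar>\<phi>' (f x)\<bar> * h x)"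
    by (intro continuous_intros cont upper_gradient_continuous(2)[OF fh])
  fix x
  show "0 \<le> \<bar>\<phi>' (f x)\<bar> * h x" "lip_bound (\<lambda>x. \<phi> (f x)) (\<bar>\<phi>' (f x)\<bar> * h x) x"
    using fh \<phi>[of x] by (auto simp: upper_gradient_def intro: lip_bound_compose)
qed

lemma test_pair_integrable:
  assumes "test_pair G f h"
  shows "integrable lborel h"
  by (rule test_pairE[OF assms])
    (rule integrable_continuous_compact_support[OF upper_gradient_continuous(2)])

lemma test_pair_superlevel_set:
  assumes "test_pair G f h" "0 < t"
  shows "{x. t \<le> f x} \<in> sets borel" "emeasure lborel {x. t \<le> f x} < \<infinity>"
proof -
  obtain K where K: "compact K" "K \<subseteq> G" "\<And>x. x \<notin> K \<Longrightarrow> f x = 0" "\<And>x. x \<notin> K \<Longrightarrow> h x = 0"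
    and fh: "upper_gradient f h"
    by (rule test_pairE[OF assms(1)]) (rule that; assumption)
  note [measurable] = upper_gradient_measurable[OF fh]
  show "{x. t \<le> f x} \<in> sets borel" by measurable
  have "x \<in> K" if "t \<le> f x" for x
    using K(3)[of x] that assms(2) by (cases "x \<in> K") auto
  then have "{x. t \<le> f x} \<subseteq> K" by auto
  then have "bounded {x. t \<le> f x}" using K(1) by (meson bounded_subset compact_imp_bounded)
  then show "emeasure lborel {x. t \<le> f x} < \<infinity>" by (rule emeasure_bounded_finite)
qed

text \<open>Integrate the potential estimate over the superlevel set \<open>S\<close>, on which \<open>f \<ge> t\<close>: the kernel integrates
over \<open>S\<close> to at most a multiple of \<open>|S|\<^sup>1\<^sup>/\<^sup>n\<close>.\<close>

lemma weak_Sobolev_L1: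
  fixes f h :: "'a::euclidean_space \<Rightarrow> real"
  defines "n \<equiv> real DIM('a)"
  defines "A \<equiv> 2 powr n * unit_ball_vol n powr (- (1 / n))"
  assumes n: "n > 1" and fh: "test_pair G f h" and t: "0 < t"
  shows "t powr (n / (n - 1)) * measure lborel {x. t \<le> f x} \<le> (A * (LINT x|lborel. h x)) powr (n / (n - 1))"
proof -
  define S where "S = {x. t \<le> f x}"
  define V where "V = measure lborel S"
  define H where "H = (LINT x|lborel. h x)"
  define \<omega> where "\<omega> = unit_ball_vol n"
  have \<omega>: "\<omega> > 0" by (simp add: n_def \<omega>_def)
  obtain K where K: "compact K" "K \<subseteq> G" "\<And>x. x \<notin> K \<Longrightarrow> f x = 0" "\<And>x. x \<notin> K \<Longrightarrow> h x = 0"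
    and ug: "upper_gradient f h"
    by (rule test_pairE[OF fh]) (rule that; assumption)
  note [measurable] = upper_gradient_measurable[OF ug]
  have h0: "h x \<ge> 0" for x using ug by (auto simp: upper_gradient_def)
  have S [measurable]: "S \<in> sets borel" and V: "emeasure lborel S = ennreal V"
    using test_pair_superlevel_set[OF fh t] by (auto simp: S_def V_def emeasure_eq_ennreal_measure)
  have H: "(\<integral>\<^sup>+x. ennreal (h x) \<partial>lborel) = ennreal H" "H \<ge> 0"
    unfolding H_def using h0 test_pair_integrable[OF fh]
    by (auto intro!: nn_integral_eq_integral integral_nonneg_AE)
  show ?thesis
  proof (cases "V = 0")
    case True
    then show ?thesis by (simp add: V_def S_def)
  next
    case False
    then have V0: "V > 0" by (simp add: V_def less_le)
    \<comment> \<open>The radius of the ball of the same measure as \<open>S\<close>.\<close>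
    define \<rho> where "\<rho> = (V / \<omega>) powr (1 / n)"
    have \<rho>: "\<rho> > 0" "\<omega> * \<rho> powr n = V" using V0 \<omega> n by (auto simp: \<rho>_def powr_powr)
    define c where "c = 2 powr n / n / \<omega>"
    have c: "c \<ge> 0" using \<omega> n by (simp add: c_def)
    have "ennreal (t * V) = (\<integral>\<^sup>+x. ennreal t * indicator S x \<partial>lborel)"
      using t by (simp add: nn_integral_cmult V ennreal_mult V_def)
    also have "\<dots> \<le> (\<integral>\<^sup>+x. indicator S x * (ennreal c * (\<integral>\<^sup>+y. ennreal (h y * norm (x - y) powr (1 - n)) \<partial>lborel)) \<partial>lborel)"
    proof (intro nn_integral_mono)
      fix x
      have "ennreal t \<le> ennreal \<bar>f x\<bar>" if "x \<in> S" using that t by (intro ennreal_leI) (auto simp: S_def)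
      also have "ennreal \<bar>f x\<bar> \<le> ennreal c * (\<integral>\<^sup>+y. ennreal (h y * norm (x - y) powr (1 - n)) \<partial>lborel)"
        unfolding c_def \<omega>_def n_def by (rule value_le_Riesz_potential[OF ug K(1,3)])
      finally show "ennreal t * indicator S x \<le> indicator S x * (ennreal c * (\<integral>\<^sup>+y. ennreal (h y * norm (x - y) powr (1 - n)) \<partial>lborel))"
        by (auto simp: indicator_def)
    qed
    also have "\<dots> = (\<integral>\<^sup>+x. (\<integral>\<^sup>+y. ennreal c * (indicator S x * ennreal (h y * norm (x - y) powr (1 - n))) \<partial>lborel) \<partial>lborel)"
      by (intro nn_integral_cong) (simp add: nn_integral_cmult mult_ac)
    also have "\<dots> = (\<integral>\<^sup>+y. (\<integral>\<^sup>+x. ennreal c * (indicator S x * ennreal (h y * norm (x - y) powr (1 - n))) \<partial>lborel) \<partial>lborel)"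
      by (rule lborel_pair.Fubini') measurable
    also have "\<dots> = (\<integral>\<^sup>+y. ennreal c * (ennreal (h y) * (\<integral>\<^sup>+x. indicator S x * ennreal (norm (x - y) powr (1 - n)) \<partial>lborel)) \<partial>lborel)"
      using h0 by (intro nn_integral_cong) (simp add: nn_integral_cmult[symmetric] ennreal_mult mult_ac)
    also have "\<dots> \<le> (\<integral>\<^sup>+y. ennreal c * (ennreal (h y) * ennreal (n * \<omega> * \<rho>)) \<partial>lborel)"
      unfolding n_def \<omega>_def using n \<rho> V
      by (intro nn_integral_mono mult_left_mono kernel_integral_over_set_le) (auto simp: n_def \<omega>_def)
    also have "\<dots> = ennreal c * (ennreal H * ennreal (n * \<omega> * \<rho>))"
      by (simp add: nn_integral_cmult nn_integral_multc H(1))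
    also have "\<dots> = ennreal (2 powr n * \<rho> * H)"
    proof -
      have "c * (H * (n * \<omega> * \<rho>)) = 2 powr n * \<rho> * H" using n \<omega> by (simp add: c_def)
      then show ?thesis using c H(2) n \<omega> \<rho> by (simp add: ennreal_mult[symmetric])
    qed
    finally have le: "t * V \<le> 2 powr n * \<rho> * H"
      using \<rho> H(2) by simp
    have \<rho>V: "\<rho> = V powr (1 / n) * \<omega> powr (- (1 / n))"
    proof -
      have "\<rho> = V powr (1 / n) / \<omega> powr (1 / n)"
        unfolding \<rho>_def using V0 \<omega> by (intro powr_divide)
      then show ?thesis by (simp add: powr_minus divide_inverse)
    qed
    have "t * V powr ((n - 1) / n) = t * V * V powr (- (1 / n))"
    proof -
      have "V powr ((n - 1) / n) = V powr (1 + (- (1 / n)))" using n by (simp add: diff_divide_distrib)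
      then show ?thesis using V0 by (simp only: powr_add) simp
    qed
    also have "\<dots> \<le> 2 powr n * \<rho> * H * V powr (- (1 / n))"
      by (intro mult_right_mono le) auto
    also have "\<dots> = A * H * (V powr (1 / n) * V powr (- (1 / n)))"
      by (simp add: \<rho>V A_def \<omega>_def)
    also have "V powr (1 / n) * V powr (- (1 / n)) = 1" using V0 by (simp add: powr_minus)
    finally have "(t * V powr ((n - 1) / n)) powr (n / (n - 1)) \<le> (A * H) powr (n / (n - 1))"
      using t n by (intro powr_mono2) auto
    also have "(t * V powr ((n - 1) / n)) powr (n / (n - 1)) = t powr (n / (n - 1)) * V"
      using n V0 t by (simp add: powr_mult powr_powr)
    finally show ?thesis by (simp add: H_def V_def S_def)
  qed
qed

lemma powr_le_layer_integral:
  assumes "u \<ge> 0" "q \<ge> 1"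
  shows "ennreal (u powr q) \<le>
    ennreal (2 powr q) * (\<integral>\<^sup>+t. ennreal (t powr (q - 1)) * indicator {0<..u} t \<partial>lborel)"
proof (cases "u = 0")
  case False
  then have u: "u > 0" using assms by simp
  have "u powr q = 2 powr q * ((u / 2) powr (q - 1) * (u / 2))"
    using u by (simp add: powr_divide powr_diff)
  then have "ennreal (u powr q) = ennreal (2 powr q) * (\<integral>\<^sup>+t. ennreal ((u / 2) powr (q - 1)) * indicator {u / 2..u} t \<partial>lborel)"
    using u by (simp add: nn_integral_cmult ennreal_mult[symmetric])
  also have "\<dots> \<le> ennreal (2 powr q) * (\<integral>\<^sup>+t. ennreal (t powr (q - 1)) * indicator {0<..u} t \<partial>lborel)"
    using u assms by (intro mult_left_mono nn_integral_mono) (auto simp: indicator_def intro!: ennreal_leI powr_mono2)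
  finally show ?thesis .
qed auto

lemma truncation_derivative:
  fixes a v :: real
  assumes "a + v > 0"
  shows "((\<lambda>v. (1 - a / (a + v))\<^sup>2) has_real_derivative 2 * a * v / (a + v) ^ 3) (at v)"
proof -
  have "((\<lambda>v. (1 - a / (a + v))\<^sup>2) has_real_derivative 2 * (1 - a / (a + v)) * (a / (a + v)\<^sup>2)) (at v)"
    using assms by (auto intro!: derivative_eq_intros simp: power2_eq_square)
  also have "1 - a / (a + v) = v / (a + v)" using assms by (simp add: field_simps)
  finally show ?thesis by (simp add: power2_eq_square power3_eq_cube mult_ac)
qed

text \<open>The truncations of \<open>Sobolev_L1\<close> have slope \<open>2 t\<^sup>2 u / (t + u)\<^sup>3\<close>; integrated against \<open>dt / t\<close> the slopes
at a given value \<open>u\<close> add up to at most 1, as if the truncation at each height only saw its own layer.\<close>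

lemma truncation_slopes_integral_le:
  assumes "u \<ge> 0"
  shows "(\<integral>\<^sup>+t. ennreal (2 * t * u / (t + u) ^ 3) * indicator {0<..} t \<partial>lborel) \<le> 1"
proof (cases "u = 0")
  case False
  then have u: "u > 0" using assms by simp
  have "(\<integral>\<^sup>+t. ennreal (2 * t * u / (t + u) ^ 3) * indicator {0<..} t \<partial>lborel) \<le>
     (\<integral>\<^sup>+t. ennreal (2 * t * u / (t + u) ^ 3) * indicator {0..} t \<partial>lborel)"
    by (intro nn_integral_mono) (auto simp: indicator_def)
  also have "\<dots> = ennreal (1 - (1 - u / (u + 0))\<^sup>2)"
  proof (rule nn_integral_FTC_atLeast)
    fix t :: real assume "0 \<le> t"
    then have "u + t > 0" using u by simp
    from truncation_derivative[OF this]
    show "((\<lambda>t. (1 - u / (u + t))\<^sup>2) has_real_derivative 2 * t * u / (t + u) ^ 3) (at t)"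
      by (simp add: mult_ac add.commute)
  next
    have "((\<lambda>t. u / (u + t)) \<longlongrightarrow> 0) at_top"
      by (intro tendsto_divide_0[OF tendsto_const] filterlim_at_top_imp_at_infinity
          filterlim_at_top_mono[OF filterlim_ident]) (use u in \<open>auto intro!: always_eventually\<close>)
    then have "((\<lambda>t. (1 - u / (u + t))\<^sup>2) \<longlongrightarrow> (1 - 0)\<^sup>2) at_top"
      by (intro tendsto_intros)
    then show "((\<lambda>t. (1 - u / (u + t))\<^sup>2) \<longlongrightarrow> 1) at_top" by simp
  qed (use u in auto)
  finally show ?thesis using u by simp
qed simp

text \<open>From weak to strong type by truncation. The weak estimate is applied to the smooth truncations
\<open>T\<^sub>t f = t f\<^sup>2 / (t + f)\<^sup>2\<close>, which are at least \<open>t/4\<close> where \<open>f \<ge> t\<close> and whose gradients are small except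
near the level \<open>t\<close>. One factor of the power \<open>q = n/(n-1)\<close> keeps this localized gradient while the others
are estimated by the full integral; integrating over all levels \<open>t\<close> then counts every point only once.\<close>

lemma Sobolev_L1:
  fixes f h :: "'a::euclidean_space \<Rightarrow> real"
  defines "n \<equiv> real DIM('a)"
  defines "A \<equiv> 2 powr n * unit_ball_vol n powr (- (1 / n))"
  assumes n: "n > 1" and fh: "test_pair G f h" and f0: "\<And>x. 0 \<le> f x"
  shows "(\<integral>\<^sup>+x. ennreal (f x powr (n / (n - 1))) \<partial>lborel) \<le>
    ennreal ((8 * A * (LINT x|lborel. h x)) powr (n / (n - 1)))"
proof -
  define q where "q = n / (n - 1)"
  have q: "q > 1" using n by (simp add: q_def field_simps)
  obtain K where K: "compact K" "K \<subseteq> G" "\<And>x. x \<notin> K \<Longrightarrow> f x = 0" "\<And>x. x \<notin> K \<Longrightarrow> h x = 0"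
    and ug: "upper_gradient f h"
    by (rule test_pairE[OF fh]) (rule that; assumption)
  note [measurable] = upper_gradient_measurable[OF ug]
  have h0: "h x \<ge> 0" for x using ug by (auto simp: upper_gradient_def)
  define H where "H = (LINT x|lborel. h x)"
  have H: "(\<integral>\<^sup>+x. ennreal (h x) \<partial>lborel) = ennreal H" "H \<ge> 0"
    unfolding H_def using h0 test_pair_integrable[OF fh]
    by (auto intro!: nn_integral_eq_integral integral_nonneg_AE)
  have "unit_ball_vol n > 0" by (simp add: n_def)
  then have A: "A > 0" unfolding A_def by (intro mult_pos_pos) (simp_all add: less_le)
  define B where "B = (4 * A) powr q * H powr (q - 1)"
  have B: "B \<ge> 0" by (simp add: B_def)
  define s where "s t u = 2 * t * u / (t + u) ^ 3" for t u :: real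
  have [measurable]: "case_prod s \<in> borel_measurable (lborel \<Otimes>\<^sub>M lborel)"
    unfolding s_def by measurable
  have s0: "s t u \<ge> 0" if "t > 0" "u \<ge> 0" for t u using that by (simp add: s_def)
  have level: "ennreal (t powr (q - 1)) * emeasure lborel {x. t \<le> f x} \<le>
      ennreal B * (\<integral>\<^sup>+x. ennreal (s t (f x) * h x) \<partial>lborel)" if t: "t > 0" for t
  proof -
    \<comment> \<open>This is \<open>t u\<^sup>2 / (t + u)\<^sup>2\<close>, in the form that is easiest to differentiate.\<close>
    define T where "T u = t * (1 - t / (t + u))\<^sup>2" for u
    define T' where "T' u = t * s t u" for u
    define g where "g x = T (f x)" for x
    define k where "k x = \<bar>T' (f x)\<bar> * h x" for x
    have pos: "t + f x > 0" for x using t f0[of x] by simp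
    have "upper_gradient g k"
      unfolding g_def k_def
    proof (rule upper_gradient_compose[OF ug])
      show "(T has_real_derivative T' (f x)) (at (f x))" for x
        unfolding T_def T'_def s_def by (intro DERIV_cmult truncation_derivative pos)
      have "(t + f x) ^ 3 \<noteq> 0" for x using pos[of x] by simp
      then show "continuous_on UNIV (\<lambda>x. T' (f x))"
        unfolding T'_def s_def by (intro continuous_intros upper_gradient_continuous(1)[OF ug]) auto
    qed
    moreover have "g x = 0 \<and> k x = 0" if "x \<notin> K" for x
      using K(3,4)[OF that] t by (simp add: g_def k_def T_def)
    ultimately have gk: "test_pair G g k" using K(1,2) unfolding test_pair_def by blast
    have k: "k x = t * (s t (f x) * h x)" "0 \<le> k x" "k x \<le> h x" for x
    proof -
      show 1: "k x = t * (s t (f x) * h x)" using s0[OF t f0[of x]] t by (simp add: k_def T'_def)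
      show "0 \<le> k x" using s0[OF t f0[of x]] t h0[of x] by (simp add: k_def)
      have "2 * t * t * f x \<le> (t + f x) ^ 3"
        using t f0[of x] by (simp add: power3_eq_cube algebra_simps)
      then have "t * s t (f x) \<le> 1" using pos[of x] by (simp add: s_def field_simps)
      then have "(t * s t (f x)) * h x \<le> 1 * h x" by (rule mult_right_mono[OF _ h0])
      then show "k x \<le> h x" by (simp add: 1)
    qed
    define M where "M = (LINT x|lborel. k x)"
    have ki: "integrable lborel k" by (rule test_pair_integrable[OF gk])
    have M: "(\<integral>\<^sup>+x. ennreal (k x) \<partial>lborel) = ennreal M" "0 \<le> M" "M \<le> H"
      unfolding M_def H_def using k(2,3) ki test_pair_integrable[OF fh]
      by (auto intro!: nn_integral_eq_integral integral_nonneg_AE integral_mono)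
    have sub: "{x. t \<le> f x} \<subseteq> {x. t / 4 \<le> g x}"
    proof safe
      fix x assume "t \<le> f x"
      then have "1 / 2 \<le> 1 - t / (t + f x)" using pos[of x] by (simp add: field_simps)
      then have "(1 / 2)\<^sup>2 \<le> (1 - t / (t + f x))\<^sup>2" by (intro power_mono) auto
      then have "t * (1 / 4) \<le> t * (1 - t / (t + f x))\<^sup>2"
        using t by (intro mult_left_mono) (auto simp: power2_eq_square)
      then show "t / 4 \<le> g x" by (simp add: g_def T_def)
    qed
    have fin: "emeasure lborel {x. t \<le> f x} \<noteq> \<infinity>" "emeasure lborel {x. t / 4 \<le> g x} \<noteq> \<infinity>"
      using test_pair_superlevel_set[OF fh t] test_pair_superlevel_set[OF gk, of "t / 4"] t by auto
    define V where "V = measure lborel {x. t \<le> f x}"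
    have "V \<le> measure lborel {x. t / 4 \<le> g x}"
      unfolding V_def using test_pair_superlevel_set[OF gk, of "t / 4"] t sub test_pair_superlevel_set[OF fh t]
      by (intro measure_mono_fmeasurable) (auto simp: fmeasurable_def)
    then have "(t / 4) powr q * V \<le> (t / 4) powr q * measure lborel {x. t / 4 \<le> g x}"
      by (intro mult_left_mono) auto
    also have "\<dots> \<le> (A * M) powr q"
      unfolding q_def M_def A_def n_def by (rule weak_Sobolev_L1[OF _ gk]) (use n t in \<open>auto simp: n_def\<close>)
    also have "\<dots> = A powr q * (M powr (q - 1) * M)"
      using M(2) A by (cases "M = 0") (auto simp: powr_mult powr_diff)
    also have "\<dots> \<le> A powr q * (H powr (q - 1) * M)"
      using M q by (intro mult_left_mono mult_right_mono powr_mono2) auto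
    finally have "4 powr q * ((t / 4) powr q * V) \<le> 4 powr q * (A powr q * (H powr (q - 1) * M))"
      by (intro mult_left_mono) auto
    then have "t powr q * V \<le> B * M"
      using t A by (simp add: powr_divide powr_mult B_def mult_ac)
    then have "t powr q * V / t \<le> B * M / t" using t by (intro divide_right_mono) auto
    then have "t powr (q - 1) * V \<le> B * (M / t)" using t by (simp add: powr_diff)
    then have "ennreal (t powr (q - 1)) * ennreal V \<le> ennreal B * ennreal (M / t)"
      using B M t by (simp add: ennreal_mult[symmetric] V_def ennreal_leI)
    also have "ennreal V = emeasure lborel {x. t \<le> f x}"
      using fin by (simp add: V_def emeasure_eq_ennreal_measure)
    also have "ennreal (M / t) = (\<integral>\<^sup>+x. ennreal (s t (f x) * h x) \<partial>lborel)"
    proof -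
      have "ennreal (M / t) = ennreal (1 / t) * (\<integral>\<^sup>+x. ennreal (k x) \<partial>lborel)"
        using M t by (simp add: ennreal_mult[symmetric])
      also have "\<dots> = (\<integral>\<^sup>+x. ennreal (1 / t) * ennreal (k x) \<partial>lborel)"
        using ki by (intro nn_integral_cmult[symmetric]) auto
      also have "\<dots> = (\<integral>\<^sup>+x. ennreal (s t (f x) * h x) \<partial>lborel)"
        using t k(2) by (intro nn_integral_cong) (simp add: ennreal_mult[symmetric] k(1))
      finally show ?thesis .
    qed
    finally show ?thesis .
  qed
  have "(\<integral>\<^sup>+x. ennreal (f x powr q) \<partial>lborel) \<le>
    (\<integral>\<^sup>+x. ennreal (2 powr q) * (\<integral>\<^sup>+t. ennreal (t powr (q - 1)) * indicator {0<..f x} t \<partial>lborel) \<partial>lborel)"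
    using q f0 by (intro nn_integral_mono powr_le_layer_integral) auto
  also have "\<dots> = ennreal (2 powr q) * (\<integral>\<^sup>+x. (\<integral>\<^sup>+t. ennreal (t powr (q - 1)) * indicator {0<..f x} t \<partial>lborel) \<partial>lborel)"
    unfolding indicator_def greaterThanAtMost_iff by (intro nn_integral_cmult) measurable
  finally have layers: "(\<integral>\<^sup>+x. ennreal (f x powr q) \<partial>lborel) \<le>
    ennreal (2 powr q) * (\<integral>\<^sup>+x. (\<integral>\<^sup>+t. ennreal (t powr (q - 1)) * indicator {0<..f x} t \<partial>lborel) \<partial>lborel)" .
  have "(\<integral>\<^sup>+x. (\<integral>\<^sup>+t. ennreal (t powr (q - 1)) * indicator {0<..f x} t \<partial>lborel) \<partial>lborel) =
    (\<integral>\<^sup>+t. (\<integral>\<^sup>+x. ennreal (t powr (q - 1)) * indicator {0<..f x} t \<partial>lborel) \<partial>lborel)"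
    unfolding indicator_def greaterThanAtMost_iff by (rule lborel_pair.Fubini') measurable
  also have "\<dots> \<le> (\<integral>\<^sup>+t. (\<integral>\<^sup>+x. ennreal B * ((ennreal (s t (f x)) * indicator {0<..} t) * ennreal (h x)) \<partial>lborel) \<partial>lborel)"
  proof (rule nn_integral_mono)
    fix t :: real
    show "(\<integral>\<^sup>+x. ennreal (t powr (q - 1)) * indicator {0<..f x} t \<partial>lborel) \<le>
      (\<integral>\<^sup>+x. ennreal B * ((ennreal (s t (f x)) * indicator {0<..} t) * ennreal (h x)) \<partial>lborel)"
    proof (cases "t > 0")
      case True
      have "(\<integral>\<^sup>+x. ennreal (t powr (q - 1)) * indicator {0<..f x} t \<partial>lborel) =
         (\<integral>\<^sup>+x. ennreal (t powr (q - 1)) * indicator {x. t \<le> f x} x \<partial>lborel)"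
        using True by (intro nn_integral_cong) (auto simp: indicator_def)
      also have "\<dots> = ennreal (t powr (q - 1)) * emeasure lborel {x. t \<le> f x}"
        by (subst nn_integral_cmult) auto
      also note level[OF True]
      also have "ennreal B * (\<integral>\<^sup>+x. ennreal (s t (f x) * h x) \<partial>lborel) =
        (\<integral>\<^sup>+x. ennreal B * ennreal (s t (f x) * h x) \<partial>lborel)"
        unfolding s_def by (rule nn_integral_cmult[symmetric]) measurable
      also have "\<dots> = (\<integral>\<^sup>+x. ennreal B * ((ennreal (s t (f x)) * indicator {0<..} t) * ennreal (h x)) \<partial>lborel)"
        using True s0[OF True] f0 h0 by (intro nn_integral_cong) (simp add: ennreal_mult)
      finally show ?thesis .
    qed auto
  qed
  also have "\<dots> = (\<integral>\<^sup>+x. (\<integral>\<^sup>+t. ennreal B * ((ennreal (s t (f x)) * indicator {0<..} t) * ennreal (h x)) \<partial>lborel) \<partial>lborel)"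
    unfolding s_def by (rule lborel_pair.Fubini') measurable
  also have "\<dots> = (\<integral>\<^sup>+x. ennreal B * ((\<integral>\<^sup>+t. ennreal (s t (f x)) * indicator {0<..} t \<partial>lborel) * ennreal (h x)) \<partial>lborel)"
    unfolding s_def by (simp add: nn_integral_cmult nn_integral_multc)
  also have "\<dots> \<le> (\<integral>\<^sup>+x. ennreal B * (1 * ennreal (h x)) \<partial>lborel)"
    unfolding s_def by (intro nn_integral_mono mult_left_mono mult_right_mono truncation_slopes_integral_le f0) auto
  also have "\<dots> = ennreal B * ennreal H"
    by (simp add: nn_integral_cmult H)
  finally have "(\<integral>\<^sup>+x. ennreal (f x powr q) \<partial>lborel) \<le> ennreal (2 powr q) * (ennreal B * ennreal H)"
    by (intro order_trans[OF layers] mult_left_mono) auto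
  also have "\<dots> = ennreal ((8 * A * H) powr q)"
  proof -
    have "2 powr q * (B * H) = (8 * A * H) powr q"
    proof (cases "H = 0")
      case False
      then have "H powr (q - 1) * H = H powr q" using H by (simp add: powr_diff)
      moreover have "(8::real) powr q = 2 powr q * 4 powr q" using powr_mult[of 2 4 q] by simp
      ultimately show ?thesis using A H by (simp add: B_def powr_mult)
    qed simp
    then show ?thesis using B H by (simp add: ennreal_mult[symmetric])
  qed
  finally show ?thesis by (simp add: q_def H_def)
qed


section \<open>From L1 to Lp\<close>

text \<open>Hoelder's inequality with both factors written as powers of integrable functions. With \<open>0 powr 0 = 0\<close>
it includes the end points.\<close>

lemma Hoelder_interpolation:
  fixes u v :: "'a \<Rightarrow> real"
  assumes u: "integrable M u" "\<And>x. 0 \<le> u x" and v: "integrable M v" "\<And>x. 0 \<le> v x"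
    and \<theta>: "0 \<le> \<theta>" "\<theta> \<le> 1"
  shows "(LINT x|M. u x powr \<theta> * v x powr (1 - \<theta>)) \<le> (LINT x|M. u x) powr \<theta> * (LINT x|M. v x) powr (1 - \<theta>)"
proof -
  have young: "a powr \<theta> * b powr (1 - \<theta>) \<le> \<theta> * a + (1 - \<theta>) * b" if "a \<ge> 0" "b \<ge> 0" for a b :: real
    using Youngs_inequality_0[of \<theta> "1 - \<theta>" a b] that \<theta> by (cases "a = 0 \<or> b = 0") auto
  have [measurable]: "u \<in> borel_measurable M" "v \<in> borel_measurable M"
    using u v by auto
  define U V where "U = (LINT x|M. u x)" and "V = (LINT x|M. v x)"
  have UV: "U \<ge> 0" "V \<ge> 0" using u v by (auto simp: U_def V_def)
  show ?thesis
  proof (cases "U = 0 \<or> V = 0")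
    case True
    then have "(AE x in M. u x = 0) \<or> (AE x in M. v x = 0)"
      using u v by (auto simp: U_def V_def integral_nonneg_eq_0_iff_AE)
    then have "AE x in M. u x powr \<theta> * v x powr (1 - \<theta>) = 0"
    proof
      assume "AE x in M. u x = 0"
      then show ?thesis by eventually_elim simp
    next
      assume "AE x in M. v x = 0"
      then show ?thesis by eventually_elim simp
    qed
    then have "(LINT x|M. u x powr \<theta> * v x powr (1 - \<theta>)) = 0"
      by (rule integral_eq_zero_AE)
    then show ?thesis by simp
  next
    case False
    then have UV0: "U > 0" "V > 0" using UV by auto
    have "(LINT x|M. u x powr \<theta> * v x powr (1 - \<theta>)) \<le>
      (LINT x|M. U powr \<theta> * V powr (1 - \<theta>) * (\<theta> * (u x / U) + (1 - \<theta>) * (v x / V)))"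
    proof (rule integral_mono')
      show "integrable M (\<lambda>x. U powr \<theta> * V powr (1 - \<theta>) * (\<theta> * (u x / U) + (1 - \<theta>) * (v x / V)))"
        using u v by auto
      show "u x powr \<theta> * v x powr (1 - \<theta>) \<le> U powr \<theta> * V powr (1 - \<theta>) * (\<theta> * (u x / U) + (1 - \<theta>) * (v x / V))" for x
      proof -
        have "u x powr \<theta> * v x powr (1 - \<theta>) =
          U powr \<theta> * V powr (1 - \<theta>) * ((u x / U) powr \<theta> * (v x / V) powr (1 - \<theta>))"
          using UV0 u v by (simp add: powr_divide)
        also have "\<dots> \<le> U powr \<theta> * V powr (1 - \<theta>) * (\<theta> * (u x / U) + (1 - \<theta>) * (v x / V))"
          using UV0 u v by (intro mult_left_mono young) auto
        finally show ?thesis .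
      qed
      show "0 \<le> U powr \<theta> * V powr (1 - \<theta>) * (\<theta> * (u x / U) + (1 - \<theta>) * (v x / V))" for x
        using UV u v \<theta> by (intro mult_nonneg_nonneg add_nonneg_nonneg) auto
    qed
    also have "\<dots> = U powr \<theta> * V powr (1 - \<theta>) * (\<theta> * (U / U) + (1 - \<theta>) * (V / V))"
      using u v by (simp add: U_def V_def)
    finally show ?thesis using UV0 by (simp add: U_def V_def)
  qed
qed

text \<open>The weight is positive and continuous near the support of \<open>F\<close>, and the product is 0 elsewhere.\<close>

lemma weighted_integrable:
  fixes F :: "'a::euclidean_space \<Rightarrow> real"
  assumes G: "open G" "- G \<noteq> {}" and F: "continuous_on UNIV F"
    and K: "compact K" "K \<subseteq> G" "\<And>x. x \<notin> K \<Longrightarrow> F x = 0"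
  shows "continuous_on UNIV (\<lambda>x. F x * infdist x (- G) powr a)"
    and "integrable lborel (\<lambda>x. F x * infdist x (- G) powr a)"
proof -
  have "continuous_on (G \<union> - K) (\<lambda>x. F x * infdist x (- G) powr a)"
  proof (rule continuous_on_open_Un[OF G(1)])
    show "open (- K)" using K(1) by (simp add: compact_imp_closed open_Compl)
    have "infdist x (- G) \<noteq> 0" if "x \<in> G" for x
      using infdist_pos_of_open[OF G that] by simp
    then show "continuous_on G (\<lambda>x. F x * infdist x (- G) powr a)"
      by (intro continuous_intros continuous_on_subset[OF F]) auto
    show "continuous_on (- K) (\<lambda>x. F x * infdist x (- G) powr a)"
      using K(3) by (subst continuous_on_cong[OF refl, of _ _ "\<lambda>_. 0"]) auto
  qed
  also have "G \<union> - K = UNIV" using K(2) by auto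
  finally show c: "continuous_on UNIV (\<lambda>x. F x * infdist x (- G) powr a)" .
  show "integrable lborel (\<lambda>x. F x * infdist x (- G) powr a)"
    using K by (intro integrable_continuous_compact_support[OF c K(1)]) auto
qed

lemma abs_powr_derivative:
  fixes p u :: real
  assumes "p > 1" "u \<ge> 0"
  shows "((\<lambda>v. \<bar>v\<bar> powr p) has_real_derivative p * u powr (p - 1)) (at u)"
proof (cases "u = 0")
  case False
  then have u: "u > 0" using assms by simp
  have "((\<lambda>v. v powr p) has_real_derivative p * u powr (p - 1)) (at u)"
    using u by (auto intro!: derivative_eq_intros)
  moreover have "\<forall>\<^sub>F v in nhds u. \<bar>v\<bar> powr p = v powr p"
    using eventually_nhds_in_open[of "{0<..}" u] u by (auto elim: eventually_mono)
  ultimately show ?thesis by (subst DERIV_cong_ev[OF refl _ refl]) auto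
next
  case True
  have "((\<lambda>v::real. \<bar>v\<bar> powr (p - 1)) \<longlongrightarrow> \<bar>0\<bar> powr (p - 1)) (at 0)"
    using assms by (intro tendsto_powr' tendsto_intros) auto
  then have "((\<lambda>v::real. \<bar>v\<bar> powr (p - 1)) \<longlongrightarrow> 0) (at 0)" by simp
  then have "((\<lambda>v::real. \<bar>v\<bar> powr p / v) \<longlongrightarrow> 0) (at 0)"
  proof (rule Lim_null_comparison[rotated])
    show "\<forall>\<^sub>F v::real in at 0. norm (\<bar>v\<bar> powr p / v) \<le> \<bar>v\<bar> powr (p - 1)"
      by (auto simp: eventually_at_filter powr_diff)
  qed
  then show ?thesis using True assms by (simp add: has_field_derivative_iff)
qed

lemma test_pair_abs:
  assumes "test_pair G f h"
  shows "test_pair G (\<lambda>x. \<bar>f x\<bar>) h"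
proof -
  have "lip_bound (\<lambda>x. \<bar>f x\<bar>) L x" if lb: "lip_bound f L x" for L x
  proof -
    obtain r where r: "(r \<longlongrightarrow> L) (at x)" "\<forall>\<^sub>F z in at x. \<bar>f z - f x\<bar> \<le> r z * norm (z - x)"
      using lb by (auto simp: lip_bound_def)
    have "\<forall>\<^sub>F z in at x. \<bar>\<bar>f z\<bar> - \<bar>f x\<bar>\<bar> \<le> r z * norm (z - x)"
      using r(2) by eventually_elim linarith
    then show ?thesis using r(1) by (auto simp: lip_bound_def)
  qed
  note abs = this
  obtain K where K: "compact K" "K \<subseteq> G" "\<And>x. x \<notin> K \<Longrightarrow> f x = 0" "\<And>x. x \<notin> K \<Longrightarrow> h x = 0"
    and "upper_gradient f h"
    by (rule test_pairE[OF assms]) (rule that; assumption)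
  then have "upper_gradient (\<lambda>x. \<bar>f x\<bar>) h" by (simp add: upper_gradient_def abs)
  then show ?thesis unfolding test_pair_def using K by (intro conjI exI[of _ K]) simp_all
qed

lemma test_pair_weighted_power:
  fixes G :: "'a::euclidean_space set"
  assumes G: "open G" "- G \<noteq> {}" and fh: "test_pair G f h" and f0: "\<And>x. 0 \<le> f x" and \<gamma>: "\<gamma> > 1"
  shows "test_pair G (\<lambda>x. f x powr \<gamma> * infdist x (- G) powr a)
    (\<lambda>x. \<bar>a\<bar> * (f x powr \<gamma> * infdist x (- G) powr (a - 1)) + \<gamma> * (f x powr (\<gamma> - 1) * h x * infdist x (- G) powr a))"
    (is "test_pair G ?w ?k")
proof -
  let ?d = "\<lambda>x. infdist x (- G)"
  obtain K where K: "compact K" "K \<subseteq> G" "\<And>x. x \<notin> K \<Longrightarrow> f x = 0" "\<And>x. x \<notin> K \<Longrightarrow> h x = 0"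
    and ug: "upper_gradient f h"
    by (rule test_pairE[OF fh]) (rule that; assumption)
  have h0: "h x \<ge> 0" for x using ug by (auto simp: upper_gradient_def)
  have zero: "?w x = 0" "?k x = 0" if "x \<notin> K" for x using K(3,4)[OF that] by auto
  note cf = upper_gradient_continuous(1)[OF ug] and ch = upper_gradient_continuous(2)[OF ug]
  have pc: "continuous_on UNIV (\<lambda>x. f x powr c)" if "c > 0" for c
    using f0 that by (intro continuous_on_powr' cf continuous_on_const) auto
  have cont: "continuous_on UNIV ?k"
    using \<gamma> by (intro continuous_on_add continuous_on_mult_left weighted_integrable(1)[OF G _ K(1,2)]
        continuous_on_mult[OF pc ch] pc) (simp_all add: K(3,4))
  have "lip_bound ?w (?k x) x" for x
  proof (cases "x \<in> K")
    case True
    then have d: "?d x > 0" using K(2) by (intro infdist_pos_of_open[OF G]) auto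
    have 1: "lip_bound (\<lambda>z. \<bar>f z\<bar> powr \<gamma>) (\<bar>\<gamma> * f x powr (\<gamma> - 1)\<bar> * h x) x"
      using ug by (intro lip_bound_compose abs_powr_derivative \<gamma> f0) (auto simp: upper_gradient_def)
    have 2: "lip_bound (\<lambda>z. ?d z powr a) (\<bar>a * ?d x powr (a - 1)\<bar> * 1) x"
      by (rule lip_bound_compose[OF lip_bound_infdist]) (use d in \<open>auto intro!: derivative_eq_intros\<close>)
    from lip_bound_mult[OF 1 2] show ?thesis
      using f0 \<gamma> by (simp add: abs_mult mult_ac)
  next
    case False
    have "open (- K)" using K(1) by (simp add: compact_imp_closed open_Compl)
    then have "\<forall>\<^sub>F z in nhds x. z \<in> - K" using False by (intro eventually_nhds_in_open) auto
    then have "\<forall>\<^sub>F z in nhds x. ?w z = 0" by eventually_elim (use zero in auto)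
    from lip_bound_cong[OF lip_bound_const this] show ?thesis using zero(2)[OF False] by simp
  qed
  moreover have "?k x \<ge> 0" for x using h0 \<gamma> by simp
  ultimately have "upper_gradient ?w ?k" using cont by (simp add: upper_gradient_def)
  then show ?thesis unfolding test_pair_def using K(1,2) zero by blast
qed

text \<open>Hoelder's inequality bounds the right-hand side for \<open>f\<^sup>p\<close> by \<open>A\<^sup>(\<^sup>p\<^sup>-\<^sup>1\<^sup>)\<^sup>/\<^sup>p D\<^sup>1\<^sup>/\<^sup>p\<close>, where \<open>A\<close> is the left-hand
side; as \<open>A\<close> is finite, its power can be cancelled.\<close>

lemma weighted_Hardy:
  fixes G :: "'a::euclidean_space set"
  assumes G: "open G" "- G \<noteq> {}" and p: "p > 1" and hardy: "Hardy_L1 s G"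
  shows "\<exists>C\<ge>0. \<forall>f h. test_pair G f h \<longrightarrow> (\<forall>x. 0 \<le> f x) \<longrightarrow>
    (LINT x|lborel. f x powr p * infdist x (- G) powr (- s - 1)) \<le>
    C * (LINT x|lborel. h x powr p * infdist x (- G) powr (p - 1 - s))"
proof -
  let ?d = "\<lambda>x. infdist x (- G)"
  obtain C where C: "C \<ge> 0" "\<And>f h. test_pair G f h \<Longrightarrow>
     (\<integral>\<^sup>+x. ennreal (\<bar>f x\<bar> * ?d x powr (- s - 1)) \<partial>lborel) \<le>
     ennreal C * (\<integral>\<^sup>+x. ennreal (h x * ?d x powr (- s)) \<partial>lborel)"
    using hardy unfolding Hardy_L1_def by blast
  have "(LINT x|lborel. f x powr p * ?d x powr (- s - 1)) \<le>
    (C * p) powr p * (LINT x|lborel. h x powr p * ?d x powr (p - 1 - s))"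
    if fh: "test_pair G f h" and f0: "\<And>x. 0 \<le> f x" for f h
  proof -
    obtain K where K: "compact K" "K \<subseteq> G" "\<And>x. x \<notin> K \<Longrightarrow> f x = 0" "\<And>x. x \<notin> K \<Longrightarrow> h x = 0"
      and ug: "upper_gradient f h"
      by (rule test_pairE[OF fh]) (rule that; assumption)
    have h0: "h x \<ge> 0" for x using ug by (auto simp: upper_gradient_def)
    note cf = upper_gradient_continuous(1)[OF ug] and ch = upper_gradient_continuous(2)[OF ug]
    have pf: "continuous_on UNIV (\<lambda>x. f x powr c)" if "c > 0" for c
      using f0 that by (intro continuous_on_powr' cf continuous_on_const) auto
    have ph: "continuous_on UNIV (\<lambda>x. h x powr c)" if "c > 0" for c
      using h0 that by (intro continuous_on_powr' ch continuous_on_const) auto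
    define u v where "u x = f x powr p * ?d x powr (- s - 1)"
      and "v x = h x powr p * ?d x powr (p - 1 - s)" for x
    define \<theta> where "\<theta> = (p - 1) / p"
    have \<theta>: "0 \<le> \<theta>" "\<theta> \<le> 1" "1 - \<theta> = 1 / p" using p by (auto simp: \<theta>_def field_simps)
    have iu: "integrable lborel u" unfolding u_def using p K by (intro weighted_integrable(2)[OF G _ K(1,2)] pf) auto
    have iv: "integrable lborel v" unfolding v_def using p K by (intro weighted_integrable(2)[OF G _ K(1,2)] ph) auto
    have ik: "integrable lborel (\<lambda>x. f x powr (p - 1) * h x * ?d x powr (- s))"
      using p K by (intro weighted_integrable(2)[OF G _ K(1,2)] continuous_on_mult[OF pf ch]) auto
    have uv0: "u x \<ge> 0" "v x \<ge> 0" for x by (auto simp: u_def v_def)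
    define A where "A = (LINT x|lborel. u x)"
    define D where "D = (LINT x|lborel. v x)"
    define M where "M = (LINT x|lborel. f x powr (p - 1) * h x * ?d x powr (- s))"
    have AD: "A \<ge> 0" "D \<ge> 0" "M \<ge> 0" using uv0 h0 by (auto simp: A_def D_def M_def)
    have tp: "test_pair G (\<lambda>x. \<bar>f x\<bar> powr p) (\<lambda>x. \<bar>p * f x powr (p - 1)\<bar> * h x)"
      unfolding test_pair_def
    proof (intro conjI exI[of _ K] K(1,2) allI impI)
      show "upper_gradient (\<lambda>x. \<bar>f x\<bar> powr p) (\<lambda>x. \<bar>p * f x powr (p - 1)\<bar> * h x)"
        using p by (intro upper_gradient_compose[OF ug] abs_powr_derivative f0 continuous_on_mult_left pf) auto
    qed (use K(3,4) in auto)
    have "ennreal A = (\<integral>\<^sup>+x. ennreal (u x) \<partial>lborel)"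
      using nn_integral_eq_integral[OF iu] uv0 by (simp add: A_def)
    also have "\<dots> = (\<integral>\<^sup>+x. ennreal (\<bar>\<bar>f x\<bar> powr p\<bar> * ?d x powr (- s - 1)) \<partial>lborel)"
      using f0 by (simp add: u_def)
    also have "\<dots> \<le> ennreal C * (\<integral>\<^sup>+x. ennreal (\<bar>p * f x powr (p - 1)\<bar> * h x * ?d x powr (- s)) \<partial>lborel)"
      by (rule C(2)[OF tp])
    also have "(\<integral>\<^sup>+x. ennreal (\<bar>p * f x powr (p - 1)\<bar> * h x * ?d x powr (- s)) \<partial>lborel) =
       (\<integral>\<^sup>+x. ennreal (p * (f x powr (p - 1) * h x * ?d x powr (- s))) \<partial>lborel)"
      using p by (intro nn_integral_cong) (simp add: abs_mult mult_ac)
    also have "\<dots> = ennreal (p * M)"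
      using p h0 ik by (subst nn_integral_eq_integral) (auto simp: M_def)
    finally have AM: "A \<le> C * p * M" using C(1) p AD by (simp add: ennreal_mult[symmetric] mult.assoc)
    \<comment> \<open>The weights match: \<open>- (s + 1) (p - 1)/p + (p - 1 - s)/p = - s\<close>.\<close>
    have "M = (LINT x|lborel. u x powr \<theta> * v x powr (1 - \<theta>))"
      unfolding M_def
    proof (intro Bochner_Integration.integral_cong refl)
      fix x
      show "f x powr (p - 1) * h x * ?d x powr (- s) = u x powr \<theta> * v x powr (1 - \<theta>)"
      proof (cases "x \<in> K")
        case True
        have e: "(- s - 1) * \<theta> + (p - 1 - s) * (1 / p) = - s" "p * \<theta> = p - 1"
          using p by (auto simp: \<theta>_def field_simps)
        have "u x powr \<theta> * v x powr (1 - \<theta>) = f x powr (p * \<theta>) * h x * (?d x powr ((- s - 1) * \<theta>) * ?d x powr ((p - 1 - s) * (1 / p)))"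
          unfolding \<theta>(3) using p f0[of x] h0[of x] infdist_nonneg[of x "- G"]
          by (simp add: u_def v_def powr_mult powr_powr)
        also have "\<dots> = f x powr (p - 1) * h x * ?d x powr (- s)"
          unfolding powr_add[symmetric] e ..
        finally show ?thesis by simp
      qed (use K(3,4) p in \<open>auto simp: u_def v_def\<close>)
    qed
    also have "\<dots> \<le> A powr \<theta> * D powr (1 - \<theta>)"
      unfolding A_def D_def by (rule Hoelder_interpolation[OF iu uv0(1) iv uv0(2) \<theta>(1,2)])
    finally have "A \<le> C * p * (A powr \<theta> * D powr (1 / p))"
      unfolding \<theta>(3) using AM C(1) p by (meson dual_order.trans less_eq_real_def mult_left_mono mult_nonneg_nonneg zero_less_one order_less_trans)
    then have le: "A \<le> A powr \<theta> * (C * p * D powr (1 / p))" by (simp add: mult_ac)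
    have "A \<le> (C * p) powr p * D"
    proof (cases "A = 0")
      case False
      then have A: "A > 0" using AD by simp
      have "A powr \<theta> * A powr (1 / p) \<le> A powr \<theta> * (C * p * D powr (1 / p))"
        using le A p by (simp add: powr_add[symmetric] \<theta>(3)[symmetric])
      then have "A powr (1 / p) \<le> C * p * D powr (1 / p)" using A by simp
      then have "(A powr (1 / p)) powr p \<le> (C * p * D powr (1 / p)) powr p"
        using p by (intro powr_mono2) auto
      then show ?thesis using A AD p C(1) by (simp add: powr_mult powr_powr)
    qed (use AD in simp)
    then show ?thesis by (simp add: A_def D_def u_def v_def)
  qed
  then show ?thesis by (intro exI[of _ "(C * p) powr p"]) auto
qed

text \<open>The exponents \<open>\<gamma>\<close> and \<open>a\<close> are such that the power \<open>n/(n-1)\<close> of \<open>f\<^sup>\<gamma> d\<^sup>a\<close> is the integrand \<open>z\<close> on the left.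
By Hoelder's inequality both terms of its upper gradient are bounded by \<open>B\<^sup>(\<^sup>p\<^sup>-\<^sup>1\<^sup>)\<^sup>/\<^sup>p D\<^sup>1\<^sup>/\<^sup>p\<close>, where \<open>B\<close> is the
integral of \<open>z\<close>; the one from the derivative of \<open>d\<^sup>a\<close> needs the Hardy inequality. Since \<open>B\<close> is
finite, its power can be cancelled.\<close>

lemma weighted_Sobolev:
  fixes G :: "'a::euclidean_space set"
  defines "n \<equiv> real DIM('a)"
  assumes G: "open G" "- G \<noteq> {}" and p: "1 < p" "p < n" and hardy: "Hardy_L1 (p - 1 - \<beta>) G"
  shows "\<exists>C\<ge>0. \<forall>f h. test_pair G f h \<longrightarrow> (\<forall>x. 0 \<le> f x) \<longrightarrow>
    (LINT x|lborel. f x powr (n * p / (n - p)) * infdist x (- G) powr (n * \<beta> / (n - p))) \<le>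
    C * (LINT x|lborel. h x powr p * infdist x (- G) powr \<beta>) powr (n / (n - p))"
proof -
  let ?d = "\<lambda>x. infdist x (- G)"
  obtain CH where CH: "CH \<ge> 0" "\<And>f h. test_pair G f h \<Longrightarrow> (\<And>x. 0 \<le> f x) \<Longrightarrow>
    (LINT x|lborel. f x powr p * ?d x powr (\<beta> - p)) \<le> CH * (LINT x|lborel. h x powr p * ?d x powr \<beta>)"
    using weighted_Hardy[OF G p(1) hardy] by auto
  have n: "n > 1" using p by simp
  define \<gamma> where "\<gamma> = p * (n - 1) / (n - p)"
  define a where "a = \<beta> * (n - 1) / (n - p)"
  define ps where "ps = n * p / (n - p)"
  define n' where "n' = n / (n - 1)"
  define \<theta> where "\<theta> = (p - 1) / p"
  define A0 where "A0 = 8 * (2 powr n * unit_ball_vol n powr (- (1 / n)))"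
  define C3 where "C3 = A0 * (\<bar>a\<bar> * CH powr (1 / p) + \<gamma>)"
  have \<gamma>: "\<gamma> > 1"
  proof -
    have "1 * (n - p) < p * (n - 1)" using p n by (simp add: algebra_simps)
    then show ?thesis using p by (simp add: \<gamma>_def field_simps)
  qed
  have \<theta>: "0 \<le> \<theta>" "\<theta> \<le> 1" "1 - \<theta> = 1 / p" using p by (auto simp: \<theta>_def field_simps)
  have A0: "A0 \<ge> 0" by (simp add: A0_def)
  have C3: "C3 \<ge> 0" using A0 \<gamma> by (simp add: C3_def)
  have ps: "ps > 0" using p n by (simp add: ps_def)
  have n'e: "\<gamma> * n' = ps" "a * n' = n * \<beta> / (n - p)"
    using p n by (simp_all add: \<gamma>_def n'_def ps_def a_def)
  have e: "ps * \<theta> + 1 = \<gamma>" "ps * \<theta> = \<gamma> - 1"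
    "n * \<beta> / (n - p) * \<theta> + (\<beta> - p) / p = a - 1" "n * \<beta> / (n - p) * \<theta> + \<beta> / p = a"
    using p n by (auto simp: \<gamma>_def n'_def ps_def a_def \<theta>_def field_simps)
  have e': "(1 - \<theta> * n') * ps = n'"
  proof -
    have "1 / n' - \<theta> = 1 / ps" using p n by (simp add: \<theta>_def n'_def ps_def field_simps)
    moreover have "n' > 0" using n by (simp add: n'_def)
    then have "(1 - \<theta> * n') * ps = n' * (1 / n' - \<theta>) * ps" by (simp add: right_diff_distrib)
    ultimately show ?thesis using ps by simp
  qed
  have e'': "1 / p * ps = n / (n - p)" using p by (simp add: ps_def)
  have pos: "1 - \<theta> * n' > 0"
    using e' ps n by (metis divide_pos_pos n'_def diff_gt_0_iff_gt less_trans zero_less_one zero_less_mult_pos2)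
  have "(LINT x|lborel. f x powr ps * ?d x powr (n * \<beta> / (n - p))) \<le>
    C3 powr ps * (LINT x|lborel. h x powr p * ?d x powr \<beta>) powr (n / (n - p))"
    if fh: "test_pair G f h" and f0: "\<And>x. 0 \<le> f x" for f h
  proof -
    obtain K where K: "compact K" "K \<subseteq> G" "\<And>x. x \<notin> K \<Longrightarrow> f x = 0" "\<And>x. x \<notin> K \<Longrightarrow> h x = 0"
      and ug: "upper_gradient f h"
      by (rule test_pairE[OF fh]) (rule that; assumption)
    have h0: "h x \<ge> 0" for x using ug by (auto simp: upper_gradient_def)
    note cf = upper_gradient_continuous(1)[OF ug] and ch = upper_gradient_continuous(2)[OF ug]
    have pf: "continuous_on UNIV (\<lambda>x. f x powr c)" if "c > 0" for c
      using f0 that by (intro continuous_on_powr' cf continuous_on_const) auto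
    have ph: "continuous_on UNIV (\<lambda>x. h x powr c)" if "c > 0" for c
      using h0 that by (intro continuous_on_powr' ch continuous_on_const) auto
    define u v z where "u x = f x powr p * ?d x powr (\<beta> - p)"
      and "v x = h x powr p * ?d x powr \<beta>" and "z x = f x powr ps * ?d x powr (n * \<beta> / (n - p))" for x
    have iu: "integrable lborel u" unfolding u_def using p K by (intro weighted_integrable(2)[OF G _ K(1,2)] pf) auto
    have iv: "integrable lborel v" unfolding v_def using p K by (intro weighted_integrable(2)[OF G _ K(1,2)] ph) auto
    have iz: "integrable lborel z" unfolding z_def using ps K by (intro weighted_integrable(2)[OF G _ K(1,2)] pf) auto
    have i1: "integrable lborel (\<lambda>x. f x powr \<gamma> * ?d x powr (a - 1))"
      using \<gamma> K by (intro weighted_integrable(2)[OF G _ K(1,2)] pf) auto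
    have i2: "integrable lborel (\<lambda>x. f x powr (\<gamma> - 1) * h x * ?d x powr a)"
      using \<gamma> K by (intro weighted_integrable(2)[OF G _ K(1,2)] continuous_on_mult[OF pf ch]) auto
    have nn: "u x \<ge> 0" "v x \<ge> 0" "z x \<ge> 0" for x by (auto simp: u_def v_def z_def)
    define A where "A = (LINT x|lborel. u x)"
    define D where "D = (LINT x|lborel. v x)"
    define B where "B = (LINT x|lborel. z x)"
    have AD: "A \<ge> 0" "D \<ge> 0" "B \<ge> 0" using nn by (auto simp: A_def D_def B_def)
    have AHD: "A \<le> CH * D" unfolding A_def D_def u_def v_def by (rule CH(2)[OF fh f0])
    have 1: "(LINT x|lborel. f x powr \<gamma> * ?d x powr (a - 1)) \<le> B powr \<theta> * A powr (1 / p)"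
    proof -
      have "f x powr \<gamma> * ?d x powr (a - 1) = z x powr \<theta> * u x powr (1 / p)" for x
      proof (cases "f x = 0")
        case False
        then have fx: "f x > 0" using f0[of x] by simp
        have "z x powr \<theta> * u x powr (1 / p) = (f x powr (ps * \<theta>) * f x powr 1) *
           (?d x powr (n * \<beta> / (n - p) * \<theta>) * ?d x powr ((\<beta> - p) / p))"
          using p fx by (simp add: z_def u_def powr_mult powr_powr)
        then show ?thesis unfolding powr_add[symmetric] e by simp
      qed (use \<gamma> in \<open>simp add: z_def\<close>)
      then show ?thesis
        using Hoelder_interpolation[OF iz nn(3) iu nn(1) \<theta>(1,2)] by (simp add: A_def B_def \<theta>(3))
    qed
    have 2: "(LINT x|lborel. f x powr (\<gamma> - 1) * h x * ?d x powr a) \<le> B powr \<theta> * D powr (1 / p)"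
    proof -
      have "f x powr (\<gamma> - 1) * h x * ?d x powr a = z x powr \<theta> * v x powr (1 / p)" for x
      proof -
        have "z x powr \<theta> * v x powr (1 / p) = f x powr (ps * \<theta>) * h x *
           (?d x powr (n * \<beta> / (n - p) * \<theta>) * ?d x powr (\<beta> / p))"
          using p h0[of x] by (simp add: z_def v_def powr_mult powr_powr)
        then show ?thesis unfolding powr_add[symmetric] e by simp
      qed
      then show ?thesis
        using Hoelder_interpolation[OF iz nn(3) iv nn(2) \<theta>(1,2)] by (simp add: D_def B_def \<theta>(3))
    qed
    define k where "k x = \<bar>a\<bar> * (f x powr \<gamma> * ?d x powr (a - 1)) + \<gamma> * (f x powr (\<gamma> - 1) * h x * ?d x powr a)" for x
    have tp: "test_pair G (\<lambda>x. f x powr \<gamma> * ?d x powr a) k"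
      unfolding k_def by (rule test_pair_weighted_power[OF G fh f0 \<gamma>])
    define Ik where "Ik = (LINT x|lborel. k x)"
    have "Ik = \<bar>a\<bar> * (LINT x|lborel. f x powr \<gamma> * ?d x powr (a - 1)) + \<gamma> * (LINT x|lborel. f x powr (\<gamma> - 1) * h x * ?d x powr a)"
      unfolding Ik_def k_def using i1 i2 by simp
    also have "\<dots> \<le> \<bar>a\<bar> * (B powr \<theta> * A powr (1 / p)) + \<gamma> * (B powr \<theta> * D powr (1 / p))"
      using \<gamma> by (intro add_mono mult_left_mono 1 2) auto
    also have "\<dots> \<le> \<bar>a\<bar> * (B powr \<theta> * (CH powr (1 / p) * D powr (1 / p))) + \<gamma> * (B powr \<theta> * D powr (1 / p))"
    proof -
      have "A powr (1 / p) \<le> (CH * D) powr (1 / p)" using AHD AD p by (intro powr_mono2) auto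
      then show ?thesis using AD CH(1) by (intro add_right_mono mult_left_mono) (auto simp: powr_mult)
    qed
    also have "\<dots> = (\<bar>a\<bar> * CH powr (1 / p) + \<gamma>) * (B powr \<theta> * D powr (1 / p))"
      by (simp add: algebra_simps)
    finally have Ik: "A0 * Ik \<le> C3 * (B powr \<theta> * D powr (1 / p))"
      unfolding C3_def mult.assoc using A0 by (rule mult_left_mono)
    have k0: "k x \<ge> 0" for x using \<gamma> h0 by (simp add: k_def)
    then have Ik0: "Ik \<ge> 0" by (simp add: Ik_def)
    have "ennreal B = (\<integral>\<^sup>+x. ennreal ((f x powr \<gamma> * ?d x powr a) powr n') \<partial>lborel)"
    proof -
      have "(f x powr \<gamma> * ?d x powr a) powr n' = z x" for x
        by (simp add: z_def powr_mult powr_powr n'e)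
      then show ?thesis using nn_integral_eq_integral[OF iz] nn(3) by (simp add: B_def)
    qed
    also have "\<dots> \<le> ennreal ((A0 * Ik) powr n')"
      using Sobolev_L1[OF n[unfolded n_def] tp] unfolding A0_def n'_def n_def Ik_def by simp
    finally have "B \<le> (A0 * Ik) powr n'" by simp
    also have "\<dots> \<le> (C3 * (B powr \<theta> * D powr (1 / p))) powr n'"
      using Ik A0 Ik0 n by (intro powr_mono2) (auto simp: n'_def)
    also have "\<dots> = B powr (\<theta> * n') * (C3 * D powr (1 / p)) powr n'"
      using C3 by (simp add: powr_mult powr_powr)
    finally have le: "B \<le> B powr (\<theta> * n') * (C3 * D powr (1 / p)) powr n'" .
    have "B \<le> C3 powr ps * D powr (n / (n - p))"
    proof (cases "B = 0")
      case False
      then have B: "B > 0" using AD by simp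
      have "B powr (\<theta> * n') * B powr (1 - \<theta> * n') \<le> B powr (\<theta> * n') * (C3 * D powr (1 / p)) powr n'"
        using le B by (simp add: powr_add[symmetric])
      then have "B powr (1 - \<theta> * n') \<le> (C3 * D powr (1 / p)) powr n'" using B by simp
      then have "B powr (1 - \<theta> * n') \<le> ((C3 * D powr (1 / p)) powr ps) powr (1 - \<theta> * n')"
        by (simp only: powr_powr mult.commute[of ps] e')
      then have "B \<le> (C3 * D powr (1 / p)) powr ps"
        using pos B AD by (metis less_le_not_le linorder_not_less powr_ge_zero powr_less_mono2)
      then show ?thesis using C3 by (simp add: powr_mult powr_powr e''[symmetric])
    qed (use C3 in simp)
    then show ?thesis by (simp add: B_def D_def z_def v_def)
  qed
  then show ?thesis unfolding ps_def by (intro exI[of _ "C3 powr (n * p / (n - p))"]) auto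
qed

lemma weighted_Hardy_Sobolev:
  fixes G :: "'a::euclidean_space set"
  defines "n \<equiv> real DIM('a)"
  assumes G: "open G" "- G \<noteq> {}" and p: "1 < p" "p < n" and q: "p \<le> q" "q \<le> n * p / (n - p)"
    and hardy: "Hardy_L1 (p - 1 - \<beta>) G"
  shows "\<exists>C>0. \<forall>f h. test_pair G f h \<longrightarrow> (\<forall>x. 0 \<le> f x) \<longrightarrow>
    (LINT x|lborel. f x powr q * infdist x (- G) powr (q / p * (n - p + \<beta>) - n)) powr (1 / q) \<le>
    C * (LINT x|lborel. h x powr p * infdist x (- G) powr \<beta>) powr (1 / p)"
proof -
  let ?d = "\<lambda>x. infdist x (- G)"
  obtain C1 where C1: "C1 \<ge> 0" "\<And>f h. test_pair G f h \<Longrightarrow> (\<And>x. 0 \<le> f x) \<Longrightarrow>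
    (LINT x|lborel. f x powr p * ?d x powr (\<beta> - p)) \<le> C1 * (LINT x|lborel. h x powr p * ?d x powr \<beta>)"
    using weighted_Hardy[OF G p(1) hardy] by auto
  define ps where "ps = n * p / (n - p)"
  obtain C2 where C2: "C2 \<ge> 0" "\<And>f h. test_pair G f h \<Longrightarrow> (\<And>x. 0 \<le> f x) \<Longrightarrow>
    (LINT x|lborel. f x powr ps * ?d x powr (n * \<beta> / (n - p))) \<le> C2 * (LINT x|lborel. h x powr p * ?d x powr \<beta>) powr (n / (n - p))"
    using weighted_Sobolev[OF G p[unfolded n_def] hardy, folded n_def] unfolding ps_def by blast
  \<comment> \<open>The position of \<open>q\<close> between the end points \<open>p\<close> and \<open>n p / (n - p)\<close>.\<close>
  define \<tau> where "\<tau> = (q - p) / (ps - p)"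
  have psp: "ps - p = p * p / (n - p)" using p by (simp add: ps_def field_simps)
  then have "ps > p" using p by (metis diff_gt_0_iff_gt divide_pos_pos less_trans mult_pos_pos zero_less_one)
  then have \<tau>: "0 \<le> \<tau>" "\<tau> \<le> 1" using q by (auto simp: \<tau>_def ps_def[symmetric])
  have \<tau>q: "\<tau> * (p * p) = (q - p) * (n - p)" using p by (simp add: \<tau>_def psp)
  have "p * (ps * \<tau> + p * (1 - \<tau>)) = p * q"
  proof -
    have "p * (ps * \<tau> + p * (1 - \<tau>)) = p * (\<tau> * (ps - p) + p)" by (simp add: algebra_simps)
    also have "\<tau> * (ps - p) = q - p" using \<open>ps > p\<close> by (simp add: \<tau>_def)
    finally show ?thesis by simp
  qed
  then have e1: "ps * \<tau> + p * (1 - \<tau>) = q" using p by simp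
  have e3: "n / (n - p) = ps / p" using p by (simp add: ps_def)
  have e2: "n * \<beta> / (n - p) * \<tau> + (\<beta> - p) * (1 - \<tau>) = q / p * (n - p + \<beta>) - n"
  proof -
    have "n * \<beta> / (n - p) = \<beta> * ps / p" using p by (simp add: ps_def)
    moreover have "\<beta> * ps / p * \<tau> + (\<beta> - p) * (1 - \<tau>) = \<beta> / p * (ps * \<tau> + p * (1 - \<tau>)) - p * (1 - \<tau>)"
      using p by (simp add: field_simps)
    ultimately have "n * \<beta> / (n - p) * \<tau> + (\<beta> - p) * (1 - \<tau>) = \<beta> / p * (ps * \<tau> + p * (1 - \<tau>)) - p * (1 - \<tau>)"
      by (simp only:)
    also have "\<dots> = \<beta> / p * q - p * (1 - \<tau>)" by (simp only: e1)
    also have "p * (1 - \<tau>) = p - (q - p) * (n - p) / p"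
      using \<tau>q p by (simp add: field_simps)
    finally show ?thesis using p by (simp add: field_simps)
  qed
  define C where "C = (C2 powr \<tau> * C1 powr (1 - \<tau>)) powr (1 / q)"
  have "(LINT x|lborel. f x powr q * ?d x powr (q / p * (n - p + \<beta>) - n)) powr (1 / q) \<le>
    C * (LINT x|lborel. h x powr p * ?d x powr \<beta>) powr (1 / p)"
    if fh: "test_pair G f h" and f0: "\<And>x. 0 \<le> f x" for f h
  proof -
    obtain K where K: "compact K" "K \<subseteq> G" "\<And>x. x \<notin> K \<Longrightarrow> f x = 0" "\<And>x. x \<notin> K \<Longrightarrow> h x = 0"
      and ug: "upper_gradient f h"
      by (rule test_pairE[OF fh]) (rule that; assumption)
    note cf = upper_gradient_continuous(1)[OF ug]
    have pf: "continuous_on UNIV (\<lambda>x. f x powr c)" if "c > 0" for c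
      using f0 that by (intro continuous_on_powr' cf continuous_on_const) auto
    define u z where "u x = f x powr p * ?d x powr (\<beta> - p)"
      and "z x = f x powr ps * ?d x powr (n * \<beta> / (n - p))" for x
    have iu: "integrable lborel u" unfolding u_def using p K by (intro weighted_integrable(2)[OF G _ K(1,2)] pf) auto
    have iz: "integrable lborel z" unfolding z_def using p \<open>ps > p\<close> K by (intro weighted_integrable(2)[OF G _ K(1,2)] pf) auto
    have nn: "u x \<ge> 0" "z x \<ge> 0" for x by (auto simp: u_def z_def)
    define D where "D = (LINT x|lborel. h x powr p * ?d x powr \<beta>)"
    have D: "D \<ge> 0" by (simp add: D_def)
    have "f x powr q * ?d x powr (q / p * (n - p + \<beta>) - n) = z x powr \<tau> * u x powr (1 - \<tau>)" for x
    proof -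
      have "z x powr \<tau> * u x powr (1 - \<tau>) = (f x powr (ps * \<tau>) * f x powr (p * (1 - \<tau>))) *
        (?d x powr (n * \<beta> / (n - p) * \<tau>) * ?d x powr ((\<beta> - p) * (1 - \<tau>)))"
        by (simp add: z_def u_def powr_mult powr_powr)
      then show ?thesis unfolding powr_add[symmetric] e1 e2 by simp
    qed
    then have "(LINT x|lborel. f x powr q * ?d x powr (q / p * (n - p + \<beta>) - n)) \<le>
      (LINT x|lborel. z x) powr \<tau> * (LINT x|lborel. u x) powr (1 - \<tau>)"
      using Hoelder_interpolation[OF iz nn(2) iu nn(1) \<tau>] by simp
    also have "\<dots> \<le> (C2 * D powr (ps / p)) powr \<tau> * (C1 * D) powr (1 - \<tau>)"
      using C2(2)[OF fh f0] C1(2)[OF fh f0] \<tau> nn unfolding e3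
      by (intro mult_mono powr_mono2) (auto simp: D_def z_def u_def)
    also have "\<dots> = C2 powr \<tau> * C1 powr (1 - \<tau>) * (D powr (ps / p * \<tau>) * D powr (1 - \<tau>))"
      using C1(1) C2(1) D by (simp add: powr_mult powr_powr)
    also have "D powr (ps / p * \<tau>) * D powr (1 - \<tau>) = D powr (q / p)"
    proof -
      have "ps / p * \<tau> + (1 - \<tau>) = q / p" using p e1 by (simp add: field_simps)
      then show ?thesis by (simp add: powr_add[symmetric])
    qed
    finally have "(LINT x|lborel. f x powr q * ?d x powr (q / p * (n - p + \<beta>) - n)) powr (1 / q) \<le>
      (C2 powr \<tau> * C1 powr (1 - \<tau>) * D powr (q / p)) powr (1 / q)"
      using p q by (intro powr_mono2) auto
    also have "\<dots> = C * D powr (1 / p)"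
      using p q by (simp add: C_def powr_mult powr_powr)
    finally show ?thesis by (simp add: D_def)
  qed
  moreover have "C \<ge> 0" by (simp add: C_def)
  ultimately have "(LINT x|lborel. f x powr q * ?d x powr (q / p * (n - p + \<beta>) - n)) powr (1 / q) \<le>
    (C + 1) * (LINT x|lborel. h x powr p * ?d x powr \<beta>) powr (1 / p)"
    if fh: "test_pair G f h" and f0: "\<And>x. 0 \<le> f x" for f h
    using that by (meson add_increasing2 mult_right_mono order_refl order_trans powr_ge_zero zero_le_one)
  then show ?thesis using \<open>C \<ge> 0\<close> by (intro exI[of _ "C + 1"]) auto
qed


section \<open>Smooth functions and the Hardy--Sobolev inequality\<close>

text \<open>A segment from \<open>x\<close> to its nearest point outside \<open>G\<close> meets the boundary.\<close>

lemma infdist_frontier_eq_infdist_complement: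
  fixes G :: "'a::euclidean_space set"
  assumes "open G" "- G \<noteq> {}" "x \<in> G"
  shows "infdist x (frontier G) = infdist x (- G)"
proof (rule antisym)
  obtain w where w: "w \<in> - G" "infdist x (- G) = dist x w"
    using infdist_attains_inf[of "- G" x] assms by (auto simp: closed_Compl)
  have "closed_segment x w \<inter> frontier G \<noteq> {}"
    using assms w(1) by (intro connected_Int_frontier) (auto simp: disjoint_iff)
  then obtain y where y: "y \<in> closed_segment x w" "y \<in> frontier G" by blast
  have "infdist x (frontier G) \<le> dist x y" by (rule infdist_le[OF y(2)])
  also have "\<dots> \<le> dist x w"
    using segment_bound(1)[OF y(1)] by (simp add: dist_norm norm_minus_commute)
  finally show "infdist x (frontier G) \<le> infdist x (- G)" by (simp add: w(2))
  have "frontier G \<subseteq> - G"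
    using \<open>open G\<close> by (auto simp: frontier_def interior_open)
  then show "infdist x (- G) \<le> infdist x (frontier G)"
    using y(2) by (intro infdist_mono) auto
qed

lemma frechet_derivative_eq_inner_gradient:
  fixes f :: "'a::euclidean_space \<Rightarrow> real"
  assumes "f differentiable (at x)"
  shows "frechet_derivative f (at x) v = gradient f x \<bullet> v"
proof -
  have lin: "linear (frechet_derivative f (at x))" by (rule linear_frechet_derivative[OF assms])
  have "frechet_derivative f (at x) v = frechet_derivative f (at x) (\<Sum>b\<in>Basis. (v \<bullet> b) *\<^sub>R b)"
    by (simp add: euclidean_representation)
  also have "\<dots> = (\<Sum>b\<in>Basis. (v \<bullet> b) * frechet_derivative f (at x) b)"
    by (simp add: linear_sum[OF lin] linear_scale[OF lin])
  finally show ?thesis by (simp add: gradient_def inner_sum_left inner_commute[of v] mult.commute)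
qed

lemma test_pair_of_test_function:
  fixes f :: "'a::euclidean_space \<Rightarrow> real"
  assumes f: "f \<in> test_functions G"
  shows "test_pair G f (\<lambda>x. norm (gradient f x))"
proof -
  define K where "K = closure {x. f x \<noteq> 0}"
  have K: "compact K" "K \<subseteq> G" and C1: "class_C 1 f"
    using f by (auto simp: test_functions_def smooth_def K_def)
  have diff: "f differentiable (at x)" for x using C1 by simp
  have cont: "continuous_on UNIV (gradient f)"
    using C1 unfolding gradient_def[abs_def] by (intro continuous_intros) auto
  have f0: "f x = 0" if "x \<notin> K" for x
    using that closure_subset[of "{x. f x \<noteq> 0}"] unfolding K_def by auto
  have grad0: "gradient f x = 0" if "x \<notin> K" for x
  proof -
    have "open (- K)" using K(1) by (simp add: compact_imp_closed open_Compl)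
    then have "\<forall>\<^sub>F z in nhds x. z \<in> - K" using that by (intro eventually_nhds_in_open) auto
    then have "\<forall>\<^sub>F z in nhds x. 0 = f z" by eventually_elim (use f0 in auto)
    then have "(f has_derivative (\<lambda>_. 0)) (at x)"
      by (intro has_derivative_transform_eventually[where f="\<lambda>_. 0" and g=f])
        (auto simp: f0[OF that] eventually_nhds_conv_at)
    then have "frechet_derivative f (at x) = (\<lambda>_. 0)" by (rule frechet_derivative_at[symmetric])
    then show ?thesis by (simp add: gradient_def)
  qed
  have "lip_bound f (norm (gradient f x)) x" for x
  proof -
    let ?D = "frechet_derivative f (at x)"
    define r where "r z = norm (gradient f x) + norm (f z - f x - ?D (z - x)) / norm (z - x)" for z
    have "((\<lambda>z. norm (f z - f x - ?D (z - x)) / norm (z - x)) \<longlongrightarrow> 0) (at x)"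
      using diff[of x] unfolding frechet_derivative_works has_derivative_iff_norm by blast
    then have "(r \<longlongrightarrow> norm (gradient f x) + 0) (at x)"
      unfolding r_def by (intro tendsto_intros)
    moreover have "\<bar>f z - f x\<bar> \<le> r z * norm (z - x)" if "z \<noteq> x" for z
    proof -
      have "\<bar>f z - f x\<bar> \<le> \<bar>?D (z - x)\<bar> + \<bar>f z - f x - ?D (z - x)\<bar>" by linarith
      also have "\<bar>?D (z - x)\<bar> \<le> norm (gradient f x) * norm (z - x)"
        unfolding frechet_derivative_eq_inner_gradient[OF diff] by (rule Cauchy_Schwarz_ineq2)
      finally show ?thesis using that by (simp add: r_def distrib_right)
    qed
    then have "\<forall>\<^sub>F z in at x. \<bar>f z - f x\<bar> \<le> r z * norm (z - x)"
      by (simp add: eventually_at_filter)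
    ultimately show ?thesis unfolding lip_bound_def by auto
  qed
  then have "upper_gradient f (\<lambda>x. norm (gradient f x))"
    using cont by (auto simp: upper_gradient_def intro: continuous_intros)
  then show ?thesis
    unfolding test_pair_def using K f0 grad0 by (intro conjI exI[of _ K]) simp_all
qed

lemma admits_Hardy_Sobolev_of_Hardy_L1:
  fixes G :: "'a::euclidean_space set"
  assumes G: "open G" "- G \<noteq> {}" and p: "1 < p" "p < real DIM('a)"
    and q: "p \<le> q" "q \<le> real DIM('a) * p / (real DIM('a) - p)"
    and hardy: "Hardy_L1 (p - 1 - \<beta>) G"
  shows "admits_Hardy_Sobolev q p \<beta> G"
proof -
  define e where "e = q / p * (real DIM('a) - p + \<beta>) - real DIM('a)"
  obtain C where C: "C > 0" "\<And>f h. test_pair G f h \<Longrightarrow> (\<And>x. 0 \<le> f x) \<Longrightarrow>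
    (LINT x|lborel. f x powr q * infdist x (- G) powr e) powr (1 / q) \<le>
    C * (LINT x|lborel. h x powr p * infdist x (- G) powr \<beta>) powr (1 / p)"
    using weighted_Hardy_Sobolev[OF G p q hardy] unfolding e_def by blast
  have to_G: "(LINT x:G|lborel. F x powr r * infdist x (frontier G) powr a) =
      (LINT x|lborel. F x powr r * infdist x (- G) powr a)"
    if "\<And>x. x \<notin> G \<Longrightarrow> F x = 0" for F :: "'a \<Rightarrow> real" and r a
    unfolding set_lebesgue_integral_def
    using that infdist_frontier_eq_infdist_complement[OF G]
    by (intro Bochner_Integration.integral_cong) (auto simp: indicator_def)
  have "(LINT x:G|lborel. \<bar>f x\<bar> powr q * infdist x (frontier G) powr e) powr (1 / q)
    \<le> C * (LINT x:G|lborel. norm (gradient f x) powr p * infdist x (frontier G) powr \<beta>) powr (1 / p)"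
    if f: "f \<in> test_functions G" for f
  proof -
    have fh: "test_pair G f (\<lambda>x. norm (gradient f x))" by (rule test_pair_of_test_function[OF f])
    then have "f x = 0 \<and> norm (gradient f x) = 0" if "x \<notin> G" for x
      using that unfolding test_pair_def by blast
    then show ?thesis
      using C(2)[OF test_pair_abs[OF fh]] by (simp add: to_G)
  qed
  then show ?thesis using C(1) unfolding admits_Hardy_Sobolev_def e_def by blast
qed

theorem corollary4p1:
  fixes G :: "(real ^ 'n) set" and p q \<beta> :: real
  defines "n \<equiv> real CARD('n)"
  assumes "CARD('n) \<ge> 2"
    and "1 < p" and "p < n" and "p \<le> q" and "q \<le> n * p / (n - p)"
    and "\<beta> < p - 1"
    and "open G" and "G \<noteq> {}" and "frontier G \<noteq> {}"
    and "upper_Assouad_dim (- G) < ereal (n - p + \<beta>) \<or>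
         (lower_Assouad_dim (- G) > ereal (n - p + \<beta>) \<and>
          (\<not> bounded G \<longrightarrow> \<not> bounded (- G)))"
  shows "admits_Hardy_Sobolev q p \<beta> G"
proof -
  have n: "real DIM(real ^ 'n) = n" by (simp add: n_def)
  have ne: "- G \<noteq> {}" using \<open>frontier G \<noteq> {}\<close> 
    by (metis double_compl Compl_empty_eq frontier_UNIV)
  have "Hardy_L1 (p - 1 - \<beta>) G"
    using assms(11)
  proof (elim disjE conjE)
    assume "upper_Assouad_dim (- G) < ereal (n - p + \<beta>)"
    then show ?thesis
      using assms(2,7,8) ne n by (intro Hardy_L1_of_thin_complement) (auto simp: algebra_simps)
  next
    assume low: "ereal (n - p + \<beta>) < lower_Assouad_dim (- G)"
      and unbounded: "\<not> bounded G \<longrightarrow> \<not> bounded (- G)"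
    have "\<not> (bounded G \<and> bounded (- G))"
      by (metis Compl_partition bounded_Un not_bounded_UNIV)
    then have "\<not> bounded (- G)" using unbounded by blast
    then show ?thesis
      using low assms(2,7,8) n by (intro Hardy_L1_of_fat_complement) (auto simp: algebra_simps)
  qed
  then show ?thesis
    using assms(3-6,8) ne n by (intro admits_Hardy_Sobolev_of_Hardy_L1) auto
qed

end
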